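(* Let $\Lambda$ be a metric tree with $N$ edges, let $T>0$ and $M$ be constants, and let $\{\varphi_j\}_{j=1}^N$ be a group of weight functions on $\Lambda$ as described in the context. Let $\omega\ge 0$ and let $\phi$ be a real constant. Assume that $f_j=F_j(x)e^{-i(\omega t+\phi)}$ for $j\in\mathcal N$ and that $\{p_j\}_{j=1}^N\in\mathcal U(M)$. If $$\{u_j=U_j(x)e^{-i(\omega t+\phi)}\}_{j=1}^N\in\bigoplus_{j=1}^N H^1(-T,T;H^2(\mathcal I_j))$$ is a solution of the Schr\"odinger equations on the tree $$i\partial_t u_j+\partial_x^2u_j+p_ju_j=f_j\quad\text{in }\mathcal I_j\times(-T,T),\qquad j=1,\dots,N,$$ with the inner vertex conditions $$u_{j_1}(x(V_k),t)=u_{j_2}(x(V_k),t)\ \ (j_1,j_2\in S_{T,k}\cup S_{I,k}),\qquad \sum_{j\in S_{T,k}}\partial_xu_j(x(V_k),t)=\sum_{j\in S_{I,k}}\partial_xu_j(x(V_k),t),\qquad k\in\Pi_2,$$ and the boundary conditions $$u_j(x(V_0),t)=0\ \ (j\in S_{I,0}),\qquad u_j(x(V_k),t)=0\ \ (j\in S_{T,k},\ k\in\Pi_1\setminus\{0\}),\qquad t\in[-T,T],$$ then there exists a constant $s_0\ge 0$ such that for all $s>s_0$ $$\sum_{j=1}^N\int_{Q_j}\left(s^3\theta^3|u_j|^2+s\theta|\partial_xu_j|^2\right)e^{2s\varphi_j}\,dx\,dt\le C\left(\sum_{j=1}^N\int_{Q_j}|f_j|^2e^{2s\varphi_j}\,dx\,dt+B\right),$$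 where $Q_j=\mathcal I_j\times(-T,T)$, $$B=\sum_{k\in\Pi_1}\int_{-T}^T\left(\sum_{j\in S_{T,k}}\theta|\partial_xu_j|^2e^{2s\varphi_j}-\sum_{j\in S_{I,k}}\theta|\partial_xu_j|^2e^{2s\varphi_j}\right)\Big|_{x=x(V_k)}\,dt,$$ and $C=C(\Lambda,M,T,s_0,\{\varphi_j\}_{j=1}^N)$ is a constant independent of $\{p_j\}_{j=1}^N$ and $s$.
   Context: Tree. $\Lambda$ is a tree-shaped graph with $N$ edges $\{E_j\}_{j\in\mathcal N}$ (of finite positive lengths) and $N+1$ vertices $\{V_j\}_{j\in\mathcal N^0}$, where $\mathcal N=\{1,\dots,N\}$ and $\mathcal N^0=\mathcal N\cup\{0\}$. The root vertex $V_0$ is a boundary vertex, i.e. it belongs to exactly one edge. Each point $A\in\Lambda$ has the coordinate $x(A)$, the length of the path from $V_0$ to $A$. If $V_{k_1},V_{k_2}$ are the two vertices of an edge $E_j$ and $x(V_{k_1})<x(V_{k_2})$, then $V_{k_1}$ is called the initial node $I_j$ and $V_{k_2}$ the terminal node $T_j$ of $E_j$. The edge $E_j$ is identified with the interval $\mathcal I_j=(x(I_j),x(T_j))$. (The constant $T>0$ is the time horizon and is unrelated to the nodes $T_j$.) Index sets. $S_{I,k}=\{j\in\mathcal N: I_j=V_k\}$ and $S_{T,k}=\{j\in\mathcal N: T_j=V_k\}$ for $k\in\mathcal N^0$; $\Pi_1=\{k\in\mathcal N^0:|S_{I,k}|+|S_{T,k}|=1\}$ (boundary vertices); $\Pi_2=\{k\in\mathcal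 N^0:|S_{I,k}|+|S_{T,k}|>1\}$ (inner vertices). Potentials. $\mathcal U(M)=\bigoplus_{j=1}^N\{p\in L^\infty(\mathcal I_j):\|p\|_{L^\infty(\mathcal I_j)}\le M\}$. Here $i=\sqrt{-1}$ and the functions $u_j,f_j$ are complex-valued. Weight functions. $\theta=\theta(t)=\frac{1}{(T-t)(T+t)}$ and $\varphi_j(x,t)=\theta(t)\psi_j(x)$, where $\psi_j(x)=a_jx^2+b_jx+c_j$, $j\in\mathcal N$, with real coefficients chosen so that, for every $k\in\Pi_2$, - $\varphi_{j_1}(x(V_k),t)=\varphi_{j_2}(x(V_k),t)$ for $j_1,j_2\in S_{T,k}\cup S_{I,k}$, - $\partial_x\varphi_{j_1}(x(V_k),t)=|S_{I,k}|\,\partial_x\varphi_{j_2}(x(V_k),t)$ for $j_1\in S_{T,k}$, $j_2\in S_{I,k}$, - $\partial_x^2\varphi_{j_1}(x(V_k),t)=|S_{I,k}|^2\,\partial_x^2\varphi_{j_2}(x(V_k),t)$ for $j_1\in S_{T,k}$, $j_2\in S_{I,k}$, and, for $j=1,\dots,N$, $\varphi_j<0$, $\partial_x\varphi_j>0$, $\partial_x^2\varphi_j>0$ on $\overline{\mathcal I_j}\times(-T,T)$. *)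

theory Defs
  imports "HOL-Analysis.Analysis" "HOL-Probability.Essential_Supremum"
begin

text \<open>Vertices are \<open>0, \<dots>, nedges\<close> with root \<open>0\<close>; edges are \<open>1, \<dots>, nedges\<close>.\<close>

record metric_graph =
  nedges :: nat
  ends :: "nat \<Rightarrow> nat set"
  len :: "nat \<Rightarrow> real"

definition edges :: "metric_graph \<Rightarrow> nat set" where
  "edges \<Lambda> = {1..nedges \<Lambda>}"

definition verts :: "metric_graph \<Rightarrow> nat set" where
  "verts \<Lambda> = {0..nedges \<Lambda>}"

text \<open>A walk is described by the list of the edges it traverses.\<close>

fun walk :: "metric_graph \<Rightarrow> nat \<Rightarrow> nat list \<Rightarrow> nat \<Rightarrow> bool" where
  "walk \<Lambda> v [] w \<longleftrightarrow> v = w"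
| "walk \<Lambda> v (j # js) w \<longleftrightarrow> j \<in> edges \<Lambda> \<and> (\<exists>v'. ends \<Lambda> j = {v, v'} \<and> walk \<Lambda> v' js w)"

text \<open>Connected, without cycles (closed walks that repeat no edge), rooted at a boundary vertex.\<close>

definition metric_tree :: "metric_graph \<Rightarrow> bool" where
  "metric_tree \<Lambda> \<longleftrightarrow>
     (\<forall>j\<in>edges \<Lambda>. ends \<Lambda> j \<subseteq> verts \<Lambda> \<and> card (ends \<Lambda> j) = 2 \<and> len \<Lambda> j > 0) \<and>
     (\<forall>v\<in>verts \<Lambda>. \<forall>w\<in>verts \<Lambda>. \<exists>js. walk \<Lambda> v js w) \<and>
     (\<forall>v\<in>verts \<Lambda>. \<forall>js. walk \<Lambda> v js v \<and> distinct js \<longrightarrow> js = []) \<and>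
     card {j \<in> edges \<Lambda>. 0 \<in> ends \<Lambda> j} = 1"

text \<open>The coordinate \<open>x(V\<^sub>k)\<close>: in a tree the path (walk without repeated edges) is unique.\<close>

definition coord :: "metric_graph \<Rightarrow> nat \<Rightarrow> real" where
  "coord \<Lambda> k = sum_list (map (len \<Lambda>) (THE js. walk \<Lambda> 0 js k \<and> distinct js))"

definition ini :: "metric_graph \<Rightarrow> nat \<Rightarrow> nat" where
  "ini \<Lambda> j = (THE v. \<exists>w. ends \<Lambda> j = {v, w} \<and> coord \<Lambda> v < coord \<Lambda> w)"

definition ter :: "metric_graph \<Rightarrow> nat \<Rightarrow> nat" where
  "ter \<Lambda> j = (THE w. \<exists>v. ends \<Lambda> j = {v, w} \<and> coord \<Lambda> v < coord \<Lambda> w)"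

abbreviation lft :: "metric_graph \<Rightarrow> nat \<Rightarrow> real" where
  "lft \<Lambda> j \<equiv> coord \<Lambda> (ini \<Lambda> j)"

abbreviation rgt :: "metric_graph \<Rightarrow> nat \<Rightarrow> real" where
  "rgt \<Lambda> j \<equiv> coord \<Lambda> (ter \<Lambda> j)"

definition S_I :: "metric_graph \<Rightarrow> nat \<Rightarrow> nat set" where
  "S_I \<Lambda> k = {j \<in> edges \<Lambda>. ini \<Lambda> j = k}"

definition S_T :: "metric_graph \<Rightarrow> nat \<Rightarrow> nat set" where
  "S_T \<Lambda> k = {j \<in> edges \<Lambda>. ter \<Lambda> j = k}"

definition boundary_verts :: "metric_graph \<Rightarrow> nat set" where
  "boundary_verts \<Lambda> = {k \<in> verts \<Lambda>. card (S_I \<Lambda> k) + card (S_T \<Lambda> k) = 1}"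

definition inner_verts :: "metric_graph \<Rightarrow> nat set" where
  "inner_verts \<Lambda> = {k \<in> verts \<Lambda>. card (S_I \<Lambda> k) + card (S_T \<Lambda> k) > 1}"

definition cyl :: "metric_graph \<Rightarrow> real \<Rightarrow> nat \<Rightarrow> (real \<times> real) set" where
  "cyl \<Lambda> T j = {lft \<Lambda> j<..<rgt \<Lambda> j} \<times> {-T<..<T}"

definition theta :: "real \<Rightarrow> real \<Rightarrow> real" where
  "theta T t = 1 / ((T - t) * (T + t))"

definition weight ::
  "real \<Rightarrow> (nat \<Rightarrow> real) \<Rightarrow> (nat \<Rightarrow> real) \<Rightarrow> (nat \<Rightarrow> real) \<Rightarrow> nat \<Rightarrow> real \<Rightarrow> real \<Rightarrow> real" where
  "weight T a b c j x t = theta T t * (a j * x^2 + b j * x + c j)"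

definition weight_functions ::
  "metric_graph \<Rightarrow> real \<Rightarrow> (nat \<Rightarrow> real \<Rightarrow> real \<Rightarrow> real) \<Rightarrow> bool" where
  "weight_functions \<Lambda> T \<phi> \<longleftrightarrow>
     (\<exists>a b c. \<phi> = weight T a b c) \<and>
     (\<forall>k\<in>inner_verts \<Lambda>. \<forall>t\<in>{-T<..<T}.
        (\<forall>j1\<in>S_T \<Lambda> k \<union> S_I \<Lambda> k. \<forall>j2\<in>S_T \<Lambda> k \<union> S_I \<Lambda> k.
           \<phi> j1 (coord \<Lambda> k) t = \<phi> j2 (coord \<Lambda> k) t) \<and>
        (\<forall>j1\<in>S_T \<Lambda> k. \<forall>j2\<in>S_I \<Lambda> k.
           deriv (\<lambda>x. \<phi> j1 x t) (coord \<Lambda> k)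
             = real (card (S_I \<Lambda> k)) * deriv (\<lambda>x. \<phi> j2 x t) (coord \<Lambda> k)) \<and>
        (\<forall>j1\<in>S_T \<Lambda> k. \<forall>j2\<in>S_I \<Lambda> k.
           deriv (deriv (\<lambda>x. \<phi> j1 x t)) (coord \<Lambda> k)
             = (real (card (S_I \<Lambda> k)))^2 * deriv (deriv (\<lambda>x. \<phi> j2 x t)) (coord \<Lambda> k))) \<and>
     (\<forall>j\<in>edges \<Lambda>. \<forall>x\<in>{lft \<Lambda> j..rgt \<Lambda> j}. \<forall>t\<in>{-T<..<T}.
        \<phi> j x t < 0 \<and> deriv (\<lambda>x. \<phi> j x t) x > 0 \<and> deriv (deriv (\<lambda>x. \<phi> j x t)) x > 0)"

definition potentials :: "metric_graph \<Rightarrow> real \<Rightarrow> (nat \<Rightarrow> real \<Rightarrow> complex) set" where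
  "potentials \<Lambda> M = {p. \<forall>j\<in>edges \<Lambda>.
     p j \<in> borel_measurable (lebesgue_on {lft \<Lambda> j<..<rgt \<Lambda> j}) \<and>
     esssup (lebesgue_on {lft \<Lambda> j<..<rgt \<Lambda> j}) (\<lambda>x. ereal (norm (p j x))) \<le> ereal M}"

definition L2_fun :: "'a::euclidean_space set \<Rightarrow> ('a \<Rightarrow> complex) \<Rightarrow> bool" where
  "L2_fun S g \<longleftrightarrow> g \<in> borel_measurable (lebesgue_on S) \<and>
     integrable (lebesgue_on S) (\<lambda>z. (norm (g z))^2)"

text \<open>\<open>h\<close> is the weak derivative of \<open>g\<close> on the interval \<open>(a,b)\<close>. As usual in dimension one,
  the test functions are the compactly supported functions of class \<open>C\<^sup>1\<close>.\<close>

definition test_fun :: "real \<Rightarrow> real \<Rightarrow> (real \<Rightarrow> real) \<Rightarrow> bool" where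
  "test_fun a b \<eta> \<longleftrightarrow>
     (\<forall>x. \<eta> differentiable (at x)) \<and> continuous_on UNIV (deriv \<eta>) \<and>
     (\<exists>c d. a < c \<and> d < b \<and> (\<forall>x. x \<notin> {c..d} \<longrightarrow> \<eta> x = 0))"

definition weak_deriv :: "real \<Rightarrow> real \<Rightarrow> (real \<Rightarrow> complex) \<Rightarrow> (real \<Rightarrow> complex) \<Rightarrow> bool" where
  "weak_deriv a b g h \<longleftrightarrow> (\<forall>\<eta>. test_fun a b \<eta> \<longrightarrow>
     (LINT x|lebesgue_on {a<..<b}. deriv \<eta> x *\<^sub>R g x)
       = - (LINT x|lebesgue_on {a<..<b}. \<eta> x *\<^sub>R h x))"

text \<open>\<open>u\<close> belongs to \<open>L\<^sup>2(-T,T; H\<^sup>2(a,b))\<close>, with \<open>ux\<close>, \<open>uxx\<close> jointly measurable representatives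
  of its weak derivatives in the space variable.\<close>

definition L2_H2 :: "real \<Rightarrow> real \<Rightarrow> real \<Rightarrow> (real \<Rightarrow> real \<Rightarrow> complex) \<Rightarrow>
    (real \<Rightarrow> real \<Rightarrow> complex) \<Rightarrow> (real \<Rightarrow> real \<Rightarrow> complex) \<Rightarrow> bool" where
  "L2_H2 a b T u ux uxx \<longleftrightarrow>
     (\<forall>g\<in>{u, ux, uxx}. L2_fun ({a<..<b} \<times> {-T<..<T}) (\<lambda>(x, t). g x t)) \<and>
     (AE t in lebesgue_on {-T<..<T}.
        weak_deriv a b (\<lambda>x. u x t) (\<lambda>x. ux x t) \<and> weak_deriv a b (\<lambda>x. ux x t) (\<lambda>x. uxx x t))"

text \<open>\<open>u\<close> belongs to \<open>H\<^sup>1(-T,T; H\<^sup>2(a,b))\<close>, with \<open>uxx\<close>, \<open>ut\<close> representatives of its weak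
  derivatives \<open>\<partial>\<^sub>x\<^sup>2u\<close> and \<open>\<partial>\<^sub>tu\<close>. Every class in this space has a unique representative that is
  continuous on \<open>[a,b] \<times> [-T,T]\<close>. The function \<open>u\<close> is required to be that representative,
  so that its values at the vertices are point values.\<close>

definition H1_H2 :: "real \<Rightarrow> real \<Rightarrow> real \<Rightarrow> (real \<Rightarrow> real \<Rightarrow> complex) \<Rightarrow>
    (real \<Rightarrow> real \<Rightarrow> complex) \<Rightarrow> (real \<Rightarrow> real \<Rightarrow> complex) \<Rightarrow> bool" where
  "H1_H2 a b T u uxx ut \<longleftrightarrow>
     (\<exists>ux. L2_H2 a b T u ux uxx) \<and>
     (\<exists>utx utxx. L2_H2 a b T ut utx utxx) \<and>
     (AE x in lebesgue_on {a<..<b}. weak_deriv (-T) T (u x) (ut x)) \<and>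
     continuous_on ({a..b} \<times> {-T..T}) (\<lambda>(x, t). u x t)"

text \<open>Since \<open>H\<^sup>2(a,b)\<close> is contained in \<open>C\<^sup>1([a,b])\<close>, the first space derivative of the continuous
  representative is classical, and one-sided at the two end points.\<close>

definition dx :: "metric_graph \<Rightarrow> (nat \<Rightarrow> real \<Rightarrow> real \<Rightarrow> complex) \<Rightarrow> nat \<Rightarrow> real \<Rightarrow> real \<Rightarrow> complex" where
  "dx \<Lambda> u j x t = vector_derivative (\<lambda>y. u j y t) (at x within {lft \<Lambda> j..rgt \<Lambda> j})"

definition schroedinger_solution :: "metric_graph \<Rightarrow> real \<Rightarrow> (nat \<Rightarrow> real \<Rightarrow> complex) \<Rightarrow>
    (nat \<Rightarrow> real \<Rightarrow> real \<Rightarrow> complex) \<Rightarrow> (nat \<Rightarrow> real \<Rightarrow> real \<Rightarrow> complex) \<Rightarrow> bool" where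
  "schroedinger_solution \<Lambda> T p f u \<longleftrightarrow>
     (\<forall>j\<in>edges \<Lambda>. \<exists>uxx ut. H1_H2 (lft \<Lambda> j) (rgt \<Lambda> j) T (u j) uxx ut \<and>
        (AE (x, t) in lebesgue_on (cyl \<Lambda> T j).
           \<i> * ut x t + uxx x t + p j x * u j x t = f j x t)) \<and>
     (\<forall>k\<in>inner_verts \<Lambda>. \<forall>t\<in>{-T..T}.
        (\<forall>j1\<in>S_T \<Lambda> k \<union> S_I \<Lambda> k. \<forall>j2\<in>S_T \<Lambda> k \<union> S_I \<Lambda> k.
           u j1 (coord \<Lambda> k) t = u j2 (coord \<Lambda> k) t) \<and>
        (\<Sum>j\<in>S_T \<Lambda> k. dx \<Lambda> u j (coord \<Lambda> k) t) = (\<Sum>j\<in>S_I \<Lambda> k. dx \<Lambda> u j (coord \<Lambda> k) t)) \<and>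
     (\<forall>j\<in>S_I \<Lambda> 0. \<forall>t\<in>{-T..T}. u j (coord \<Lambda> 0) t = 0) \<and>
     (\<forall>k\<in>boundary_verts \<Lambda> - {0}. \<forall>j\<in>S_T \<Lambda> k. \<forall>t\<in>{-T..T}. u j (coord \<Lambda> k) t = 0)"

definition boundary_term :: "metric_graph \<Rightarrow> real \<Rightarrow> (nat \<Rightarrow> real \<Rightarrow> real \<Rightarrow> real) \<Rightarrow>
    (nat \<Rightarrow> real \<Rightarrow> real \<Rightarrow> complex) \<Rightarrow> real \<Rightarrow> real" where
  "boundary_term \<Lambda> T \<phi> u s =
     (\<Sum>k\<in>boundary_verts \<Lambda>. LINT t|lebesgue_on {-T<..<T}.
        (\<Sum>j\<in>S_T \<Lambda> k. theta T t * (norm (dx \<Lambda> u j (coord \<Lambda> k) t))^2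
            * exp (2 * s * \<phi> j (coord \<Lambda> k) t))
      - (\<Sum>j\<in>S_I \<Lambda> k. theta T t * (norm (dx \<Lambda> u j (coord \<Lambda> k) t))^2
            * exp (2 * s * \<phi> j (coord \<Lambda> k) t)))"

end

theory Submission
  imports Defs
begin

text \<open>A time-harmonic solution \<open>u\<^sub>j = U\<^sub>j exp (- i (\<omega> t + \<phi>))\<close> solves the ordinary differential
  equation \<open>U'' + (\<omega> + p) U = F\<close> on every edge, and time enters the estimate only as the parameter
  \<open>\<tau> = s \<theta>(t)\<close> of the weight \<open>e = exp (2 \<tau> \<psi>)\<close>. The proof is an energy estimate for this equation, in
  which the exponential weight, with \<open>\<psi>' \<ge> \<mu> > 0\<close>, absorbs all lower order terms.

  The energy is \<open>G = |U'|\<^sup>2 + (\<omega> + \<kappa>) |U|\<^sup>2\<close> with the artificial mass \<open>\<kappa> = (\<mu>\<tau>/4)\<^sup>2\<close>. Its derivative is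
  twice the real part of the product of \<open>F - p U + \<kappa> U\<close> with the conjugate of \<open>U'\<close>. The frequency has
  cancelled, whence the uniformity in \<open>\<omega>\<close>. The term with \<open>\<kappa>\<close> is at most \<open>\<mu>\<tau>/4\<close> times \<open>G\<close>, while
  differentiating the weight gains \<open>2 \<mu> \<tau> G\<close>. As \<open>\<kappa>\<close> is comparable to \<open>\<tau>\<^sup>2\<close>, the gain controls
  \<open>\<tau>\<^sup>3 |U|\<^sup>2 + \<tau> |U'|\<^sup>2\<close>, at the price of \<open>|F|\<^sup>2 / \<tau>\<close> and of the values of \<open>e G\<close> at the two end points
  of the edge (\<open>weighted_energy_inequality\<close>).

  These boundary values have to be summed over the vertices. A branching vertex has a single incoming
  edge, and Kirchhoff's law bounds \<open>|U'|\<^sup>2\<close> on it only by \<open>n\<close> times the sum over the \<open>n\<close> outgoing edges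
  (\<open>inner_vertex_energy\<close>). The factor is recovered on the edges: the additional weight that decreases
  exponentially from \<open>1\<close> to \<open>1/n\<close> along each edge changes the logarithmic derivative of the weight by a
  constant, which is absorbed for large \<open>\<tau>\<close> (\<open>edge_carleman_inequality\<close>). What remains are the vertices
  of degree one, where \<open>U\<close> vanishes: at the root the coefficient is \<open>1\<close>, at the leaves it is \<open>1/n \<le> 1\<close>
  (\<open>tree_carleman_inequality\<close>). That the incoming edge is unique, and that \<open>1/n\<close> is found
  at the leaves and not at the root, is a property of trees (\<open>ter_bij\<close>).

  Finally the estimate for fixed \<open>t\<close> is multiplied by \<open>\<theta>(t)\<close>, which is bounded below by \<open>1/T\<^sup>2\<close>, and
  integrated in time. Since \<open>\<theta>/\<tau> = 1/s\<close>, this yields the boundary term with the factor \<open>\<theta>\<close> and without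
  \<open>s\<close>.

  The energy argument needs \<open>U\<close> to be continuously differentiable up to the vertices, with an absolutely
  continuous derivative. This is extracted from the weak derivatives in \<open>time_harmonic_edge_profile\<close>:
  for almost every time the weak second space derivative is a function in \<open>L\<^sup>2\<close>, and by a lemma of
  du Bois-Reymond the solution differs from a double primitive of it by an affine function only.\<close>

section \<open>Paths, coordinates and nodes in a metric tree\<close>

lemma walk_append: "walk \<Lambda> v (ps @ qs) w \<longleftrightarrow> (\<exists>z. walk \<Lambda> v ps z \<and> walk \<Lambda> z qs w)"
  by (induction ps arbitrary: v) auto

lemma walk_singleton: "walk \<Lambda> v [j] w \<longleftrightarrow> j \<in> edges \<Lambda> \<and> ends \<Lambda> j = {v, w}"
  by auto

lemma walk_rev: "walk \<Lambda> v ps w \<Longrightarrow> walk \<Lambda> w (rev ps) v"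
proof (induction ps arbitrary: v)
  case (Cons j js)
  then obtain z where z: "j \<in> edges \<Lambda>" "ends \<Lambda> j = {v, z}" "walk \<Lambda> z js w" by auto
  then have "walk \<Lambda> w (rev js) z" "walk \<Lambda> z [j] v"
    using Cons.IH by (auto simp: insert_commute)
  then show ?case unfolding rev.simps walk_append by blast
qed auto

lemma walk_split:
  assumes "walk \<Lambda> v ps w" "j \<in> set ps"
  obtains qs x y rs where "ps = qs @ j # rs" "j \<notin> set qs" "walk \<Lambda> v qs x" "ends \<Lambda> j = {x, y}"
    "walk \<Lambda> y rs w" "j \<in> edges \<Lambda>"
proof -
  obtain qs rs where ps: "ps = qs @ j # rs" "j \<notin> set qs"
    using split_list_first[OF assms(2)] by blast
  then obtain x where "walk \<Lambda> v qs x" "walk \<Lambda> x (j # rs) w"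
    using assms(1) by (auto simp only: walk_append)
  then show thesis using that ps by auto
qed

text \<open>A walk of minimal length repeats no edge: between two passages through the same edge, in
  either direction, it can be shortened.\<close>

lemma ex_distinct_walk:
  assumes "walk \<Lambda> v ps w"
  shows "\<exists>qs. walk \<Lambda> v qs w \<and> distinct qs"
  using assms
proof (induction "length ps" arbitrary: ps rule: less_induct)
  case less
  show ?case
  proof (cases "distinct ps")
    case True
    then show ?thesis using less.prems by blast
  next
    case False
    then obtain as j bs cs where ps: "ps = as @ [j] @ bs @ [j] @ cs"
      using not_distinct_decomp by blast
    from less.prems obtain x y where 1: "walk \<Lambda> v as x" "ends \<Lambda> j = {x, y}" "j \<in> edges \<Lambda>"
        "walk \<Lambda> y (bs @ [j] @ cs) w"
      unfolding ps walk_append walk_singleton by blast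
    then obtain x' y' where 2: "walk \<Lambda> y bs x'" "ends \<Lambda> j = {x', y'}" "walk \<Lambda> y' cs w"
      unfolding walk_append walk_singleton by blast
    from 1(2) 2(2) consider "x' = x" "y' = y" | "x' = y" "y' = x"
      by (metis doubleton_eq_iff)
    then show ?thesis
    proof cases
      case 1
      with \<open>walk \<Lambda> v as x\<close> \<open>ends \<Lambda> j = {x, y}\<close> \<open>j \<in> edges \<Lambda>\<close> 2(3)
      have "walk \<Lambda> v (as @ j # cs) w" by (auto simp: walk_append)
      moreover have "length (as @ j # cs) < length ps" unfolding ps by simp
      ultimately show ?thesis using less.hyps by blast
    next
      case 2
      with \<open>walk \<Lambda> v as x\<close> \<open>walk \<Lambda> y' cs w\<close> have "walk \<Lambda> v (as @ cs) w"
        by (auto simp: walk_append)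
      moreover have "length (as @ cs) < length ps" unfolding ps by simp
      ultimately show ?thesis using less.hyps by blast
    qed
  qed
qed

text \<open>Two different paths with the same end points would enclose a cycle. The cycle is closed at the
  first edge \<open>j\<close> of one path that the other path uses as well. If both paths traverse \<open>j\<close> in the same
  direction, their initial segments before \<open>j\<close> form a closed walk without repeated edges, hence are
  empty, and induction applies to the rest. If they traverse \<open>j\<close> in opposite directions, the two
  initial segments together with \<open>j\<close> form such a walk, which is impossible.\<close>

lemma path_unique:
  assumes tree: "metric_tree \<Lambda>"
    and "walk \<Lambda> v ps w" "distinct ps" "walk \<Lambda> v qs w" "distinct qs" "v \<in> verts \<Lambda>"
  shows "ps = qs"
  using assms(2-)
proof (induction ps arbitrary: v qs)
  case Nil
  then show ?case using tree unfolding metric_tree_def by auto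
next
  case (Cons i ps')
  define ps where "ps = i # ps'"
  have acyc: "\<And>js. walk \<Lambda> v js v \<Longrightarrow> distinct js \<Longrightarrow> js = []"
    using tree Cons.prems(5) unfolding metric_tree_def by blast
  have ps: "walk \<Lambda> v ps w" "distinct ps" using Cons.prems ps_def by auto
  have "\<exists>j\<in>set ps. j \<in> set qs"
  proof (rule ccontr)
    assume "\<not> ?thesis"
    moreover have "walk \<Lambda> v (ps @ rev qs) v"
      using ps(1) walk_rev[OF Cons.prems(3)] unfolding walk_append by blast
    ultimately have "ps @ rev qs = []"
      by (intro acyc) (use ps Cons.prems in auto)
    then show False by (simp add: ps_def)
  qed
  then obtain as j bs where split: "ps = as @ j # bs" "j \<in> set qs" "\<forall>a\<in>set as. a \<notin> set qs"
    using split_list_first_prop[of ps "\<lambda>j. j \<in> set qs"] by blast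
  obtain x y where x: "walk \<Lambda> v as x" "ends \<Lambda> j = {x, y}" "j \<in> edges \<Lambda>" "walk \<Lambda> y bs w"
    using ps(1) unfolding split(1) walk_append by auto
  obtain cs x' y' ds where qs: "qs = cs @ j # ds" "walk \<Lambda> v cs x'" "ends \<Lambda> j = {x', y'}" "walk \<Lambda> y' ds w"
    using walk_split[OF Cons.prems(3) split(2)] by metis
  consider "x' = x" "y' = y" | "x' = y" "y' = x" using x(2) qs(3) by (metis doubleton_eq_iff)
  then show ?case
  proof cases
    case 1
    have "walk \<Lambda> v (as @ rev cs) v"
      using x(1) walk_rev[OF qs(2)] 1 unfolding walk_append by blast
    then have "as @ rev cs = []"
      by (rule acyc) (use split qs ps Cons.prems in auto)
    then have eq: "as = []" "cs = []" by auto
    then have i: "i = j" "ps' = bs" using split(1) ps_def by auto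
    have "v = x" using x(1) eq by simp
    then have "y \<in> verts \<Lambda>" using tree x unfolding metric_tree_def by blast
    then have "bs = ds"
      using Cons.IH[of y ds] x qs i ps(2) Cons.prems 1 by (auto simp: ps_def)
    then show ?thesis using i qs eq by simp
  next
    case 2
    have "walk \<Lambda> v (as @ [j] @ rev cs) v"
      using x walk_rev[OF qs(2)] 2 unfolding walk_append walk_singleton by blast
    then have "as @ [j] @ rev cs = []"
      by (rule acyc) (use split qs ps Cons.prems in auto)
    then show ?thesis by simp
  qed
qed

lemma zero_in_verts: "0 \<in> verts \<Lambda>"
  by (simp add: verts_def)

definition path_to :: "metric_graph \<Rightarrow> nat \<Rightarrow> nat list" where
  "path_to \<Lambda> k = (THE js. walk \<Lambda> 0 js k \<and> distinct js)"

lemma coord_path_to: "coord \<Lambda> k = sum_list (map (len \<Lambda>) (path_to \<Lambda> k))"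
  by (simp add: coord_def path_to_def)

lemma path_to_eq:
  assumes "metric_tree \<Lambda>" "walk \<Lambda> 0 js k" "distinct js"
  shows "path_to \<Lambda> k = js"
  unfolding path_to_def using assms path_unique[OF assms(1)] zero_in_verts by blast

lemma path_to:
  assumes "metric_tree \<Lambda>" "k \<in> verts \<Lambda>"
  shows "walk \<Lambda> 0 (path_to \<Lambda> k) k" "distinct (path_to \<Lambda> k)"
proof -
  obtain js where "walk \<Lambda> 0 js k"
    using assms zero_in_verts unfolding metric_tree_def by blast
  then obtain qs where "walk \<Lambda> 0 qs k" "distinct qs" using ex_distinct_walk by blast
  then show "walk \<Lambda> 0 (path_to \<Lambda> k) k" "distinct (path_to \<Lambda> k)"
    using path_to_eq[OF assms(1)] by auto
qed

text \<open>If the path to one end point of an edge runs through that edge, it does so in its last step, for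
  otherwise it would return to the same vertex. If it does not, the edge prolongs it to the path to the
  other end point.\<close>

lemma edge_extends_path:
  assumes tree: "metric_tree \<Lambda>" and j: "j \<in> edges \<Lambda>" "ends \<Lambda> j = {v, w}"
  shows "path_to \<Lambda> w = path_to \<Lambda> v @ [j] \<or> path_to \<Lambda> v = path_to \<Lambda> w @ [j]"
proof -
  have v: "v \<in> verts \<Lambda>" "w \<in> verts \<Lambda>" using tree j unfolding metric_tree_def by auto
  note pv = path_to[OF tree v(1)]
  show ?thesis
  proof (cases "j \<in> set (path_to \<Lambda> v)")
    case False
    have "walk \<Lambda> 0 (path_to \<Lambda> v @ [j]) w"
      using pv(1) j unfolding walk_append walk_singleton by blast
    moreover have "distinct (path_to \<Lambda> v @ [j])" using False pv(2) by simp
    ultimately have "path_to \<Lambda> w = path_to \<Lambda> v @ [j]" by (rule path_to_eq[OF tree])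
    then show ?thesis ..
  next
    case True
    obtain qs x y rs where s: "path_to \<Lambda> v = qs @ j # rs" "walk \<Lambda> 0 qs x"
      "ends \<Lambda> j = {x, y}" "walk \<Lambda> y rs v"
      using walk_split[OF pv(1) True] by metis
    have d: "distinct qs" "distinct rs" using pv(2) s(1) by auto
    consider "x = v" "y = w" | "x = w" "y = v" using j(2) s(3) by (metis doubleton_eq_iff)
    then show ?thesis
    proof cases
      case 1
      then have "path_to \<Lambda> v = qs" using path_to_eq[OF tree] s(2) d by blast
      then show ?thesis using s(1) by simp
    next
      case 2
      then have "rs = []" using s(4) d v tree unfolding metric_tree_def by blast
      moreover have "path_to \<Lambda> w = qs" using path_to_eq[OF tree] s(2) d 2 by blast
      ultimately show ?thesis using s(1) by simp
    qed
  qed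
qed

text \<open>Hence the coordinates of the end points of an edge differ by its length, which makes the initial
  and the terminal node well defined.\<close>

lemma ini_ter:
  assumes tree: "metric_tree \<Lambda>" and j: "j \<in> edges \<Lambda>"
  shows "ends \<Lambda> j = {ini \<Lambda> j, ter \<Lambda> j}" "coord \<Lambda> (ini \<Lambda> j) < coord \<Lambda> (ter \<Lambda> j)"
    and ter_eqI: "\<And>v w. ends \<Lambda> j = {v, w} \<Longrightarrow> coord \<Lambda> v < coord \<Lambda> w \<Longrightarrow> ter \<Lambda> j = w"
proof -
  have len: "len \<Lambda> j > 0" and card: "card (ends \<Lambda> j) = 2"
    using tree j unfolding metric_tree_def by auto
  obtain v w where vw: "ends \<Lambda> j = {v, w}" using card by (meson card_2_iff)
  have "\<exists>v w. ends \<Lambda> j = {v, w} \<and> coord \<Lambda> v < coord \<Lambda> w"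
    using edge_extends_path[OF tree j vw]
  proof
    assume "path_to \<Lambda> w = path_to \<Lambda> v @ [j]"
    then have "coord \<Lambda> v < coord \<Lambda> w" using len by (simp add: coord_path_to)
    then show ?thesis using vw by blast
  next
    assume "path_to \<Lambda> v = path_to \<Lambda> w @ [j]"
    then have "coord \<Lambda> w < coord \<Lambda> v" using len by (simp add: coord_path_to)
    then show ?thesis using vw by (metis insert_commute)
  qed
  then obtain v w where vw: "ends \<Lambda> j = {v, w}" "coord \<Lambda> v < coord \<Lambda> w" by blast
  have uniq: "v' = v \<and> w' = w" if "ends \<Lambda> j = {v', w'}" "coord \<Lambda> v' < coord \<Lambda> w'" for v' w'
    using that vw by (metis doubleton_eq_iff order_less_asym)
  have ini: "ini \<Lambda> j = v" unfolding ini_def using vw uniq by blast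
  have ter: "ter \<Lambda> j = w" unfolding ter_def using vw uniq by blast
  show "ends \<Lambda> j = {ini \<Lambda> j, ter \<Lambda> j}" "coord \<Lambda> (ini \<Lambda> j) < coord \<Lambda> (ter \<Lambda> j)"
    using ini ter vw by auto
  show "\<And>v w. ends \<Lambda> j = {v, w} \<Longrightarrow> coord \<Lambda> v < coord \<Lambda> w \<Longrightarrow> ter \<Lambda> j = w"
    using uniq ter by blast
qed

text \<open>The last edge of the path from the root to a vertex has that vertex as its terminal node. As there
  are exactly as many edges as vertices other than the root, no further edge ends there.\<close>

lemma ter_bij:
  assumes tree: "metric_tree \<Lambda>"
  shows "bij_betw (ter \<Lambda>) (edges \<Lambda>) (verts \<Lambda> - {0})"
proof -
  have "\<exists>j\<in>edges \<Lambda>. ter \<Lambda> j = k" if k: "k \<in> verts \<Lambda>" "k \<noteq> 0" for k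
  proof -
    note p = path_to[OF tree k(1)]
    have "path_to \<Lambda> k \<noteq> []" using p(1) k(2) by auto
    then obtain qs j where qs: "path_to \<Lambda> k = qs @ [j]" by (metis rev_exhaust)
    then obtain z where z: "walk \<Lambda> 0 qs z" "j \<in> edges \<Lambda>" "ends \<Lambda> j = {z, k}"
      using p(1) unfolding qs walk_append walk_singleton by blast
    have "path_to \<Lambda> z = qs" using path_to_eq[OF tree z(1)] p(2) qs by auto
    then have "coord \<Lambda> z < coord \<Lambda> k"
      using qs tree z(2) unfolding metric_tree_def by (auto simp: coord_path_to)
    then show ?thesis using ter_eqI[OF tree z(2,3)] z(2) by blast
  qed
  then have sub: "verts \<Lambda> - {0} \<subseteq> ter \<Lambda> ` edges \<Lambda>" by blast
  have c: "card (verts \<Lambda> - {0}) = card (edges \<Lambda>)" "finite (edges \<Lambda>)"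
    by (simp_all add: verts_def edges_def)
  have "card (ter \<Lambda> ` edges \<Lambda>) \<le> card (edges \<Lambda>)" using c(2) by (rule card_image_le)
  then have eq: "verts \<Lambda> - {0} = ter \<Lambda> ` edges \<Lambda>"
    using card_seteq[OF _ sub] c by auto
  moreover have "inj_on (ter \<Lambda>) (edges \<Lambda>)"
    using eq c by (intro eq_card_imp_inj_on) auto
  ultimately show ?thesis by (simp add: bij_betw_def)
qed

lemma S_T_root: "metric_tree \<Lambda> \<Longrightarrow> S_T \<Lambda> 0 = {}"
  using ter_bij[of \<Lambda>] by (auto simp: S_T_def bij_betw_def)

lemma S_T_singleton:
  assumes "metric_tree \<Lambda>" "k \<in> verts \<Lambda>" "k \<noteq> 0"
  shows "\<exists>j. S_T \<Lambda> k = {j}"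
proof -
  have b: "inj_on (ter \<Lambda>) (edges \<Lambda>)" "ter \<Lambda> ` edges \<Lambda> = verts \<Lambda> - {0}"
    using ter_bij[OF assms(1)] by (simp_all add: bij_betw_def)
  have "k \<in> ter \<Lambda> ` edges \<Lambda>" using assms(2,3) unfolding b(2) by simp
  then obtain j where j: "j \<in> edges \<Lambda>" "ter \<Lambda> j = k" by blast
  then have "S_T \<Lambda> k = {j}"
    unfolding S_T_def using inj_onD[OF b(1)] by blast
  then show ?thesis ..
qed

lemma finite_edges [simp]: "finite (edges \<Lambda>)"
  and finite_verts [simp]: "finite (verts \<Lambda>)"
  by (simp_all add: edges_def verts_def)

lemma finite_S_I [simp]: "finite (S_I \<Lambda> k)"
  by (simp add: S_I_def)

lemma root_boundary:
  assumes tree: "metric_tree \<Lambda>"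
  shows "0 \<in> boundary_verts \<Lambda>"
proof -
  have "S_I \<Lambda> 0 = {j \<in> edges \<Lambda>. 0 \<in> ends \<Lambda> j}"
    using ini_ter(1)[OF tree] S_T_root[OF tree] by (auto simp: S_I_def S_T_def)
  moreover have "card {j \<in> edges \<Lambda>. 0 \<in> ends \<Lambda> j} = 1"
    using tree by (simp add: metric_tree_def)
  ultimately show ?thesis
    using S_T_root[OF tree] zero_in_verts by (auto simp: boundary_verts_def)
qed

lemma leaf_S_I:
  assumes "metric_tree \<Lambda>" "k \<in> boundary_verts \<Lambda>" "k \<noteq> 0"
  shows "S_I \<Lambda> k = {}"
proof -
  obtain j where "S_T \<Lambda> k = {j}"
    using S_T_singleton[OF assms(1) _ assms(3)] assms(2) by (auto simp: boundary_verts_def)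
  then show ?thesis using assms(2) by (auto simp: boundary_verts_def)
qed

lemma verts_cases:
  assumes "metric_tree \<Lambda>"
  shows "verts \<Lambda> = boundary_verts \<Lambda> \<union> inner_verts \<Lambda>" "boundary_verts \<Lambda> \<inter> inner_verts \<Lambda> = {}"
proof -
  have "k \<in> boundary_verts \<Lambda> \<union> inner_verts \<Lambda>" if k: "k \<in> verts \<Lambda>" for k
  proof (cases "k = 0")
    case True
    then show ?thesis using root_boundary[OF assms] by simp
  next
    case False
    then obtain j where "S_T \<Lambda> k = {j}" using S_T_singleton[OF assms k] by blast
    then show ?thesis using k by (auto simp: boundary_verts_def inner_verts_def card_gt_0_iff)
  qed
  then show "verts \<Lambda> = boundary_verts \<Lambda> \<union> inner_verts \<Lambda>"
    by (auto simp: boundary_verts_def inner_verts_def)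
  show "boundary_verts \<Lambda> \<inter> inner_verts \<Lambda> = {}"
    by (auto simp: boundary_verts_def inner_verts_def)
qed

text \<open>Summation by parts on the tree: contributions of the end points of edges are regrouped by
  vertices.\<close>

lemma sum_ini_ter:
  fixes g h :: "nat \<Rightarrow> real"
  assumes tree: "metric_tree \<Lambda>"
  shows "(\<Sum>j\<in>edges \<Lambda>. g j - h j) = (\<Sum>k\<in>verts \<Lambda>. (\<Sum>j\<in>S_T \<Lambda> k. g j) - (\<Sum>j\<in>S_I \<Lambda> k. h j))"
proof -
  have "ini \<Lambda> ` edges \<Lambda> \<subseteq> verts \<Lambda>" "ter \<Lambda> ` edges \<Lambda> \<subseteq> verts \<Lambda>"
    using ini_ter(1)[OF tree] tree unfolding metric_tree_def by auto
  then have "sum g (edges \<Lambda>) = (\<Sum>k\<in>verts \<Lambda>. sum g (S_T \<Lambda> k))"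
    "sum h (edges \<Lambda>) = (\<Sum>k\<in>verts \<Lambda>. sum h (S_I \<Lambda> k))"
    unfolding S_T_def S_I_def
    using sum.group[OF finite_edges finite_verts, of "ter \<Lambda>" \<Lambda> \<Lambda> g]
      sum.group[OF finite_edges finite_verts, of "ini \<Lambda>" \<Lambda> \<Lambda> h] by simp_all
  then show ?thesis by (simp add: sum_subtractf)
qed

section \<open>Primitives of Lebesgue integrable functions\<close>

text \<open>This is absolute continuity of \<open>F\<close> with density \<open>f\<close>. The integral form makes the calculus below
  independent of the almost everywhere differentiability of \<open>F\<close>.\<close>

definition lebesgue_primitive :: "real \<Rightarrow> real \<Rightarrow> (real \<Rightarrow> real) \<Rightarrow> (real \<Rightarrow> real) \<Rightarrow> bool" where
  "lebesgue_primitive a b F f \<longleftrightarrow> f absolutely_integrable_on {a..b} \<and>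
     (\<forall>x\<in>{a..b}. F x = F a + integral {a..x} f)"

lemma lebesgue_primitiveD:
  assumes "lebesgue_primitive a b F f"
  shows "f absolutely_integrable_on {a..b}" "x \<in> {a..b} \<Longrightarrow> F x = F a + integral {a..x} f"
  using assms unfolding lebesgue_primitive_def by blast+

lemma absolutely_integrable_continuous_mult:
  fixes f g :: "real \<Rightarrow> real"
  assumes "continuous_on {a..b} g" "f absolutely_integrable_on {a..b}"
  shows "(\<lambda>x. g x * f x) absolutely_integrable_on {a..b}"
proof (rule absolutely_integrable_bounded_measurable_product_real)
  show "g \<in> borel_measurable (lebesgue_on {a..b})"
    by (rule continuous_imp_measurable_on_sets_lebesgue[OF assms(1)]) simp
  show "bounded (g ` {a..b})"
    using assms(1) compact_continuous_image compact_imp_bounded by blast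
qed (use assms in auto)

lemma lebesgue_primitive_diff:
  assumes "lebesgue_primitive a b F f" "a \<le> x" "x \<le> y" "y \<le> b"
  shows "F y - F x = integral {x..y} f" "f absolutely_integrable_on {x..y}" "f integrable_on {x..y}"
proof -
  have f: "f absolutely_integrable_on {a..b}" using lebesgue_primitiveD(1)[OF assms(1)] .
  have "f absolutely_integrable_on {a..y}"
    using absolutely_integrable_on_subinterval[OF f] assms by auto
  then have "f integrable_on {a..y}" by (simp add: absolutely_integrable_on_def)
  then have "integral {a..x} f + integral {x..y} f = integral {a..y} f"
    using assms by (intro Henstock_Kurzweil_Integration.integral_combine) auto
  moreover have "F x = F a + integral {a..x} f" "F y = F a + integral {a..y} f"
    using assms(2-4) by (auto intro: lebesgue_primitiveD(2)[OF assms(1)])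
  ultimately show "F y - F x = integral {x..y} f" by simp
  show "f absolutely_integrable_on {x..y}"
    using absolutely_integrable_on_subinterval[OF f] assms by auto
  then show "f integrable_on {x..y}" by (simp add: absolutely_integrable_on_def)
qed

lemma lebesgue_primitive_continuous:
  assumes "lebesgue_primitive a b F f"
  shows "continuous_on {a..b} F"
proof -
  have "f integrable_on {a..b}"
    using lebesgue_primitiveD(1)[OF assms] by (simp add: absolutely_integrable_on_def)
  then have "continuous_on {a..b} (\<lambda>x. F a + integral {a..x} f)"
    by (intro continuous_intros indefinite_integral_continuous_1)
  then show ?thesis
    by (rule continuous_on_eq) (rule lebesgue_primitiveD(2)[OF assms, symmetric])
qed

lemma lebesgue_primitive_C1:
  assumes "continuous_on {a..b} f"
    and "\<And>x. x \<in> {a..b} \<Longrightarrow> (F has_real_derivative f x) (at x within {a..b})"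
  shows "lebesgue_primitive a b F f"
  unfolding lebesgue_primitive_def
proof (intro conjI ballI)
  show "f absolutely_integrable_on {a..b}"
    using assms(1) by (rule absolutely_integrable_continuous_real)
  fix x assume x: "x \<in> {a..b}"
  have "(f has_integral (F x - F a)) {a..x}"
  proof (rule fundamental_theorem_of_calculus)
    fix y assume "y \<in> {a..x}"
    then show "(F has_vector_derivative f y) (at y within {a..x})"
      using assms(2)[of y] x DERIV_subset[of F _ y "{a..b}" "{a..x}"]
      by (auto simp flip: has_real_derivative_iff_has_vector_derivative)
  qed (use x in auto)
  then show "F x = F a + integral {a..x} f" by (simp add: integral_unique)
qed

lemma lebesgue_primitive_add:
  assumes "lebesgue_primitive a b F f" "lebesgue_primitive a b G g"
  shows "lebesgue_primitive a b (\<lambda>x. F x + G x) (\<lambda>x. f x + g x)"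
  unfolding lebesgue_primitive_def
proof (intro conjI ballI)
  show "(\<lambda>x. f x + g x) absolutely_integrable_on {a..b}"
    using assms[THEN lebesgue_primitiveD(1)] by auto
  fix x assume x: "x \<in> {a..b}"
  show "F x + G x = F a + G a + integral {a..x} (\<lambda>x. f x + g x)"
    using lebesgue_primitive_diff[OF assms(1), of a x] lebesgue_primitive_diff[OF assms(2), of a x] x
    by (simp add: integral_add)
qed

lemma lebesgue_primitive_cmult:
  assumes "lebesgue_primitive a b F f"
  shows "lebesgue_primitive a b (\<lambda>x. c * F x) (\<lambda>x. c * f x)"
  unfolding lebesgue_primitive_def
proof (intro conjI ballI)
  show "(\<lambda>x. c * f x) absolutely_integrable_on {a..b}"
    using assms[THEN lebesgue_primitiveD(1)] by auto
  fix x assume x: "x \<in> {a..b}"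
  show "c * F x = c * F a + integral {a..x} (\<lambda>x. c * f x)"
    using lebesgue_primitive_diff[OF assms(1), of a x] x
    by (simp add: algebra_simps)
qed

text \<open>The interval is chained through steps shorter than \<open>\<delta>\<close>.\<close>

lemma constant_if_increments_negligible:
  fixes D A :: "real \<Rightarrow> real"
  assumes "a \<le> b"
    and small: "\<And>e. e > 0 \<Longrightarrow> \<exists>\<delta>>0. \<forall>x y. a \<le> x \<longrightarrow> x \<le> y \<longrightarrow> y \<le> b \<longrightarrow> y - x < \<delta> \<longrightarrow>
                  \<bar>D y - D x\<bar> \<le> e * (A y - A x)"
  shows "D b = D a"
proof -
  have bound: "\<bar>D b - D a\<bar> \<le> e * (A b - A a)" if e: "e > 0" for e
  proof -
    obtain \<delta> where \<delta>: "\<delta> > 0"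
      "\<And>x y. a \<le> x \<Longrightarrow> x \<le> y \<Longrightarrow> y \<le> b \<Longrightarrow> y - x < \<delta> \<Longrightarrow> \<bar>D y - D x\<bar> \<le> e * (A y - A x)"
      using small[OF e] by blast
    have step: "y \<le> b \<Longrightarrow> a \<le> y \<Longrightarrow> y - a \<le> real n * (\<delta>/2) \<Longrightarrow> \<bar>D y - D a\<bar> \<le> e * (A y - A a)" for n y
    proof (induction n arbitrary: y)
      case (Suc n)
      define z where "z = max a (y - \<delta>/2)"
      have z: "a \<le> z" "z \<le> y" "y - z < \<delta>" "z - a \<le> real n * (\<delta>/2)"
        using Suc.prems \<delta>(1) by (auto simp: z_def max_def algebra_simps)
      have "\<bar>D z - D a\<bar> \<le> e * (A z - A a)" using Suc.IH[of z] z Suc.prems by simp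
      moreover have "\<bar>D y - D z\<bar> \<le> e * (A y - A z)" using \<delta>(2) z Suc.prems by simp
      ultimately show ?case by (simp add: algebra_simps abs_le_iff)
    qed auto
    obtain n where "(b - a) / (\<delta>/2) \<le> real n" using real_arch_simple by blast
    then have "b - a \<le> real n * (\<delta>/2)" using \<delta>(1) by (simp add: field_simps)
    then show ?thesis using step[of b n] assms(1) by simp
  qed
  have "\<bar>D b - D a\<bar> \<le> 0"
  proof (rule field_le_epsilon)
    fix e :: real assume e: "e > 0"
    have "\<bar>D b - D a\<bar> \<le> e / (\<bar>A b - A a\<bar> + 1) * (A b - A a)" using e by (intro bound) simp
    also have "\<dots> \<le> e / (\<bar>A b - A a\<bar> + 1) * (\<bar>A b - A a\<bar> + 1)"
      using e by (intro mult_left_mono) auto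
    also have "\<dots> = 0 + e" by simp
    finally show "\<bar>D b - D a\<bar> \<le> 0 + e" .
  qed
  then show ?thesis by simp
qed

text \<open>As \<open>F\<close> and \<open>G\<close> may fail to be differentiable at a given point, the rule is verified on increments. Over a short
  interval \<open>[x,y]\<close> the defect of the rule is
  \<open>\<integral> f(s) (G(y) - G(s)) + g(s) (F(x) - F(s)) ds\<close>, which uniform continuity of \<open>F\<close> and \<open>G\<close> makes small
  compared with the integral of \<open>\<bar>f\<bar> + \<bar>g\<bar>\<close>.\<close>

lemma lebesgue_primitive_mult:
  assumes F: "lebesgue_primitive a b F f" and G: "lebesgue_primitive a b G g"
  shows "lebesgue_primitive a b (\<lambda>x. F x * G x) (\<lambda>x. G x * f x + F x * g x)"
proof -
  have f: "f absolutely_integrable_on {a..b}" and g: "g absolutely_integrable_on {a..b}"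
    using assms[THEN lebesgue_primitiveD(1)] by auto
  note contF = lebesgue_primitive_continuous[OF F]
  note contG = lebesgue_primitive_continuous[OF G]
  define h where "h = (\<lambda>x. G x * f x + F x * g x)"
  have h: "h absolutely_integrable_on {a..b}"
    unfolding h_def
    by (intro set_integral_add(1) absolutely_integrable_continuous_mult f g contF contG)
  have "F x * G x = F a * G a + integral {a..x} h" if x: "x \<in> {a..b}" for x
  proof -
    define D where "D y = F y * G y - integral {a..y} h" for y
    define A where "A y = integral {a..y} (\<lambda>s. \<bar>f s\<bar> + \<bar>g s\<bar>)" for y
    have "D x = D a"
    proof (rule constant_if_increments_negligible[where A = A and D = D and a = a and b = x])
      show "a \<le> x" using x by simp
      fix e :: real assume e: "e > 0"
      obtain d1 where d1: "d1 > 0" "\<And>s t. s \<in> {a..b} \<Longrightarrow> t \<in> {a..b} \<Longrightarrow> dist t s < d1 \<Longrightarrow> dist (F t) (F s) < e"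
        using compact_uniformly_continuous[OF contF] e unfolding uniformly_continuous_on_def by fastforce
      obtain d2 where d2: "d2 > 0" "\<And>s t. s \<in> {a..b} \<Longrightarrow> t \<in> {a..b} \<Longrightarrow> dist t s < d2 \<Longrightarrow> dist (G t) (G s) < e"
        using compact_uniformly_continuous[OF contG] e unfolding uniformly_continuous_on_def by fastforce
      have "\<bar>D z - D y\<bar> \<le> e * (A z - A y)" if yz: "a \<le> y" "y \<le> z" "z \<le> x" "z - y < min d1 d2" for y z
      proof -
        have sub: "{y..z} \<subseteq> {a..b}" using yz x by auto
        note int = absolutely_integrable_on_subinterval[OF _ sub]
        have fyz: "f absolutely_integrable_on {y..z}" and gyz: "g absolutely_integrable_on {y..z}"
          and hyz: "h absolutely_integrable_on {y..z}" using int f g h by auto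
        have combine: "integral {a..z} k - integral {a..y} k = integral {y..z} k"
          if "k absolutely_integrable_on {a..b}" for k :: "real \<Rightarrow> real"
        proof -
          have "k absolutely_integrable_on {a..z}"
            using absolutely_integrable_on_subinterval[OF that] yz x by auto
          then have "k integrable_on {a..z}" by (simp add: absolutely_integrable_on_def)
          then have "integral {a..y} k + integral {y..z} k = integral {a..z} k"
            using yz by (intro Henstock_Kurzweil_Integration.integral_combine) auto
          then show ?thesis by simp
        qed
        have FG: "F z - F y = integral {y..z} f" "G z - G y = integral {y..z} g"
          using lebesgue_primitive_diff(1)[OF F] lebesgue_primitive_diff(1)[OF G] yz x by auto
        have i: "f integrable_on {y..z}" "g integrable_on {y..z}" "h integrable_on {y..z}"
          using fyz gyz hyz by (auto simp: absolutely_integrable_on_def)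
        have hi: "((\<lambda>s. G z * f s + F y * g s - h s) has_integral
            (G z * integral {y..z} f + F y * integral {y..z} g - integral {y..z} h)) {y..z}"
          by (intro has_integral_diff has_integral_add has_integral_mult_right integrable_integral i)
        have "D z - D y = (F z - F y) * G z + F y * (G z - G y) - integral {y..z} h"
          using combine[OF h] by (simp add: D_def algebra_simps)
        also have "\<dots> = integral {y..z} (\<lambda>s. G z * f s + F y * g s - h s)"
          using hi by (simp add: FG integral_unique algebra_simps)
        finally have eq: "D z - D y = integral {y..z} (\<lambda>s. G z * f s + F y * g s - h s)" .
        have "norm (integral {y..z} (\<lambda>s. G z * f s + F y * g s - h s)) \<le> integral {y..z} (\<lambda>s. e * (\<bar>f s\<bar> + \<bar>g s\<bar>))"
        proof (rule integral_norm_bound_integral)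
          show "(\<lambda>s. G z * f s + F y * g s - h s) integrable_on {y..z}"
            using hi by (rule has_integral_integrable)
          show "(\<lambda>s. e * (\<bar>f s\<bar> + \<bar>g s\<bar>)) integrable_on {y..z}"
            using integrable_cmul[of "\<lambda>s. \<bar>f s\<bar> + \<bar>g s\<bar>" "{y..z}" e] fyz gyz
            by (simp add: absolutely_integrable_on_def integrable_add)
          fix s assume s: "s \<in> {y..z}"
          have sb: "s \<in> {a..b}" "y \<in> {a..b}" "z \<in> {a..b}" using s yz x by auto
          have 1: "\<bar>F y - F s\<bar> \<le> e" "\<bar>G z - G s\<bar> \<le> e"
            using d1(2)[of s y] d2(2)[of s z] s sb yz by (auto simp: dist_real_def)
          have "G z * f s + F y * g s - h s = (G z - G s) * f s + (F y - F s) * g s"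
            by (simp add: h_def algebra_simps)
          also have "\<bar>\<dots>\<bar> \<le> \<bar>G z - G s\<bar> * \<bar>f s\<bar> + \<bar>F y - F s\<bar> * \<bar>g s\<bar>"
            by (metis abs_mult abs_triangle_ineq)
          also have "\<dots> \<le> e * \<bar>f s\<bar> + e * \<bar>g s\<bar>"
            using 1 by (intro add_mono mult_right_mono) auto
          finally show "norm (G z * f s + F y * g s - h s) \<le> e * (\<bar>f s\<bar> + \<bar>g s\<bar>)"
            by (simp add: algebra_simps)
        qed
        also have "\<dots> = e * (A z - A y)"
          using combine[OF set_integral_add(1)[OF set_integrable_abs[OF f] set_integrable_abs[OF g]]]
          by (simp add: A_def)
        finally show ?thesis by (simp add: eq)
      qed
      then show "\<exists>\<delta>>0. \<forall>y z. a \<le> y \<longrightarrow> y \<le> z \<longrightarrow> z \<le> x \<longrightarrow> z - y < \<delta> \<longrightarrow> \<bar>D z - D y\<bar> \<le> e * (A z - A y)"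
        using d1(1) d2(1) by (intro exI[of _ "min d1 d2"]) auto
    qed
    then show ?thesis by (simp add: D_def)
  qed
  then show ?thesis
    using h unfolding lebesgue_primitive_def h_def[symmetric] by blast
qed

text \<open>Squaring removes the kink of the positive part. Test functions of class \<open>C\<^sup>1\<close> are built from this
  function.\<close>

section \<open>Fundamental lemmas of the calculus of variations\<close>

lemma has_real_derivative_max0_squared:
  "((\<lambda>y::real. (max 0 y)^2) has_real_derivative 2 * max 0 y) (at y)"
proof -
  consider "y > 0" | "y < 0" | "y = 0" by linarith
  then show ?thesis
  proof cases
    case 1
    then have "((\<lambda>y::real. y^2) has_real_derivative 2 * max 0 y) (at y)"
      by (auto intro!: derivative_eq_intros)
    then show ?thesis
      by (rule has_field_derivative_transform_within_open[where f = "\<lambda>y. y^2" and S = "{0<..}",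
          OF _ open_greaterThan]) (use 1 in auto)
  next
    case 2
    have "((\<lambda>y::real. 0) has_real_derivative 2 * max 0 y) (at y)"
      using 2 by (auto intro!: derivative_eq_intros)
    then show ?thesis
      by (rule has_field_derivative_transform_within_open[where f = "\<lambda>y. 0" and S = "{..<0}",
          OF _ open_lessThan]) (use 2 in auto)
  next
    case 3
    have "((\<lambda>h::real. (max 0 h)^2 / h) \<longlongrightarrow> 0) (at 0)"
    proof (rule Lim_null_comparison)
      show "\<forall>\<^sub>F h::real in at 0. norm ((max 0 h)^2 / h) \<le> \<bar>h\<bar>"
        by (auto simp: max_def power2_eq_square)
      show "((\<lambda>h::real. \<bar>h\<bar>) \<longlongrightarrow> 0) (at 0)"
        by (rule tendsto_rabs_zero) (rule tendsto_ident_at)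
    qed
    then show ?thesis using 3 by (simp add: DERIV_def)
  qed
qed

lemma test_funI:
  assumes "\<And>x. (\<eta> has_real_derivative \<eta>' x) (at x)" "continuous_on UNIV \<eta>'"
    and "a < c" "d < b" "\<And>x. x \<notin> {c..d} \<Longrightarrow> \<eta> x = 0"
  shows "test_fun a b \<eta>"
proof -
  have "deriv \<eta> = \<eta>'" using assms(1) DERIV_imp_deriv by blast
  then show ?thesis
    using assms unfolding test_fun_def by (auto simp: real_differentiable_def)
qed

text \<open>With \<open>0 \<le> \<beta> \<le> 1\<close> positive exactly on the open interval, \<open>1 - (1 - \<beta>)\<^sup>n\<close> increases to the indicator
  function of the interval and inherits both the regularity and the support of \<open>\<beta>\<close>.\<close>

lemma ex_test_fun_indicator:
  fixes a b c d :: real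
  assumes "a < c" "c < d" "d < b"
  shows "\<exists>\<eta>. (\<forall>n. test_fun a b (\<eta> n)) \<and> (\<forall>n x. 0 \<le> \<eta> n x \<and> \<eta> n x \<le> 1) \<and>
           (\<forall>x. (\<lambda>n. \<eta> n x) \<longlonglongrightarrow> indicat_real {c<..<d} x)"
proof -
  define \<beta> where "\<beta> x = (max 0 ((x - c) * (d - x) / (d - c)^2))^2" for x
  define \<beta>' where "\<beta>' x = 2 * max 0 ((x - c) * (d - x) / (d - c)^2) * ((c + d - 2 * x) / (d - c)^2)" for x
  have der\<beta>: "(\<beta> has_real_derivative \<beta>' x) (at x)" for x
  proof -
    have "((\<lambda>x. (x - c) * (d - x) / (d - c)^2) has_real_derivative ((c + d - 2 * x) / (d - c)^2)) (at x)"
      by (rule DERIV_cdivide) (auto intro!: derivative_eq_intros)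
    from DERIV_chain2[OF has_real_derivative_max0_squared this] show ?thesis
      unfolding \<beta>_def[abs_def] \<beta>'_def by simp
  qed
  have cont\<beta>': "continuous_on UNIV \<beta>'"
    unfolding \<beta>'_def[abs_def] using assms by (intro continuous_intros) auto
  have cont\<beta>: "continuous_on UNIV \<beta>"
    unfolding \<beta>_def[abs_def] using assms by (intro continuous_intros) auto
  have \<beta>0: "\<beta> x = 0" if "x \<notin> {c<..<d}" for x
  proof -
    have "(x - c) * (d - x) \<le> 0" using that assms by (auto simp: mult_le_0_iff)
    then have "(x - c) * (d - x) / (d - c)^2 \<le> 0" by (simp add: divide_nonpos_nonneg)
    then show ?thesis by (simp add: \<beta>_def max_absorb1)
  qed
  have \<beta>pos: "0 < \<beta> x" if "x \<in> {c<..<d}" for x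
    using that assms by (auto simp: \<beta>_def max_def not_le)
  have \<beta>le: "0 \<le> \<beta> x \<and> \<beta> x \<le> 1" for x
  proof (cases "x \<in> {c<..<d}")
    case True
    then have "(x - c) * (d - x) \<le> (d - c) * (d - c)" by (intro mult_mono) auto
    then have "max 0 ((x - c) * (d - x) / (d - c)^2) \<le> 1"
      using assms by (simp add: divide_le_eq power2_eq_square)
    then show ?thesis by (simp add: \<beta>_def power_le_one)
  next
    case False
    then show ?thesis using \<beta>0 by simp
  qed
  define \<eta> where "\<eta> n x = 1 - (1 - \<beta> x)^n" for n x
  have "test_fun a b (\<eta> n)" for n
  proof (rule test_funI)
    show "(\<eta> n has_real_derivative real n * (1 - \<beta> x)^(n - 1) * \<beta>' x) (at x)" for x
      unfolding \<eta>_def[abs_def] by (rule derivative_eq_intros der\<beta> refl | simp)+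
    show "continuous_on UNIV (\<lambda>x. real n * (1 - \<beta> x)^(n - 1) * \<beta>' x)"
      by (intro continuous_intros cont\<beta> cont\<beta>')
    show "\<eta> n x = 0" if "x \<notin> {c..d}" for x
      using \<beta>0[of x] that by (auto simp: \<eta>_def)
  qed (use assms in auto)
  moreover have "0 \<le> \<eta> n x \<and> \<eta> n x \<le> 1" for n x
    using \<beta>le[of x] by (auto simp: \<eta>_def power_le_one)
  moreover have "(\<lambda>n. \<eta> n x) \<longlonglongrightarrow> indicat_real {c<..<d} x" for x
  proof (cases "x \<in> {c<..<d}")
    case True
    have "(\<lambda>n. 1 - (1 - \<beta> x)^n) \<longlonglongrightarrow> 1 - 0"
      using \<beta>le[of x] \<beta>pos[OF True] by (intro tendsto_intros LIMSEQ_power_zero) auto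
    then show ?thesis using True by (simp add: \<eta>_def)
  next
    case False
    then show ?thesis using \<beta>0 by (simp add: \<eta>_def)
  qed
  ultimately show ?thesis by blast
qed

lemma test_fun_continuous: "test_fun a b \<eta> \<Longrightarrow> continuous_on S \<eta>"
  unfolding test_fun_def
  by (meson continuous_at_imp_continuous_on differentiable_imp_continuous_within)

lemma absolutely_integrable_scaleR_continuous:
  fixes q :: "real \<Rightarrow> complex"
  assumes "continuous_on {a..b} \<eta>" "q absolutely_integrable_on {a..b}"
  shows "(\<lambda>x. \<eta> x *\<^sub>R q x) absolutely_integrable_on {a..b}"
proof (rule absolutely_integrable_bounded_measurable_product[where h = scaleR])
  show "bilinear (scaleR :: real \<Rightarrow> complex \<Rightarrow> complex)"
    by (auto simp: bilinear_def intro!: linearI simp: algebra_simps)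
  show "\<eta> \<in> borel_measurable (lebesgue_on {a..b})"
    by (rule continuous_imp_measurable_on_sets_lebesgue[OF assms(1)]) simp
  show "bounded (\<eta> ` {a..b})"
    using assms(1) compact_continuous_image compact_imp_bounded by blast
qed (use assms in auto)

lemma LINT_Ioo_eq_integral:
  fixes g :: "real \<Rightarrow> 'a::euclidean_space"
  assumes "g absolutely_integrable_on {a..b}"
  shows "(LINT x|lebesgue_on {a<..<b}. g x) = integral {a..b} g" "integrable (lebesgue_on {a<..<b}) g"
proof -
  have "g absolutely_integrable_on {a<..<b}"
    using assms absolutely_integrable_on_Icc_iff_Ioo by blast
  then show i: "integrable (lebesgue_on {a<..<b}) g"
    by (rule absolutely_integrable_imp_integrable) simp
  have "(LINT x|lebesgue_on {a<..<b}. g x) = integral {a<..<b} g"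
    by (rule lebesgue_integral_eq_integral[OF i]) simp
  then show "(LINT x|lebesgue_on {a<..<b}. g x) = integral {a..b} g"
    by (simp add: integral_open_interval_real)
qed

text \<open>Testing against approximate indicator functions shows that \<open>q\<close> has integral zero over every
  interval, and almost every point is a Lebesgue point of \<open>q\<close>.\<close>

lemma fundamental_lemma_calculus_of_variations:
  fixes q :: "real \<Rightarrow> complex"
  assumes q: "q absolutely_integrable_on {a..b}"
    and test: "\<And>\<eta>. test_fun a b \<eta> \<Longrightarrow> (LINT x|lebesgue_on {a<..<b}. \<eta> x *\<^sub>R q x) = 0"
  shows "AE x in lebesgue_on {a<..<b}. q x = 0"
proof -
  have zero: "integral {c..d} q = 0" if cd: "a < c" "c < d" "d < b" for c d
  proof -
    obtain \<eta> where \<eta>: "\<And>n. test_fun a b (\<eta> n)" "\<And>n x. 0 \<le> \<eta> n x \<and> \<eta> n x \<le> 1"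
      "\<And>x. (\<lambda>n. \<eta> n x) \<longlonglongrightarrow> indicat_real {c<..<d} x"
      using ex_test_fun_indicator[OF cd] by blast
    have int: "(\<lambda>x. \<eta> n x *\<^sub>R q x) absolutely_integrable_on {a..b}" for n
      using absolutely_integrable_scaleR_continuous[OF test_fun_continuous[OF \<eta>(1)] q] .
    have "(\<lambda>n. integral {a..b} (\<lambda>x. \<eta> n x *\<^sub>R q x)) \<longlonglongrightarrow>
          integral {a..b} (\<lambda>x. indicat_real {c<..<d} x *\<^sub>R q x)"
    proof (rule dominated_convergence(2))
      show "(\<lambda>x. \<eta> k x *\<^sub>R q x) integrable_on {a..b}" for k
        using int by (simp add: absolutely_integrable_on_def)
      show "(\<lambda>x. norm (q x)) integrable_on {a..b}"
        using q by (simp add: absolutely_integrable_on_def)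
      show "norm (\<eta> k x *\<^sub>R q x) \<le> norm (q x)" for k x
        using \<eta>(2)[of k x] by (simp add: mult_left_le_one_le)
      show "(\<lambda>k. \<eta> k x *\<^sub>R q x) \<longlonglongrightarrow> indicat_real {c<..<d} x *\<^sub>R q x" for x
        by (intro tendsto_intros \<eta>(3))
    qed
    moreover have "integral {a..b} (\<lambda>x. \<eta> n x *\<^sub>R q x) = 0" for n
      using test[OF \<eta>(1)] LINT_Ioo_eq_integral(1)[OF int] by simp
    ultimately have "integral {a..b} (\<lambda>x. indicat_real {c<..<d} x *\<^sub>R q x) = 0"
      by (simp add: LIMSEQ_const_iff)
    moreover have "integral {a..b} (\<lambda>x. indicat_real {c<..<d} x *\<^sub>R q x) = integral {c<..<d} q"
    proof -
      have "integral {a..b} (\<lambda>x. indicat_real {c<..<d} x *\<^sub>R q x)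
          = integral {a..b} (\<lambda>x. if x \<in> {c<..<d} then q x else 0)"
        by (rule Henstock_Kurzweil_Integration.integral_cong) (auto simp: indicator_def)
      also have "\<dots> = integral ({a..b} \<inter> {c<..<d}) q" by (subst Int_commute) (rule Henstock_Kurzweil_Integration.integral_restrict_Int)
      also have "{a..b} \<inter> {c<..<d} = {c<..<d}" using cd by auto
      finally show ?thesis .
    qed
    ultimately show ?thesis by (simp add: integral_open_interval_real)
  qed
  define f where "f x = (if x \<in> {a..b} then q x else 0)" for x
  have "f integrable_on UNIV \<longleftrightarrow> q integrable_on {a..b}"
    unfolding f_def by (rule integrable_restrict_UNIV)
  then have f: "f integrable_on UNIV"
    using q by (simp add: absolutely_integrable_on_def)
  have "f integrable_on cbox x y" for x y
    using integrable_on_subcbox[OF f] by simp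
  then obtain N where N: "negligible N" "\<And>x e. x \<notin> N \<Longrightarrow> 0 < e \<Longrightarrow>
      \<exists>d>0. \<forall>h. 0 < h \<and> h < d \<longrightarrow> norm (integral (cbox x (x + h *\<^sub>R One)) f /\<^sub>R h ^ DIM(real) - f x) < e"
    using integrable_ccontinuous_explicit by metis
  have "q x = 0" if x: "x \<in> {a<..<b}" "x \<notin> N" for x
  proof (rule ccontr)
    assume "q x \<noteq> 0"
    then obtain d where d: "d > 0" "\<And>h. 0 < h \<Longrightarrow> h < d \<Longrightarrow>
        norm (integral (cbox x (x + h *\<^sub>R One)) f /\<^sub>R h ^ DIM(real) - f x) < norm (q x)"
      using N(2)[OF x(2), of "norm (q x)"] by auto
    define h where "h = min (d/2) ((b - x)/2)"
    have h: "0 < h" "h < d" "x + h < b" using d(1) x by (auto simp: h_def min_def field_simps)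
    have "integral {x..x+h} f = integral {x..x+h} q"
      by (rule Henstock_Kurzweil_Integration.integral_cong) (use x h in \<open>auto simp: f_def\<close>)
    also have "\<dots> = 0" using zero[of x "x+h"] x h by auto
    finally have "norm (f x) < norm (q x)" using d(2)[OF h(1,2)] by simp
    then show False using x by (simp add: f_def)
  qed
  then have "AE x in lebesgue. x \<in> {a<..<b} \<longrightarrow> q x = 0"
    using N(1) by (auto simp: negligible_iff_null_sets intro!: AE_I'[of N])
  then show ?thesis by (simp add: AE_restrict_space_iff)
qed

text \<open>A continuous function with compact support and mean zero has a primitive with the same support.
  Applied twice, it turns orthogonality to the affine functions into being a second derivative of a
  test function.\<close>

lemma ex_antiderivative_vanishing:
  fixes r :: "real \<Rightarrow> real"
  assumes cont: "continuous_on UNIV r" and cd: "c \<le> d"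
    and supp: "\<And>x. x \<notin> {c..d} \<Longrightarrow> r x = 0" and mean: "integral {c..d} r = 0"
  shows "\<exists>R. (\<forall>x. (R has_real_derivative r x) (at x)) \<and> (\<forall>x. x \<notin> {c..d} \<longrightarrow> R x = 0) \<and> R c = 0 \<and> R d = 0"
proof -
  have "\<exists>F. \<forall>x. -\<infinity> < ereal x \<longrightarrow> ereal x < \<infinity> \<longrightarrow> (F has_vector_derivative r x) (at x)"
    by (rule einterval_antiderivative) (use cont in \<open>auto simp: continuous_on_eq_continuous_at\<close>)
  then obtain F where F: "\<And>x. (F has_real_derivative r x) (at x)"
    by (auto simp: has_real_derivative_iff_has_vector_derivative)
  define R where "R x = F x - F c" for x
  have R: "(R has_real_derivative r x) (at x)" for x
    unfolding R_def[abs_def] using F by (auto intro!: derivative_eq_intros)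
  have contR: "continuous_on S R" for S
    by (rule DERIV_continuous_on[where D = r]) (rule DERIV_subset[OF R], simp)
  have Rc: "R c = 0" by (simp add: R_def)
  have "(r has_integral (R d - R c)) {c..d}"
    using cd R by (intro fundamental_theorem_of_calculus)
      (auto simp flip: has_real_derivative_iff_has_vector_derivative intro: DERIV_subset)
  then have Rd: "R d = 0" using mean Rc by (simp add: integral_unique)
  have "R x = 0" if "x \<notin> {c..d}" for x
  proof (cases "x < c")
    case True
    have "R c = R x"
    proof (rule DERIV_isconst_end[OF True])
      show "continuous_on {x..c} R" by (rule contR)
      show "(R has_real_derivative 0) (at y)" if "x < y" "y < c" for y
        using R[of y] supp[of y] that by simp
    qed
    then show ?thesis using Rc by simp
  next
    case False
    then have "d < x" using that by auto
    have "R x = R d"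
    proof (rule DERIV_isconst_end[OF \<open>d < x\<close>])
      show "continuous_on {d..x} R" by (rule contR)
      show "(R has_real_derivative 0) (at y)" if "d < y" "y < x" for y
        using R[of y] supp[of y] that by simp
    qed
    then show ?thesis using Rd by simp
  qed
  then show ?thesis using R Rc Rd by blast
qed

text \<open>The functions orthogonal to all second derivatives of test functions are the affine ones: every
  continuous \<open>r\<close> that is supported in \<open>[c,d]\<close> and orthogonal to the affine functions is such a second
  derivative, and the choice \<open>r = \<rho> (W - \<ell>)\<close>, with a cutoff \<open>\<rho>\<close> and the \<open>\<rho>\<close>-orthogonal projection \<open>\<ell>\<close>
  of \<open>W\<close> to the affine functions, gives \<open>\<integral> \<rho> (W - \<ell>)\<^sup>2 = 0\<close>.\<close>

lemma second_order_du_Bois_Reymond_local: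
  fixes W :: "real \<Rightarrow> real"
  assumes cd: "c < d" and contW: "continuous_on {c..d} W"
    and test: "\<And>\<eta> \<eta>' \<eta>''. (\<And>x. (\<eta> has_real_derivative \<eta>' x) (at x)) \<Longrightarrow>
      (\<And>x. (\<eta>' has_real_derivative \<eta>'' x) (at x)) \<Longrightarrow> continuous_on UNIV \<eta>'' \<Longrightarrow>
      (\<And>x. x \<notin> {c..d} \<Longrightarrow> \<eta> x = 0) \<Longrightarrow> (\<And>x. x \<notin> {c..d} \<Longrightarrow> \<eta>' x = 0) \<Longrightarrow>
      (\<And>x. x \<notin> {c..d} \<Longrightarrow> \<eta>'' x = 0) \<Longrightarrow>
      integral {c..d} (\<lambda>x. \<eta>'' x * W x) = 0"
  shows "\<exists>\<alpha> \<beta>. \<forall>x\<in>{c<..<d}. W x = \<alpha> + \<beta> * x"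
proof -
  define \<rho> where "\<rho> x = max 0 ((x - c) * (d - x))" for x
  have \<rho>0: "\<rho> x \<ge> 0" for x by (simp add: \<rho>_def)
  have \<rho>pos: "\<rho> x > 0" if "x \<in> {c<..<d}" for x using that by (auto simp: \<rho>_def max_def not_le)
  have \<rho>out: "\<rho> x = 0" if "x \<notin> {c<..<d}" for x
    using that cd by (auto simp: \<rho>_def max_absorb1 mult_le_0_iff)
  have cont\<rho>: "continuous_on S \<rho>" for S unfolding \<rho>_def[abs_def] by (intro continuous_intros)
  define I where "I g = integral {c..d} (\<lambda>x. \<rho> x * g x)" for g
  have int: "(\<lambda>x. \<rho> x * g x) integrable_on {c..d}" if "continuous_on {c..d} g" for g
    by (intro integrable_continuous_real continuous_intros cont\<rho> that)
  have Iadd: "I (\<lambda>x. g x + h x) = I g + I h" if "continuous_on {c..d} g" "continuous_on {c..d} h" for g h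
    unfolding I_def using integral_add[OF int[OF that(1)] int[OF that(2)]] by (simp add: algebra_simps)
  have Icmult: "I (\<lambda>x. k * g x) = k * I g" for g k
  proof -
    have "(\<lambda>x. \<rho> x * (k * g x)) = (\<lambda>x. k * (\<rho> x * g x))" by (auto simp: algebra_simps)
    then show ?thesis unfolding I_def by simp
  qed
  have zero: "g x = 0" if "I g = 0" "continuous_on {c..d} g" "\<And>x. g x \<ge> 0" "x \<in> {c<..<d}" for g x
  proof -
    have "continuous_on {c..d} (\<lambda>x. \<rho> x * g x)"
      by (intro continuous_intros cont\<rho> that(2))
    then have "\<forall>x\<in>{c..d}. \<rho> x * g x = 0"
      using integral_eq_0_iff[of c d "\<lambda>x. \<rho> x * g x"] cd \<rho>0 that(1,3) by (simp add: I_def)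
    then have "\<rho> x * g x = 0" using that(4) by auto
    then show ?thesis using \<rho>pos[OF that(4)] by simp
  qed
  have Ipos: "I g \<noteq> 0" if "continuous_on {c..d} g" "\<And>x. g x \<ge> 0" "x \<in> {c<..<d}" "g x \<noteq> 0" for g x
    using zero[of g x] that by blast
  have "(c + d)/2 \<in> {c<..<d}" using cd by auto
  then have I1: "I (\<lambda>x. 1) \<noteq> 0" by (intro Ipos[of _ "(c + d)/2"]) auto
  define \<mu> where "\<mu> = I (\<lambda>x. x) / I (\<lambda>x. 1)"
  have I\<mu>: "I (\<lambda>x. x - \<mu>) = 0"
    using Iadd[of "\<lambda>x. x" "\<lambda>x. (-\<mu>) * 1"] Icmult[of "-\<mu>" "\<lambda>x. 1"] I1 by (simp add: \<mu>_def)
  define y where "y = (if \<mu> = (c + d)/2 then (2*c + d)/3 else (c + d)/2)"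
  have y: "y \<in> {c<..<d}" "y \<noteq> \<mu>" using cd by (auto simp: y_def)
  then have I2: "I (\<lambda>x. (x - \<mu>)^2) \<noteq> 0" by (intro Ipos[of _ y]) (auto intro!: continuous_intros)
  define \<alpha> where "\<alpha> = I W / I (\<lambda>x. 1)"
  define \<beta> where "\<beta> = I (\<lambda>x. (x - \<mu>) * W x) / I (\<lambda>x. (x - \<mu>)^2)"
  define V where "V x = W x - (\<alpha> + \<beta> * (x - \<mu>))" for x
  have contV: "continuous_on {c..d} V" unfolding V_def[abs_def] by (intro continuous_intros contW)
  have orth1: "I V = 0"
  proof -
    have "I V = I (\<lambda>x. W x + ((-\<alpha>) * 1 + (-\<beta>) * (x - \<mu>)))"
      by (rule arg_cong[of _ _ I]) (auto simp: V_def algebra_simps)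
    also have "\<dots> = I W + (I (\<lambda>x. (-\<alpha>) * 1) + I (\<lambda>x. (-\<beta>) * (x - \<mu>)))"
      by (subst Iadd, (intro continuous_intros contW)+, subst Iadd, (intro continuous_intros)+, rule refl)
    also have "\<dots> = 0" unfolding Icmult I\<mu> using I1 by (simp add: \<alpha>_def)
    finally show ?thesis .
  qed
  have orth2: "I (\<lambda>x. (x - \<mu>) * V x) = 0"
  proof -
    have "I (\<lambda>x. (x - \<mu>) * V x) = I (\<lambda>x. (x - \<mu>) * W x + ((-\<alpha>) * (x - \<mu>) + (-\<beta>) * (x - \<mu>)^2))"
      by (rule arg_cong[of _ _ I]) (auto simp: V_def algebra_simps power2_eq_square)
    also have "\<dots> = I (\<lambda>x. (x - \<mu>) * W x) + (I (\<lambda>x. (-\<alpha>) * (x - \<mu>)) + I (\<lambda>x. (-\<beta>) * (x - \<mu>)^2))"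
      by (subst Iadd, (intro continuous_intros contW)+, subst Iadd, (intro continuous_intros)+, rule refl)
    also have "\<dots> = 0" unfolding Icmult I\<mu> using I2 by (simp add: \<beta>_def)
    finally show ?thesis .
  qed
  \<comment> \<open>the clamped argument extends \<open>V\<close> continuously to the whole line\<close>
  define r where "r x = \<rho> x * V (max c (min d x))" for x
  have r: "r x = \<rho> x * V x" if "x \<in> {c..d}" for x using that by (simp add: r_def max_absorb2 min_absorb2)
  have rout: "r x = 0" if "x \<notin> {c..d}" for x using \<rho>out[of x] that by (auto simp: r_def)
  have contr: "continuous_on UNIV r"
  proof -
    have "continuous_on UNIV (\<lambda>x. V (max c (min d x)))"
      by (rule continuous_on_compose2[OF contV]) (use cd in \<open>auto intro!: continuous_intros\<close>)
    then show ?thesis unfolding r_def[abs_def] by (intro continuous_intros cont\<rho>)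
  qed
  have int_r: "integral {c..d} (\<lambda>x. r x * g x) = I (\<lambda>x. g x * V x)" for g
    unfolding I_def by (rule Henstock_Kurzweil_Integration.integral_cong) (simp add: r)
  have "integral {c..d} r = 0" using int_r[of "\<lambda>x. 1"] orth1 by simp
  then obtain R1 where R1: "\<And>x. (R1 has_real_derivative r x) (at x)" "\<And>x. x \<notin> {c..d} \<Longrightarrow> R1 x = 0"
      "R1 c = 0" "R1 d = 0"
    using ex_antiderivative_vanishing[OF contr less_imp_le[OF cd] rout] by blast
  have contR1: "continuous_on UNIV R1" using R1(1) DERIV_continuous_on[of UNIV R1 r] by blast
  have "integral {c..d} R1 = 0"
  proof -
    have "((\<lambda>x. r x * (x - \<mu>) + R1 x) has_integral (R1 d * (d - \<mu>) - R1 c * (c - \<mu>))) {c..d}"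
    proof (rule fundamental_theorem_of_calculus)
      fix x
      have "((\<lambda>x. R1 x * (x - \<mu>)) has_real_derivative r x * (x - \<mu>) + R1 x) (at x)"
        by (rule derivative_eq_intros R1(1) refl | simp)+
      then show "((\<lambda>x. R1 x * (x - \<mu>)) has_vector_derivative r x * (x - \<mu>) + R1 x) (at x within {c..d})"
        unfolding has_real_derivative_iff_has_vector_derivative[symmetric]
        by (rule DERIV_subset) simp
    qed (use cd in simp)
    then have 1: "integral {c..d} (\<lambda>x. r x * (x - \<mu>) + R1 x) = 0" using R1 by (simp add: integral_unique)
    have "integral {c..d} (\<lambda>x. r x * (x - \<mu>) + R1 x) = integral {c..d} (\<lambda>x. r x * (x - \<mu>)) + integral {c..d} R1"
      by (rule integral_add; rule integrable_continuous_real;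
          intro continuous_intros continuous_on_subset[OF contr] continuous_on_subset[OF contR1]) auto
    then show ?thesis using 1 int_r[of "\<lambda>x. x - \<mu>"] orth2 by simp
  qed
  then obtain R2 where R2: "\<And>x. (R2 has_real_derivative R1 x) (at x)" "\<And>x. x \<notin> {c..d} \<Longrightarrow> R2 x = 0"
    using ex_antiderivative_vanishing[OF contR1 less_imp_le[OF cd] R1(2)] by blast
  have "integral {c..d} (\<lambda>x. r x * W x) = 0"
    by (rule test[OF R2(1) R1(1) contr R2(2) R1(2) rout])
  then have IW: "I (\<lambda>x. W x * V x) = 0" using int_r by simp
  have "I (\<lambda>x. (V x)^2) = I (\<lambda>x. W x * V x + ((-\<alpha>) * V x + (-\<beta>) * ((x - \<mu>) * V x)))"
    by (rule arg_cong[of _ _ I]) (auto simp: V_def algebra_simps power2_eq_square)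
  also have "\<dots> = I (\<lambda>x. W x * V x) + (I (\<lambda>x. (-\<alpha>) * V x) + I (\<lambda>x. (-\<beta>) * ((x - \<mu>) * V x)))"
    by (subst Iadd, (intro continuous_intros contW contV)+, subst Iadd, (intro continuous_intros contV)+, rule refl)
  also have "\<dots> = 0" unfolding Icmult orth1 orth2 IW by simp
  finally have "I (\<lambda>x. (V x)^2) = 0" .
  from zero[OF this] have "V x = 0" if "x \<in> {c<..<d}" for x
    using that contV by (auto intro!: continuous_intros)
  then have "W x = (\<alpha> - \<beta> * \<mu>) + \<beta> * x" if "x \<in> {c<..<d}" for x
    using that by (force simp: V_def algebra_simps)
  then show ?thesis by blast
qed

text \<open>The affine functions obtained on compact subintervals agree, because they are determined by the
  values at the two points \<open>p\<close> and \<open>q\<close>, which all the subintervals used contain. Continuity extends the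
  identity to the closed interval.\<close>

lemma second_order_du_Bois_Reymond:
  fixes W :: "real \<Rightarrow> real"
  assumes ab: "a < b" and contW: "continuous_on {a..b} W"
    and test: "\<And>\<eta> \<eta>' \<eta>'' c d. a < c \<Longrightarrow> c < d \<Longrightarrow> d < b \<Longrightarrow> (\<And>x. (\<eta> has_real_derivative \<eta>' x) (at x)) \<Longrightarrow>
      (\<And>x. (\<eta>' has_real_derivative \<eta>'' x) (at x)) \<Longrightarrow> continuous_on UNIV \<eta>'' \<Longrightarrow>
      (\<And>x. x \<notin> {c..d} \<Longrightarrow> \<eta> x = 0) \<Longrightarrow> (\<And>x. x \<notin> {c..d} \<Longrightarrow> \<eta>' x = 0) \<Longrightarrow>
      (\<And>x. x \<notin> {c..d} \<Longrightarrow> \<eta>'' x = 0) \<Longrightarrow>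
      integral {c..d} (\<lambda>x. \<eta>'' x * W x) = 0"
  shows "\<exists>\<alpha> \<beta>. \<forall>x\<in>{a..b}. W x = \<alpha> + \<beta> * x"
proof -
  define p q where "p = (2*a + b)/3" and "q = (a + 2*b)/3"
  have pq: "a < p" "p < q" "q < b" using ab by (auto simp: p_def q_def)
  define \<beta> where "\<beta> = (W q - W p) / (q - p)"
  define \<alpha> where "\<alpha> = W p - \<beta> * p"
  have inner: "W x - (\<alpha> + \<beta> * x) = 0" if x: "x \<in> {a<..<b}" for x
  proof -
    define c where "c = (a + min p x)/2"
    define d where "d = (b + max q x)/2"
    have cd: "a < c" "c < d" "d < b" "p \<in> {c<..<d}" "q \<in> {c<..<d}" "x \<in> {c<..<d}"
      using x pq by (auto simp: c_def d_def min_def max_def)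
    have "\<exists>\<alpha> \<beta>. \<forall>x\<in>{c<..<d}. W x = \<alpha> + \<beta> * x"
    proof (rule second_order_du_Bois_Reymond_local[OF cd(2)])
      show "continuous_on {c..d} W" by (rule continuous_on_subset[OF contW]) (use cd in auto)
    qed (rule test[OF cd(1-3)])
    then obtain A B where AB: "\<And>x. x \<in> {c<..<d} \<Longrightarrow> W x = A + B * x" by blast
    have W: "W p = A + B * p" "W q = A + B * q" "W x = A + B * x" using AB cd by auto
    have "W q - W p = B * (q - p)" using W by (simp add: algebra_simps)
    then have "B = \<beta>" using pq by (simp add: \<beta>_def)
    then show ?thesis using W by (simp add: \<alpha>_def algebra_simps)
  qed
  have "W x - (\<alpha> + \<beta> * x) = 0" if x: "x \<in> {a..b}" for x
  proof (rule continuous_constant_on_closure[of "{a<..<b}" "\<lambda>x. W x - (\<alpha> + \<beta> * x)"])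
    show "continuous_on (closure {a<..<b}) (\<lambda>x. W x - (\<alpha> + \<beta> * x))"
      using ab contW by (auto intro!: continuous_intros)
  qed (use inner x ab in auto)
  then show ?thesis by (intro exI[of _ \<alpha>] exI[of _ \<beta>]) auto
qed

section \<open>Fubini's theorem for the Lebesgue measure of the plane\<close>

text \<open>The completed Lebesgue measure of the plane is not the product of the measures of the axes, only its
  restriction to the Borel sets is. All statements on sections are transferred through a Borel representative.\<close>

lemma ex_borel_version:
  fixes f :: "'a::euclidean_space \<Rightarrow> 'b::euclidean_space"
  assumes "f \<in> borel_measurable lebesgue"
  shows "\<exists>f'\<in>borel_measurable borel. AE z in lborel. f z = f' z"
proof -
  have "\<exists>g. g \<in> borel_measurable lborel \<and> (AE z in lborel. f z \<bullet> b = g z)" for b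
  proof -
    have "(\<lambda>z. f z \<bullet> b) \<in> borel_measurable lebesgue" using assms by simp
    then show ?thesis using completion_ex_borel_measurable_real by blast
  qed
  then obtain g where g: "\<And>b. g b \<in> borel_measurable lborel" "\<And>b. AE z in lborel. f z \<bullet> b = g b z"
    by metis
  define f' where "f' z = (\<Sum>b\<in>Basis. g b z *\<^sub>R b)" for z
  have "f' \<in> borel_measurable borel" unfolding f'_def[abs_def] using g(1) by (intro borel_measurable_sum) auto
  moreover have "AE z in lborel. \<forall>b\<in>Basis. f z \<bullet> b = g b z"
    using g(2) by (intro AE_finite_allI) auto
  then have "AE z in lborel. f z = f' z"
  proof eventually_elim
    case (elim z)
    have "f z = (\<Sum>b\<in>Basis. (f z \<bullet> b) *\<^sub>R b)" by (simp add: euclidean_representation)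
    then show ?case using elim by (simp add: f'_def)
  qed
  ultimately show ?thesis by blast
qed

lemma AE_lborel_sections:
  assumes "AE z in (lborel :: (real \<times> real) measure). P z"
  shows "AE x in lborel. AE t in lborel. P (x, t)" "AE t in lborel. AE x in lborel. P (x, t)"
proof -
  have P: "AE z in (lborel :: real measure) \<Otimes>\<^sub>M (lborel :: real measure). P z"
    using assms unfolding lborel_prod .
  show "AE x in lborel. AE t in lborel. P (x, t)" using lborel_pair.AE_pair[OF P] .
  have "AE z in distr (lborel \<Otimes>\<^sub>M lborel) (lborel \<Otimes>\<^sub>M lborel) (\<lambda>(x, y). (y, x)). P z"
    using P by (subst lborel_pair.distr_pair_swap[symmetric])
  then have "AE z in lborel \<Otimes>\<^sub>M (lborel :: real measure). P (case z of (x, y) \<Rightarrow> (y, x))"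
    by (rule AE_distrD[rotated]) measurable
  from lborel_pair.AE_pair[OF this] show "AE t in lborel. AE x in lborel. P (x, t)" by simp
qed

lemma AE_lebesgue_sections:
  assumes "AE z in (lebesgue :: (real \<times> real) measure). P z"
  shows "AE x in lebesgue. AE t in lebesgue. P (x, t)" "AE t in lebesgue. AE x in lebesgue. P (x, t)"
  using AE_lborel_sections[of P] assms by (simp_all add: AE_completion_iff)

lemma Fubini_lebesgue:
  fixes f :: "real \<times> real \<Rightarrow> 'b::euclidean_space"
  assumes f: "integrable lebesgue f"
  shows "AE t in lebesgue. integrable lebesgue (\<lambda>x. f (x, t))"
    and "AE x in lebesgue. integrable lebesgue (\<lambda>t. f (x, t))"
    and "integrable lebesgue (\<lambda>t. LINT x|lebesgue. f (x, t))"
    and "(LINT t|lebesgue. LINT x|lebesgue. f (x, t)) = (LINT z|lebesgue. f z)"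
proof -
  obtain f' where f'[measurable]: "f' \<in> borel_measurable borel" and eq: "AE z in lborel. f z = f' z"
    using ex_borel_version borel_measurable_integrable[OF f] by blast
  have eqL: "AE z in lebesgue. f z = f' z" using eq by (simp add: AE_completion_iff)
  have f'L: "f' \<in> borel_measurable lebesgue" using f' by (intro measurable_completion) simp
  have "integrable lebesgue f'"
    using f integrable_cong_AE[OF borel_measurable_integrable[OF f] f'L eqL] by simp
  then have "integrable lborel f'" using integrable_completion[of f' lborel] by simp
  then have int: "integrable (lborel \<Otimes>\<^sub>M lborel) (case_prod (\<lambda>x t. f' (x, t)))" by (simp add: lborel_prod)
  have tr: "integrable lebesgue g \<and> (LINT x|lebesgue. g x) = (LINT x|lborel. g' x)"
    if "AE x in lebesgue. g x = g' x" "integrable lborel g'" for g g' :: "real \<Rightarrow> 'b"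
  proof -
    have g'm: "g' \<in> borel_measurable lebesgue"
      using borel_measurable_integrable[OF that(2)] by (rule measurable_completion)
    have ae: "AE x in lebesgue. g' x = g x" using that(1) by eventually_elim simp
    have gm: "g \<in> borel_measurable lebesgue" by (rule borel_measurable_AE[OF g'm ae])
    have i: "integrable lebesgue g'"
      using that(2) integrable_completion[of g' lborel] borel_measurable_integrable[OF that(2)] by simp
    then have "integrable lebesgue g" using integrable_cong_AE[OF gm g'm that(1)] by simp
    moreover have "(LINT x|lebesgue. g x) = (LINT x|lebesgue. g' x)" by (rule integral_cong_AE[OF gm g'm that(1)])
    moreover have "(LINT x|lebesgue. g' x) = (LINT x|lborel. g' x)"
      by (rule integral_completion) (use borel_measurable_integrable[OF that(2)] in simp)
    ultimately show ?thesis by simp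
  qed
  have 1: "AE t in lebesgue. AE x in lebesgue. f (x, t) = f' (x, t)"
    "AE x in lebesgue. AE t in lebesgue. f (x, t) = f' (x, t)"
    using AE_lebesgue_sections[OF eqL] by auto
  have 2: "AE t in lebesgue. integrable lborel (\<lambda>x. f' (x, t))" "AE x in lebesgue. integrable lborel (\<lambda>t. f' (x, t))"
    using lborel_pair.AE_integrable_snd[OF int] lborel_pair.AE_integrable_fst[OF int]
    by (simp_all add: AE_completion_iff)
  show "AE t in lebesgue. integrable lebesgue (\<lambda>x. f (x, t))"
    using 1(1) 2(1) by eventually_elim (rule conjunct1[OF tr])
  show "AE x in lebesgue. integrable lebesgue (\<lambda>t. f (x, t))"
    using 1(2) 2(2) by eventually_elim (rule conjunct1[OF tr])
  have 3: "AE t in lebesgue. (LINT x|lebesgue. f (x, t)) = (LINT x|lborel. f' (x, t))"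
    using 1(1) 2(1) by eventually_elim (rule conjunct2[OF tr])
  note 4 = tr[OF 3 lborel_pair.integrable_snd[OF int]]
  show "integrable lebesgue (\<lambda>t. LINT x|lebesgue. f (x, t))" by (rule conjunct1[OF 4])
  have "(LINT t|lebesgue. LINT x|lebesgue. f (x, t)) = (LINT t|lborel. LINT x|lborel. f' (x, t))" by (rule conjunct2[OF 4])
  also have "\<dots> = (LINT z|lborel. f' z)"
    using lborel_pair.integral_snd[OF int] by (simp add: lborel_prod)
  also have "\<dots> = (LINT z|lebesgue. f' z)" by (rule integral_completion[symmetric]) simp
  also have "\<dots> = (LINT z|lebesgue. f z)"
    by (rule integral_cong_AE[symmetric, OF borel_measurable_integrable[OF f] f'L eqL])
  finally show "(LINT t|lebesgue. LINT x|lebesgue. f (x, t)) = (LINT z|lebesgue. f z)" .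
qed

lemma Times_sets_lebesgue:
  fixes A B :: "real set"
  assumes "A \<in> sets borel" "B \<in> sets borel"
  shows "A \<times> B \<in> sets (lebesgue :: (real \<times> real) measure)"
proof -
  have "A \<times> B \<in> sets (lborel \<Otimes>\<^sub>M lborel)" using assms by (intro pair_measureI) auto
  then have "A \<times> B \<in> sets (lborel :: (real \<times> real) measure)" unfolding lborel_prod .
  then show ?thesis by blast
qed

lemma AE_lebesgue_on_iff:
  assumes "S \<in> sets lebesgue"
  shows "(AE z in lebesgue_on S. P z) \<longleftrightarrow> (AE z in lebesgue. z \<in> S \<longrightarrow> P z)"
  using assms by (subst AE_restrict_space_iff) auto

lemma AE_lebesgue_on_sections:
  fixes A B :: "real set"
  assumes [measurable]: "A \<in> sets borel" "B \<in> sets borel" and P: "AE z in lebesgue_on (A \<times> B). P z"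
  shows "AE x in lebesgue_on A. AE t in lebesgue_on B. P (x, t)"
    and "AE t in lebesgue_on B. AE x in lebesgue_on A. P (x, t)"
proof -
  have AB: "A \<in> sets lebesgue" "B \<in> sets lebesgue" "A \<times> B \<in> sets lebesgue"
    using assms Times_sets_lebesgue by auto
  have "AE z in lebesgue. z \<in> A \<times> B \<longrightarrow> P z" using P by (simp add: AE_lebesgue_on_iff AB)
  note s = AE_lebesgue_sections[OF this]
  show "AE x in lebesgue_on A. AE t in lebesgue_on B. P (x, t)"
    unfolding AE_lebesgue_on_iff[OF AB(1)] AE_lebesgue_on_iff[OF AB(2)]
    using s(1) by eventually_elim (auto elim: eventually_mono)
  show "AE t in lebesgue_on B. AE x in lebesgue_on A. P (x, t)"
    unfolding AE_lebesgue_on_iff[OF AB(1)] AE_lebesgue_on_iff[OF AB(2)]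
    using s(2) by eventually_elim (auto elim: eventually_mono)
qed

lemma Fubini_lebesgue_on:
  fixes f :: "real \<times> real \<Rightarrow> 'b::euclidean_space"
  assumes AB: "A \<in> sets borel" "B \<in> sets borel" and f: "integrable (lebesgue_on (A \<times> B)) f"
  shows "AE t in lebesgue_on B. integrable (lebesgue_on A) (\<lambda>x. f (x, t))"
    and "AE x in lebesgue_on A. integrable (lebesgue_on B) (\<lambda>t. f (x, t))"
    and "integrable (lebesgue_on B) (\<lambda>t. LINT x|lebesgue_on A. f (x, t))"
    and "(LINT t|lebesgue_on B. LINT x|lebesgue_on A. f (x, t)) = (LINT z|lebesgue_on (A \<times> B). f z)"
proof -
  have L: "A \<in> sets lebesgue" "B \<in> sets lebesgue" "A \<times> B \<in> sets lebesgue"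
    using AB Times_sets_lebesgue by auto
  define g where "g z = indicat_real (A \<times> B) z *\<^sub>R f z" for z
  have g: "integrable lebesgue g"
    using f L(3) unfolding g_def[abs_def] by (subst integrable_restrict_space[symmetric]) auto
  have gA: "(\<lambda>x. g (x, t)) = (\<lambda>x. indicat_real A x *\<^sub>R f (x, t))" if "t \<in> B" for t
    using that by (auto simp: g_def indicator_def)
  have gB: "(\<lambda>t. g (x, t)) = (\<lambda>t. indicat_real B t *\<^sub>R f (x, t))" if "x \<in> A" for x
    using that by (auto simp: g_def indicator_def)
  note F = Fubini_lebesgue[OF g]
  have iA: "integrable (lebesgue_on A) h \<longleftrightarrow> integrable lebesgue (\<lambda>x. indicat_real A x *\<^sub>R h x)" for h :: "real \<Rightarrow> 'b"
    using L by (subst integrable_restrict_space) auto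
  have iB: "integrable (lebesgue_on B) h \<longleftrightarrow> integrable lebesgue (\<lambda>x. indicat_real B x *\<^sub>R h x)" for h :: "real \<Rightarrow> 'b"
    using L by (subst integrable_restrict_space) auto
  show "AE t in lebesgue_on B. integrable (lebesgue_on A) (\<lambda>x. f (x, t))"
    unfolding AE_lebesgue_on_iff[OF L(2)] using F(1) by eventually_elim (auto simp: iA gA)
  show "AE x in lebesgue_on A. integrable (lebesgue_on B) (\<lambda>t. f (x, t))"
    unfolding AE_lebesgue_on_iff[OF L(1)] using F(2) by eventually_elim (auto simp: iB gB)
  have inner: "(\<lambda>t. LINT x|lebesgue. g (x, t)) = (\<lambda>t. indicat_real B t *\<^sub>R (LINT x|lebesgue_on A. f (x, t)))"
  proof
    fix t
    show "(LINT x|lebesgue. g (x, t)) = indicat_real B t *\<^sub>R (LINT x|lebesgue_on A. f (x, t))"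
    proof (cases "t \<in> B")
      case True
      have "(LINT x|lebesgue_on A. f (x, t)) = (LINT x|lebesgue. indicat_real A x *\<^sub>R f (x, t))"
        using L by (intro integral_restrict_space) auto
      then show ?thesis using True by (simp add: gA)
    next
      case False
      then have "(\<lambda>x. g (x, t)) = (\<lambda>x. 0)" by (auto simp: g_def)
      then show ?thesis using False by simp
    qed
  qed
  show "integrable (lebesgue_on B) (\<lambda>t. LINT x|lebesgue_on A. f (x, t))"
    unfolding iB using F(3) unfolding inner .
  have "(LINT t|lebesgue_on B. LINT x|lebesgue_on A. f (x, t)) =
      (LINT t|lebesgue. indicat_real B t *\<^sub>R (LINT x|lebesgue_on A. f (x, t)))"
    using L by (intro integral_restrict_space) auto
  also have "\<dots> = (LINT z|lebesgue. g z)" using F(4) unfolding inner .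
  also have "\<dots> = (LINT z|lebesgue_on (A \<times> B). f z)"
    unfolding g_def[abs_def] using L by (intro integral_restrict_space[symmetric]) auto
  finally show "(LINT t|lebesgue_on B. LINT x|lebesgue_on A. f (x, t)) = (LINT z|lebesgue_on (A \<times> B). f z)" .
qed

text \<open>The converse of passing to sections requires joint measurability.\<close>

lemma AE_sections_zero_imp_AE_zero:
  fixes h :: "real \<times> real \<Rightarrow> complex"
  assumes AB: "A \<in> sets borel" "B \<in> sets borel" and h: "h \<in> borel_measurable (lebesgue_on (A \<times> B))"
    and zero: "AE x in lebesgue_on A. AE t in lebesgue_on B. h (x, t) = 0"
  shows "AE z in lebesgue_on (A \<times> B). h z = 0"
proof -
  have L: "A \<in> sets lebesgue" "B \<in> sets lebesgue" "A \<times> B \<in> sets lebesgue"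
    using AB Times_sets_lebesgue by auto
  define g where "g z = indicat_real (A \<times> B) z *\<^sub>R h z" for z
  have "g \<in> borel_measurable lebesgue"
    using h L(3) unfolding g_def[abs_def] by (subst borel_measurable_restrict_space_iff[symmetric]) auto
  then obtain g' where g'[measurable]: "g' \<in> borel_measurable borel" and eq: "AE z in lborel. g z = g' z"
    using ex_borel_version by blast
  have 1: "AE x in lborel. AE t in lborel. g (x, t) = 0"
  proof -
    have "AE x in lborel. x \<in> A \<longrightarrow> (AE t in lborel. t \<in> B \<longrightarrow> h (x, t) = 0)"
      using zero unfolding AE_lebesgue_on_iff[OF L(1)] AE_lebesgue_on_iff[OF L(2)] by (simp add: AE_completion_iff)
    then show ?thesis
    proof eventually_elim
      case (elim x)
      show ?case
      proof (cases "x \<in> A")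
        case True
        with elim have "AE t in lborel. t \<in> B \<longrightarrow> h (x, t) = 0" by simp
        then show ?thesis by eventually_elim (auto simp: g_def indicator_def)
      qed (simp add: g_def)
    qed
  qed
  have "AE x in lborel. AE t in lborel. g' (x, t) = 0"
    using 1 AE_lborel_sections(1)[OF eq]
  proof eventually_elim
    case (elim x)
    from elim(1,2) show ?case by eventually_elim simp
  qed
  moreover have [measurable]: "g' \<in> borel_measurable ((lborel :: real measure) \<Otimes>\<^sub>M (lborel :: real measure))"
    unfolding lborel_prod using g' by simp
  have "{z \<in> space (lborel \<Otimes>\<^sub>M lborel). g' z = 0} \<in> sets ((lborel :: real measure) \<Otimes>\<^sub>M (lborel :: real measure))"
    by measurable
  ultimately have "AE z in lborel \<Otimes>\<^sub>M lborel. g' z = 0"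
    by (intro lborel_pair.AE_pair_measure)
  then have "AE z in lborel. g' z = 0" unfolding lborel_prod .
  with eq have "AE z in lborel. g z = 0" by eventually_elim simp
  then have "AE z in lebesgue. g z = 0" by (simp add: AE_completion_iff)
  then show ?thesis unfolding AE_lebesgue_on_iff[OF L(3)] by eventually_elim (auto simp: g_def)
qed

lemma integrable_times_bounded_continuous:
  fixes k :: "real \<Rightarrow> real" and m :: "real \<times> real \<Rightarrow> real"
  assumes k: "integrable (lebesgue_on {a<..<b}) k" and m: "continuous_on ({a<..<b} \<times> {c<..<d}) m"
    and bound: "\<And>z. z \<in> {a<..<b} \<times> {c<..<d} \<Longrightarrow> \<bar>m z\<bar> \<le> K"
  shows "integrable (lebesgue_on ({a<..<b} \<times> {c<..<d})) (\<lambda>(x, t). k x * m (x, t))"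
proof -
  let ?A = "{a<..<b}" and ?B = "{c<..<d}"
  have L: "?A \<times> ?B \<in> sets lebesgue" by (rule Times_sets_lebesgue) auto
  have ki: "integrable lebesgue (\<lambda>x. indicat_real ?A x *\<^sub>R k x)"
    using k by (subst integrable_restrict_space[symmetric]) auto
  then obtain k' where k'[measurable]: "k' \<in> borel_measurable borel"
    and eq: "AE x in lborel. indicat_real ?A x *\<^sub>R k x = k' x"
    using ex_borel_version borel_measurable_integrable by blast
  have k'L: "k' \<in> borel_measurable lebesgue" using k' by (intro measurable_completion) simp
  have "integrable lebesgue k'"
    using ki integrable_cong_AE[OF borel_measurable_integrable[OF ki] k'L] eq by (simp add: AE_completion_iff)
  then have k'i: "integrable lborel k'" using integrable_completion[of k' lborel] by simp
  define m' where "m' z = indicat_real (?A \<times> ?B) z *\<^sub>R m z" for z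
  have "open (?A \<times> ?B)" by (intro open_Times) auto
  then have m'[measurable]: "m' \<in> borel_measurable borel"
    using borel_measurable_continuous_on_indicator[OF _ m] unfolding m'_def[abs_def] by simp
  have Kge: "\<bar>m' z\<bar> \<le> \<bar>K\<bar> * indicat_real ?B (snd z)" for z
    using bound[of z] by (auto simp: m'_def indicator_def)
  have "integrable (lborel \<Otimes>\<^sub>M lborel) (\<lambda>(x, t). k' x * indicat_real ?B t)"
  proof (rule lborel_pair.Fubini_integrable)
    show "(\<lambda>(x, t). k' x * indicat_real ?B t) \<in> borel_measurable (lborel \<Otimes>\<^sub>M lborel)" by measurable
    have Bi: "integrable lborel (indicat_real ?B)" by (cases "c \<le> d") (auto simp: integrable_indicator_iff)
    show "AE x in lborel. integrable lborel (\<lambda>y. case (x, y) of (x, t) \<Rightarrow> k' x * indicat_real ?B t)"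
      using Bi by simp
    have "(\<lambda>x. LINT y|lborel. norm (case (x, y) of (x, t) \<Rightarrow> k' x * indicat_real ?B t))
        = (\<lambda>x. \<bar>k' x\<bar> * (LINT y|lborel. indicat_real ?B y))"
      by (auto simp: abs_mult)
    then show "integrable lborel (\<lambda>x. LINT y|lborel. norm (case (x, y) of (x, t) \<Rightarrow> k' x * indicat_real ?B t))"
      using k'i by simp
  qed
  then have "integrable (lborel \<Otimes>\<^sub>M lborel) (\<lambda>z. \<bar>K\<bar> * (case z of (x, t) \<Rightarrow> k' x * indicat_real ?B t))"
    by (rule integrable_mult_right)
  then have "integrable (lborel \<Otimes>\<^sub>M lborel) (\<lambda>z. k' (fst z) * m' z)"
  proof (rule Bochner_Integration.integrable_bound)
    have [measurable]: "m' \<in> borel_measurable (lborel \<Otimes>\<^sub>M lborel)"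
      unfolding lborel_prod using m' by simp
    show "(\<lambda>z. k' (fst z) * m' z) \<in> borel_measurable (lborel \<Otimes>\<^sub>M lborel)" by measurable
    show "AE z in lborel \<Otimes>\<^sub>M lborel. norm (k' (fst z) * m' z) \<le> norm (\<bar>K\<bar> * (case z of (x, t) \<Rightarrow> k' x * indicat_real ?B t))"
    proof (rule AE_I2)
      fix z :: "real \<times> real"
      have "\<bar>k' (fst z)\<bar> * \<bar>m' z\<bar> \<le> \<bar>k' (fst z)\<bar> * (\<bar>K\<bar> * indicat_real ?B (snd z))"
        by (intro mult_left_mono Kge) auto
      then show "norm (k' (fst z) * m' z) \<le> norm (\<bar>K\<bar> * (case z of (x, t) \<Rightarrow> k' x * indicat_real ?B t))"
        by (simp add: abs_mult case_prod_beta algebra_simps)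
    qed
  qed
  then have int: "integrable lborel (\<lambda>z. k' (fst z) * m' z)" unfolding lborel_prod .
  have mL: "(\<lambda>z. k' (fst z) * m' z) \<in> borel_measurable lebesgue"
    using borel_measurable_integrable[OF int] by (rule measurable_completion)
  have intL: "integrable lebesgue (\<lambda>z. k' (fst z) * m' z)"
    using int integrable_completion[of "\<lambda>z. k' (fst z) * m' z" lborel] borel_measurable_integrable[OF int] by simp
  have "AE z in lborel \<Otimes>\<^sub>M (lborel :: real measure). indicat_real ?A (fst z) *\<^sub>R k (fst z) = k' (fst z)"
  proof -
    obtain N where N: "N \<in> null_sets lborel" "{x. indicat_real ?A x *\<^sub>R k x \<noteq> k' x} \<subseteq> N"
      using eq by (auto simp: eventually_ae_filter)
    have [measurable]: "N \<in> sets borel" using N(1) by auto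
    have "AE x in lborel. AE t in lborel. fst (x, t :: real) \<notin> N"
      using AE_not_in[OF N(1)] by eventually_elim simp
    moreover have "{z \<in> space (lborel \<Otimes>\<^sub>M lborel). fst z \<notin> N}
        \<in> sets ((lborel :: real measure) \<Otimes>\<^sub>M (lborel :: real measure))"
      by measurable
    ultimately have "AE z in lborel \<Otimes>\<^sub>M (lborel :: real measure). fst z \<notin> N"
      by (intro lborel_pair.AE_pair_measure) auto
    then show ?thesis by eventually_elim (use N(2) in blast)
  qed
  then have "AE z in lborel. indicat_real ?A (fst z) *\<^sub>R k (fst z) = k' (fst (z :: real \<times> real))"
    unfolding lborel_prod .
  then have "AE z in lebesgue. k' (fst z) * m' z = indicat_real (?A \<times> ?B) z *\<^sub>R (case z of (x, t) \<Rightarrow> k x * m (x, t))"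
    unfolding AE_completion_iff by eventually_elim (auto simp: m'_def indicator_def)
  note ae = this
  have "integrable lebesgue (\<lambda>z. indicat_real (?A \<times> ?B) z *\<^sub>R (case z of (x, t) \<Rightarrow> k x * m (x, t)))"
    using intL integrable_cong_AE[OF mL borel_measurable_AE[OF mL ae] ae] by simp
  then show ?thesis using L by (subst integrable_restrict_space) auto
qed

section \<open>Regularity of time-harmonic solutions on one edge\<close>

text \<open>Let \<open>K\<close> be a double primitive of \<open>v\<close>. Two integrations by parts show that \<open>U - K\<close> is orthogonal to
  all second derivatives of test functions, so it is affine.\<close>

lemma weak_second_derivative_imp_C1:
  fixes U v :: "real \<Rightarrow> real"
  assumes ab: "a < b" and contU: "continuous_on {a..b} U" and v: "v absolutely_integrable_on {a..b}"
    and weak: "\<And>\<eta> \<eta>' \<eta>'' c d. a < c \<Longrightarrow> d < b \<Longrightarrow> (\<And>x. (\<eta> has_real_derivative \<eta>' x) (at x)) \<Longrightarrow>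
      (\<And>x. (\<eta>' has_real_derivative \<eta>'' x) (at x)) \<Longrightarrow> continuous_on UNIV \<eta>'' \<Longrightarrow>
      (\<And>x. x \<notin> {c..d} \<Longrightarrow> \<eta> x = 0) \<Longrightarrow> (\<And>x. x \<notin> {c..d} \<Longrightarrow> \<eta>' x = 0) \<Longrightarrow>
      integral {a..b} (\<lambda>x. \<eta>'' x * U x) = integral {a..b} (\<lambda>x. \<eta> x * v x)"
  shows "\<exists>D. lebesgue_primitive a b D v \<and>
           (\<forall>x\<in>{a..b}. (U has_real_derivative D x) (at x within {a..b}))"
proof -
  define H where "H x = integral {a..x} v" for x
  have H: "lebesgue_primitive a b H v" using v by (simp add: lebesgue_primitive_def H_def)
  note contH = lebesgue_primitive_continuous[OF H]
  define K where "K x = integral {a..x} H" for x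
  have K': "(K has_real_derivative H x) (at x within {a..b})" if "x \<in> {a..b}" for x
    unfolding K_def using integral_has_real_derivative[OF contH that] by simp
  have K: "lebesgue_primitive a b K H" by (rule lebesgue_primitive_C1[OF contH K'])
  have contK: "continuous_on {a..b} K" by (rule lebesgue_primitive_continuous[OF K])
  have "\<exists>\<alpha> \<beta>. \<forall>x\<in>{a..b}. U x - K x = \<alpha> + \<beta> * x"
  proof (rule second_order_du_Bois_Reymond[OF ab])
    show "continuous_on {a..b} (\<lambda>x. U x - K x)" by (intro continuous_intros contU contK)
    fix \<eta> \<eta>' \<eta>'' c d
    assume cd: "a < c" "c < d" "d < b"
      and \<eta>: "\<And>x. (\<eta> has_real_derivative \<eta>' x) (at x)" "\<And>x. (\<eta>' has_real_derivative \<eta>'' x) (at x)"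
        "continuous_on UNIV \<eta>''" "\<And>x. x \<notin> {c..d} \<Longrightarrow> \<eta> x = 0" "\<And>x. x \<notin> {c..d} \<Longrightarrow> \<eta>' x = 0"
        "\<And>x. x \<notin> {c..d} \<Longrightarrow> \<eta>'' x = 0"
    have out: "\<eta> a = 0" "\<eta> b = 0" "\<eta>' a = 0" "\<eta>' b = 0" using \<eta> cd by auto
    have cont: "continuous_on {a..b} \<eta>'" "continuous_on {a..b} \<eta>''"
      using DERIV_continuous_on[of UNIV \<eta>' \<eta>''] \<eta> continuous_on_subset by blast+
    have P: "lebesgue_primitive a b \<eta> \<eta>'" "lebesgue_primitive a b \<eta>' \<eta>''"
      by (rule lebesgue_primitive_C1[OF cont(1)] lebesgue_primitive_C1[OF cont(2)],
          rule DERIV_subset[OF \<eta>(1)] DERIV_subset[OF \<eta>(2)], simp)+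
    \<comment> \<open>integration by parts twice\<close>
    have 1: "integral {a..b} (\<lambda>x. K x * \<eta>'' x + \<eta>' x * H x) = 0"
      using lebesgue_primitive_diff(1)[OF lebesgue_primitive_mult[OF P(2) K], of a b] out ab by simp
    have 2: "integral {a..b} (\<lambda>x. H x * \<eta>' x + \<eta> x * v x) = 0"
      using lebesgue_primitive_diff(1)[OF lebesgue_primitive_mult[OF P(1) H], of a b] out ab by simp
    have i: "(\<lambda>x. K x * \<eta>'' x) integrable_on {a..b}" "(\<lambda>x. U x * \<eta>'' x) integrable_on {a..b}"
      "(\<lambda>x. H x * \<eta>' x) integrable_on {a..b}"
      by (intro integrable_continuous_real continuous_intros contK contU contH cont)+
    have "(\<lambda>x. \<eta> x * v x) absolutely_integrable_on {a..b}"
      by (rule absolutely_integrable_continuous_mult[OF lebesgue_primitive_continuous[OF P(1)] v])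
    then have i2: "(\<lambda>x. \<eta> x * v x) integrable_on {a..b}" by (simp add: absolutely_integrable_on_def)
    have 3: "integral {a..b} (\<lambda>x. \<eta>'' x * U x) = integral {a..b} (\<lambda>x. \<eta> x * v x)"
      by (rule weak[OF cd(1,3) \<eta>(1-5)])
    have 4: "integral {a..b} (\<lambda>x. K x * \<eta>'' x) + integral {a..b} (\<lambda>x. H x * \<eta>' x) = 0"
      using 1 integral_add[OF i(1,3)] by (simp add: algebra_simps)
    have 5: "integral {a..b} (\<lambda>x. H x * \<eta>' x) + integral {a..b} (\<lambda>x. \<eta> x * v x) = 0"
      using 2 integral_add[OF i(3) i2] by simp
    have "integral {a..b} (\<lambda>x. \<eta>'' x * (U x - K x)) = 0"
      using integral_diff[OF i(2,1)] 3 4 5 by (simp add: algebra_simps)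
    moreover have "integral {c..d} (\<lambda>x. \<eta>'' x * (U x - K x))
        = integral {a..b} (\<lambda>x. if x \<in> {c..d} then \<eta>'' x * (U x - K x) else 0)"
      using cd Henstock_Kurzweil_Integration.integral_restrict_Int[of "{a..b}" "{c..d}"
        "\<lambda>x. \<eta>'' x * (U x - K x)"] by (simp add: Int_absorb2)
    moreover have "\<dots> = integral {a..b} (\<lambda>x. \<eta>'' x * (U x - K x))"
      by (rule Henstock_Kurzweil_Integration.integral_cong) (use \<eta>(6) in auto)
    ultimately show "integral {c..d} (\<lambda>x. \<eta>'' x * (U x - K x)) = 0" by simp
  qed
  then obtain \<alpha> \<beta> where \<alpha>\<beta>: "\<And>x. x \<in> {a..b} \<Longrightarrow> U x - K x = \<alpha> + \<beta> * x" by blast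
  define D where "D x = H x + \<beta>" for x
  have "lebesgue_primitive a b D v"
    unfolding lebesgue_primitive_def
  proof (intro conjI ballI)
    fix x assume "x \<in> {a..b}"
    then show "D x = D a + integral {a..x} v" by (simp add: D_def H_def)
  qed (rule v)
  moreover have "(U has_real_derivative D x) (at x within {a..b})" if x: "x \<in> {a..b}" for x
  proof -
    have "((\<lambda>y. K y + (\<alpha> + \<beta> * y)) has_real_derivative D x) (at x within {a..b})"
      by (rule derivative_eq_intros K'[OF x] refl | simp add: D_def)+
    then show ?thesis
      by (rule has_field_derivative_transform_within[where d = 1]) (use x \<alpha>\<beta> in \<open>force simp: algebra_simps\<close>)+
  qed
  ultimately show ?thesis by blast
qed

lemma L2_fun_integrable:
  assumes g: "L2_fun S g" and S: "S \<in> lmeasurable"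
  shows "integrable (lebesgue_on S) g"
proof (rule Bochner_Integration.integrable_bound)
  have "integrable (lebesgue_on S) (\<lambda>z. 1 :: real)"
    by (rule absolutely_integrable_imp_integrable) (use S in auto)
  then show "integrable (lebesgue_on S) (\<lambda>z. 1 + (norm (g z))^2)"
    using g by (intro Bochner_Integration.integrable_add) (auto simp: L2_fun_def)
  show "AE z in lebesgue_on S. norm (g z) \<le> norm (1 + (norm (g z))^2)"
  proof (rule AE_I2)
    fix z
    have "2 * norm (g z) \<le> 1 + (norm (g z))^2" using sum_squares_bound[of "norm (g z)" 1] by simp
    then have "norm (g z) \<le> 1 + (norm (g z))^2" using norm_ge_zero[of "g z"] by linarith
    then show "norm (g z) \<le> norm (1 + (norm (g z))^2)" by simp
  qed
qed (use g in \<open>simp add: L2_fun_def\<close>)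


lemma integrable_Ioo_imp_absolutely_integrable:
  fixes g :: "real \<Rightarrow> 'a::euclidean_space"
  assumes "integrable (lebesgue_on {a<..<b}) g"
  shows "g absolutely_integrable_on {a..b}"
proof -
  have "integrable lebesgue (\<lambda>x. indicat_real {a<..<b} x *\<^sub>R g x)"
    using assms by (subst integrable_restrict_space[symmetric]) auto
  then have "g absolutely_integrable_on {a<..<b}" by (simp add: set_integrable_def)
  then show ?thesis using absolutely_integrable_on_Icc_iff_Ioo by blast
qed

text \<open>Both functions satisfy the same integration by parts formula against test functions, so their
  difference falls under the fundamental lemma.\<close>

lemma weak_deriv_eq_classical:
  fixes G G' h :: "real \<Rightarrow> complex"
  assumes ab: "a < b" and weak: "weak_deriv a b G h"
    and G: "\<And>x. (G has_vector_derivative G' x) (at x)" "continuous_on UNIV G'"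
    and h: "integrable (lebesgue_on {a<..<b}) h"
  shows "AE x in lebesgue_on {a<..<b}. h x = G' x"
proof -
  have contG: "continuous_on UNIV G"
    using G(1) by (auto intro!: continuous_at_imp_continuous_on has_vector_derivative_continuous)
  note hA = integrable_Ioo_imp_absolutely_integrable[OF h]
  have G'A: "G' absolutely_integrable_on {a..b}"
    by (rule absolutely_integrable_continuous_real) (rule continuous_on_subset[OF G(2)], simp)
  have GA: "G absolutely_integrable_on {a..b}"
    by (rule absolutely_integrable_continuous_real) (rule continuous_on_subset[OF contG], simp)
  have "AE x in lebesgue_on {a<..<b}. h x - G' x = 0"
  proof (rule fundamental_lemma_calculus_of_variations)
    show "(\<lambda>x. h x - G' x) absolutely_integrable_on {a..b}"
      by (rule set_integral_diff(1)[OF hA G'A])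
    fix \<eta> assume \<eta>: "test_fun a b \<eta>"
    have \<eta>': "(\<eta> has_real_derivative deriv \<eta> x) (at x)" for x
      using \<eta> by (simp add: test_fun_def DERIV_deriv_iff_real_differentiable)
    have cont\<eta>': "continuous_on {a..b} (deriv \<eta>)"
      using \<eta> by (auto simp: test_fun_def intro: continuous_on_subset)
    have out: "\<eta> a = 0" "\<eta> b = 0" using \<eta> by (force simp: test_fun_def)+
    note sc = absolutely_integrable_scaleR_continuous
    note c\<eta> = test_fun_continuous[OF \<eta>]
    have i: "(\<lambda>x. deriv \<eta> x *\<^sub>R G x) absolutely_integrable_on {a..b}"
      "(\<lambda>x. \<eta> x *\<^sub>R G' x) absolutely_integrable_on {a..b}" "(\<lambda>x. \<eta> x *\<^sub>R h x) absolutely_integrable_on {a..b}"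
      using sc[OF cont\<eta>' GA] sc[OF c\<eta> G'A] sc[OF c\<eta> hA] by auto
    have "((\<lambda>x. deriv \<eta> x *\<^sub>R G x + \<eta> x *\<^sub>R G' x) has_integral (\<eta> b *\<^sub>R G b - \<eta> a *\<^sub>R G a)) {a..b}"
    proof (rule fundamental_theorem_of_calculus)
      fix x
      have "((\<lambda>x. \<eta> x *\<^sub>R G x) has_vector_derivative (\<eta> x *\<^sub>R G' x + deriv \<eta> x *\<^sub>R G x)) (at x within {a..b})"
        by (intro has_vector_derivative_scaleR has_vector_derivative_at_within[OF G(1)]
            has_field_derivative_at_within[OF \<eta>'])
      then show "((\<lambda>x. \<eta> x *\<^sub>R G x) has_vector_derivative (deriv \<eta> x *\<^sub>R G x + \<eta> x *\<^sub>R G' x)) (at x within {a..b})"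
        by (simp add: add.commute)
    qed (use ab in simp)
    then have "integral {a..b} (\<lambda>x. deriv \<eta> x *\<^sub>R G x + \<eta> x *\<^sub>R G' x) = 0"
      using out by (simp add: integral_unique)
    then have 1: "integral {a..b} (\<lambda>x. deriv \<eta> x *\<^sub>R G x) + integral {a..b} (\<lambda>x. \<eta> x *\<^sub>R G' x) = 0"
      using i(1,2) by (subst (asm) integral_add) (auto simp: absolutely_integrable_on_def)
    have 2: "integral {a..b} (\<lambda>x. deriv \<eta> x *\<^sub>R G x) = - integral {a..b} (\<lambda>x. \<eta> x *\<^sub>R h x)"
      using weak \<eta> LINT_Ioo_eq_integral(1)[OF i(1)] LINT_Ioo_eq_integral(1)[OF i(3)]
      by (simp add: weak_deriv_def)
    have "(\<lambda>x. \<eta> x *\<^sub>R (h x - G' x)) = (\<lambda>x. \<eta> x *\<^sub>R h x - \<eta> x *\<^sub>R G' x)"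
      by (simp add: scaleR_diff_right)
    then have "(LINT x|lebesgue_on {a<..<b}. \<eta> x *\<^sub>R (h x - G' x)) = integral {a..b} (\<lambda>x. \<eta> x *\<^sub>R h x - \<eta> x *\<^sub>R G' x)"
      using LINT_Ioo_eq_integral(1)[OF set_integral_diff(1)[OF i(3,2)]] by simp
    also have "\<dots> = integral {a..b} (\<lambda>x. \<eta> x *\<^sub>R h x) - integral {a..b} (\<lambda>x. \<eta> x *\<^sub>R G' x)"
      using i by (intro integral_diff) (auto simp: absolutely_integrable_on_def)
    also have "\<dots> = 0" using 1 2 by (simp add: add_eq_0_iff)
    finally show "(LINT x|lebesgue_on {a<..<b}. \<eta> x *\<^sub>R (h x - G' x)) = 0" .
  qed
  then show ?thesis by eventually_elim simp
qed

lemma borel_measurable_lebesgue_on_AE: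
  fixes f g :: "'a::euclidean_space \<Rightarrow> 'b::euclidean_space"
  assumes f: "f \<in> borel_measurable (lebesgue_on S)" and S: "S \<in> sets lebesgue"
    and ae: "AE x in lebesgue_on S. f x = g x"
  shows "g \<in> borel_measurable (lebesgue_on S)"
proof -
  have "(\<lambda>x. indicat_real S x *\<^sub>R f x) \<in> borel_measurable lebesgue"
    using f S by (subst borel_measurable_restrict_space_iff[symmetric]) auto
  moreover have "AE x in lebesgue. indicat_real S x *\<^sub>R f x = indicat_real S x *\<^sub>R g x"
    using ae unfolding AE_lebesgue_on_iff[OF S] by eventually_elim (auto simp: indicator_def)
  ultimately have "(\<lambda>x. indicat_real S x *\<^sub>R g x) \<in> borel_measurable lebesgue"
    by (rule borel_measurable_AE)
  then show ?thesis using S by (subst borel_measurable_restrict_space_iff) auto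
qed

lemma ex_in_Ioo_if_AE:
  fixes a b :: real
  assumes "a < b" "AE t in lebesgue_on {a<..<b}. P t"
  shows "\<exists>t\<in>{a<..<b}. P t"
proof (rule ccontr)
  assume neg: "\<not> ?thesis"
  have "AE t in lebesgue. t \<in> {a<..<b} \<longrightarrow> P t"
    using assms(2) by (subst (asm) AE_lebesgue_on_iff) auto
  then have "AE t in lebesgue. t \<notin> {a<..<b}" by eventually_elim (use neg in blast)
  then have "{a<..<b} \<in> null_sets lebesgue" by (subst AE_iff_null_sets) auto
  then have "negligible {a<..<b}" by (simp add: negligible_iff_null_sets)
  then show False using open_not_negligible[of "{a<..<b}"] assms(1) by auto
qed

text \<open>What the energy argument uses of a time-harmonic solution on one edge: \<open>D = U'\<close> holds in the classical
  sense up to the end points, and \<open>v = U''\<close> in the sense of absolutely continuous functions. As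
  \<open>lebesgue_primitive\<close> is a notion for real functions, real and imaginary parts are listed separately.\<close>

definition helmholtz_profile :: "real \<Rightarrow> real \<Rightarrow> real \<Rightarrow> (real \<Rightarrow> complex) \<Rightarrow> (real \<Rightarrow> complex) \<Rightarrow>
    (real \<Rightarrow> complex) \<Rightarrow> (real \<Rightarrow> complex) \<Rightarrow> (real \<Rightarrow> complex) \<Rightarrow> bool" where
  "helmholtz_profile a b \<omega> p F U D v \<longleftrightarrow>
     continuous_on {a..b} U \<and>
     (\<forall>x\<in>{a..b}. (U has_vector_derivative D x) (at x within {a..b})) \<and>
     lebesgue_primitive a b (\<lambda>x. Re (D x)) (\<lambda>x. Re (v x)) \<and>
     lebesgue_primitive a b (\<lambda>x. Im (D x)) (\<lambda>x. Im (v x)) \<and>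
     v \<in> borel_measurable (lebesgue_on {a<..<b}) \<and>
     integrable (lebesgue_on {a<..<b}) (\<lambda>x. (norm (v x))^2) \<and>
     (AE x in lebesgue_on {a<..<b}. v x + complex_of_real \<omega> * U x + p x * U x = F x)"

lemma weak_derivs_imp_C1:
  fixes U u1 u2 :: "real \<Rightarrow> complex"
  assumes ab: "a < b" and contU: "continuous_on {a..b} U" and z: "z \<noteq> 0"
    and w1: "weak_deriv a b (\<lambda>x. U x * z) u1" and w2: "weak_deriv a b u1 u2"
    and u2: "integrable (lebesgue_on {a<..<b}) u2"
  shows "\<exists>D. (\<forall>x\<in>{a..b}. (U has_vector_derivative D x) (at x within {a..b})) \<and>
     lebesgue_primitive a b (\<lambda>x. Re (D x)) (\<lambda>x. Re (u2 x / z)) \<and>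
     lebesgue_primitive a b (\<lambda>x. Im (D x)) (\<lambda>x. Im (u2 x / z))"
proof -
  note u2A = integrable_Ioo_imp_absolutely_integrable[OF u2]
  have UA: "(\<lambda>x. U x * z) absolutely_integrable_on {a..b}"
    by (intro absolutely_integrable_continuous_real continuous_intros contU)
  have main: "\<exists>D. lebesgue_primitive a b D (\<lambda>x. h (u2 x)) \<and>
      (\<forall>x\<in>{a..b}. ((\<lambda>x. h (U x * z)) has_real_derivative D x) (at x within {a..b}))"
    if h: "bounded_linear h" for h :: "complex \<Rightarrow> real"
  proof (rule weak_second_derivative_imp_C1[OF ab])
    interpret h: bounded_linear h by (rule h)
    show "continuous_on {a..b} (\<lambda>x. h (U x * z))" by (intro h.continuous_on continuous_intros contU)
    show "(\<lambda>x. h (u2 x)) absolutely_integrable_on {a..b}"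
      using absolutely_integrable_linear[OF u2A h] by (simp add: o_def)
    fix \<eta> \<eta>' \<eta>'' :: "real \<Rightarrow> real" and c d :: real
    assume cd: "a < c" "d < b"
      and \<eta>: "\<And>x. (\<eta> has_real_derivative \<eta>' x) (at x)" "\<And>x. (\<eta>' has_real_derivative \<eta>'' x) (at x)"
        "continuous_on UNIV \<eta>''" "\<And>x. x \<notin> {c..d} \<Longrightarrow> \<eta> x = 0" "\<And>x. x \<notin> {c..d} \<Longrightarrow> \<eta>' x = 0"
    have cont\<eta>': "continuous_on UNIV \<eta>'" using DERIV_continuous_on[of UNIV \<eta>' \<eta>''] \<eta>(2) by blast
    have t1: "test_fun a b \<eta>" by (rule test_funI[OF \<eta>(1) cont\<eta>' cd \<eta>(4)])
    have t2: "test_fun a b \<eta>'" by (rule test_funI[OF \<eta>(2,3) cd \<eta>(5)])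
    have d: "deriv \<eta> = \<eta>'" "deriv \<eta>' = \<eta>''" using \<eta>(1,2) DERIV_imp_deriv by blast+
    have c: "continuous_on {a..b} \<eta>" "continuous_on {a..b} \<eta>''"
      using test_fun_continuous[OF t1] \<eta>(3) continuous_on_subset by blast+
    note i1 = absolutely_integrable_scaleR_continuous[OF c(2) UA]
    note i2 = absolutely_integrable_scaleR_continuous[OF c(1) u2A]
    have "(LINT x|lebesgue_on {a<..<b}. \<eta>'' x *\<^sub>R (U x * z)) = (LINT x|lebesgue_on {a<..<b}. \<eta> x *\<^sub>R u2 x)"
      using w1[unfolded weak_deriv_def, rule_format, OF t2] w2[unfolded weak_deriv_def, rule_format, OF t1]
      by (simp add: d)
    then have eq: "integral {a..b} (\<lambda>x. \<eta>'' x *\<^sub>R (U x * z)) = integral {a..b} (\<lambda>x. \<eta> x *\<^sub>R u2 x)"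
      using LINT_Ioo_eq_integral(1)[OF i1] LINT_Ioo_eq_integral(1)[OF i2] by simp
    have "integral {a..b} (\<lambda>x. \<eta>'' x * h (U x * z)) = h (integral {a..b} (\<lambda>x. \<eta>'' x *\<^sub>R (U x * z)))"
      using integral_linear[OF _ h, of "\<lambda>x. \<eta>'' x *\<^sub>R (U x * z)" "{a..b}"] i1
      by (simp add: o_def h.scaleR absolutely_integrable_on_def)
    also have "\<dots> = h (integral {a..b} (\<lambda>x. \<eta> x *\<^sub>R u2 x))" by (simp only: eq)
    also have "\<dots> = integral {a..b} (\<lambda>x. \<eta> x * h (u2 x))"
      using integral_linear[OF _ h, of "\<lambda>x. \<eta> x *\<^sub>R u2 x" "{a..b}"] i2
      by (simp add: o_def h.scaleR absolutely_integrable_on_def)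
    finally show "integral {a..b} (\<lambda>x. \<eta>'' x * h (U x * z)) = integral {a..b} (\<lambda>x. \<eta> x * h (u2 x))" .
  qed
  have "bounded_linear (\<lambda>w. w / z)" by (rule bounded_linear_divide)
  then have bl: "bounded_linear (\<lambda>w. Re (w / z))" "bounded_linear (\<lambda>w. Im (w / z))"
    using bounded_linear_compose[OF bounded_linear_Re] bounded_linear_compose[OF bounded_linear_Im] by blast+
  obtain Dr where Dr: "lebesgue_primitive a b Dr (\<lambda>x. Re (u2 x / z))"
    "\<And>x. x \<in> {a..b} \<Longrightarrow> ((\<lambda>x. Re (U x * z / z)) has_real_derivative Dr x) (at x within {a..b})"
    using main[OF bl(1)] by blast
  obtain Di where Di: "lebesgue_primitive a b Di (\<lambda>x. Im (u2 x / z))"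
    "\<And>x. x \<in> {a..b} \<Longrightarrow> ((\<lambda>x. Im (U x * z / z)) has_real_derivative Di x) (at x within {a..b})"
    using main[OF bl(2)] by blast
  show ?thesis
    using Dr Di z by (intro exI[of _ "\<lambda>x. Complex (Dr x) (Di x)"]) (simp add: has_vector_derivative_complex_iff)
qed

text \<open>The explicit dependence on time identifies the weak time derivative as \<open>- i \<omega> u\<close> almost everywhere
  in the cylinder. By Fubini's theorem there is a time at which the resulting equation holds for almost
  every \<open>x\<close> and at which \<open>u\<close> has weak space derivatives in \<open>L\<^sup>2\<close>. Any such time determines \<open>U\<close> and
  its derivatives, because the phase factor never vanishes.\<close>

lemma time_harmonic_edge_profile:
  fixes U F p :: "real \<Rightarrow> complex" and \<omega> \<phi>0 :: real
  defines "E \<equiv> \<lambda>t. exp (- \<i> * complex_of_real (\<omega> * t + \<phi>0))"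
  assumes ab: "a < b" and T: "T > 0"
    and H: "H1_H2 a b T (\<lambda>x t. U x * E t) uxx ut"
    and eq: "AE (x, t) in lebesgue_on ({a<..<b} \<times> {-T<..<T}).
               \<i> * ut x t + uxx x t + p x * (U x * E t) = F x * E t"
  shows "\<exists>D v. helmholtz_profile a b \<omega> p F U D v"
proof -
  let ?A = "{a<..<b}" and ?B = "{-T<..<T}"
  have E0: "E t \<noteq> 0" for t by (simp add: E_def)
  have E': "(E has_vector_derivative (- \<i> * complex_of_real \<omega>) * E t) (at t)" for t
  proof -
    have "((\<lambda>t. - \<i> * complex_of_real (\<omega> * t + \<phi>0)) has_vector_derivative (- \<i> * complex_of_real \<omega>)) (at t)"
      by (auto intro!: derivative_eq_intros simp: has_vector_derivative_def scaleR_conv_of_real algebra_simps)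
    from field_vector_diff_chain_at[OF this DERIV_exp] show ?thesis
      by (simp add: E_def o_def)
  qed
  have contE: "continuous_on S E" for S unfolding E_def by (intro continuous_intros)
  have sets: "?A \<in> sets borel" "?B \<in> sets borel" by auto
  have lm: "?A \<times> ?B \<in> lmeasurable"
  proof (rule bounded_set_imp_lmeasurable)
    have "bounded {c<..<d}" for c d :: real by (rule bounded_subset[of "{c..d}"]) auto
    then show "bounded (?A \<times> ?B)" by (intro bounded_Times)
    show "?A \<times> ?B \<in> sets lebesgue" by (rule Times_sets_lebesgue) auto
  qed
  obtain ux utx utxx where L2: "L2_H2 a b T (\<lambda>x t. U x * E t) ux uxx" "L2_H2 a b T ut utx utxx"
    and wt: "AE x in lebesgue_on ?A. weak_deriv (-T) T (\<lambda>t. U x * E t) (ut x)"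
    and cont: "continuous_on ({a..b} \<times> {-T..T}) (\<lambda>(x, t). U x * E t)"
    using H unfolding H1_H2_def by blast
  have contU: "continuous_on {a..b} U"
  proof -
    have "continuous_on {a..b} (\<lambda>x. (case (x, 0) of (x, t) \<Rightarrow> U x * E t) / E 0)"
      by (intro continuous_intros continuous_on_compose2[OF cont, of "{a..b}" "\<lambda>x. (x, 0)"])
        (use T E0 in \<open>auto intro!: continuous_intros\<close>)
    then show ?thesis using E0 by simp
  qed
  have L2u: "L2_fun (?A \<times> ?B) (\<lambda>(x, t). U x * E t)" and L2uxx: "L2_fun (?A \<times> ?B) (\<lambda>(x, t). uxx x t)"
    and L2ut: "L2_fun (?A \<times> ?B) (\<lambda>(x, t). ut x t)"
    and weak: "AE t in lebesgue_on ?B. weak_deriv a b (\<lambda>x. U x * E t) (\<lambda>x. ux x t) \<and>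
                 weak_deriv a b (\<lambda>x. ux x t) (\<lambda>x. uxx x t)"
    using L2 unfolding L2_H2_def by simp_all
  \<comment> \<open>the weak time derivative is the classical one\<close>
  have "AE x in lebesgue_on ?A. integrable (lebesgue_on ?B) (ut x)"
    using Fubini_lebesgue_on(2)[OF sets L2_fun_integrable[OF L2ut lm]] by simp
  with wt have "AE x in lebesgue_on ?A. AE t in lebesgue_on ?B.
      (\<lambda>(x, t). ut x t + (\<i> * complex_of_real \<omega>) * (U x * E t)) (x, t) = 0"
  proof eventually_elim
    case (elim x)
    have "AE t in lebesgue_on ?B. ut x t = (- \<i> * complex_of_real \<omega>) * (U x * E t)"
    proof (rule weak_deriv_eq_classical[OF _ elim(1) _ _ elim(2)])
      show "((\<lambda>t. U x * E t) has_vector_derivative (- \<i> * complex_of_real \<omega>) * (U x * E t)) (at t)" for t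
        using has_vector_derivative_mult_right[OF E', of "U x" t] by (simp add: algebra_simps)
      show "continuous_on UNIV (\<lambda>t. (- \<i> * complex_of_real \<omega>) * (U x * E t))"
        by (intro continuous_intros contE)
    qed (use T in simp)
    then show ?case by eventually_elim (simp add: algebra_simps)
  qed
  then have "AE z in lebesgue_on (?A \<times> ?B). (\<lambda>(x, t). ut x t + (\<i> * complex_of_real \<omega>) * (U x * E t)) z = 0"
  proof (rule AE_sections_zero_imp_AE_zero[OF sets, rotated])
    have "(\<lambda>z. (case z of (x, t) \<Rightarrow> ut x t) + (\<i> * complex_of_real \<omega>) * (case z of (x, t) \<Rightarrow> U x * E t))
        \<in> borel_measurable (lebesgue_on (?A \<times> ?B))"
      using L2u L2ut by (intro borel_measurable_add borel_measurable_times) (auto simp: L2_fun_def)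
    then show "(\<lambda>(x, t). ut x t + (\<i> * complex_of_real \<omega>) * (U x * E t)) \<in> borel_measurable (lebesgue_on (?A \<times> ?B))"
      by (simp add: case_prod_beta)
  qed
  with eq have "AE z in lebesgue_on (?A \<times> ?B). (case z of (x, t) \<Rightarrow>
      uxx x t + complex_of_real \<omega> * (U x * E t) + p x * (U x * E t) = F x * E t)"
  proof eventually_elim
    case (elim z)
    obtain x t where z: "z = (x, t)" by (cases z)
    have "ut x t = - (\<i> * complex_of_real \<omega>) * (U x * E t)"
      using elim(2) by (simp add: z add_eq_0_iff2)
    then have "\<i> * ut x t = complex_of_real \<omega> * (U x * E t)" by (simp add: algebra_simps)
    then show ?case using elim(1) by (simp add: z algebra_simps)
  qed
  from AE_lebesgue_on_sections(2)[OF sets this]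
  have eq': "AE t in lebesgue_on ?B. AE x in lebesgue_on ?A.
      uxx x t + complex_of_real \<omega> * (U x * E t) + p x * (U x * E t) = F x * E t" by simp
  have i1: "AE t in lebesgue_on ?B. integrable (lebesgue_on ?A) (\<lambda>x. uxx x t)"
    using Fubini_lebesgue_on(1)[OF sets L2_fun_integrable[OF L2uxx lm]] by simp
  have i2: "AE t in lebesgue_on ?B. integrable (lebesgue_on ?A) (\<lambda>x. (norm (uxx x t))^2)"
    using Fubini_lebesgue_on(1)[OF sets, of "\<lambda>z. (norm (case z of (x, t) \<Rightarrow> uxx x t))^2"] L2uxx
    by (simp add: L2_fun_def)
  have "AE t in lebesgue_on ?B. (weak_deriv a b (\<lambda>x. U x * E t) (\<lambda>x. ux x t) \<and>
        weak_deriv a b (\<lambda>x. ux x t) (\<lambda>x. uxx x t)) \<and>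
      (AE x in lebesgue_on ?A. uxx x t + complex_of_real \<omega> * (U x * E t) + p x * (U x * E t) = F x * E t) \<and>
      integrable (lebesgue_on ?A) (\<lambda>x. uxx x t) \<and> integrable (lebesgue_on ?A) (\<lambda>x. (norm (uxx x t))^2)"
    using weak eq' i1 i2 by eventually_elim simp
  \<comment> \<open>from here on \<open>t\<close> is one fixed good time\<close>
  from ex_in_Ioo_if_AE[OF _ this] T
  obtain t where t: "weak_deriv a b (\<lambda>x. U x * E t) (\<lambda>x. ux x t)"
      "weak_deriv a b (\<lambda>x. ux x t) (\<lambda>x. uxx x t)"
      "AE x in lebesgue_on ?A. uxx x t + complex_of_real \<omega> * (U x * E t) + p x * (U x * E t) = F x * E t"
      "integrable (lebesgue_on ?A) (\<lambda>x. uxx x t)" "integrable (lebesgue_on ?A) (\<lambda>x. (norm (uxx x t))^2)"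
    by auto
  obtain D where D: "\<forall>x\<in>{a..b}. (U has_vector_derivative D x) (at x within {a..b})"
     "lebesgue_primitive a b (\<lambda>x. Re (D x)) (\<lambda>x. Re (uxx x t / E t))"
     "lebesgue_primitive a b (\<lambda>x. Im (D x)) (\<lambda>x. Im (uxx x t / E t))"
    using weak_derivs_imp_C1[OF ab contU E0 t(1,2,4)] by blast
  have "AE x in lebesgue_on ?A. uxx x t / E t + complex_of_real \<omega> * U x + p x * U x = F x"
    using t(3)
  proof eventually_elim
    case (elim x)
    have "F x = (uxx x t + complex_of_real \<omega> * (U x * E t) + p x * (U x * E t)) / E t"
      using elim E0 by simp
    then show ?case using E0[of t] by (simp add: field_simps)
  qed
  moreover have "(\<lambda>x. uxx x t / E t) \<in> borel_measurable (lebesgue_on ?A)"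
    using borel_measurable_integrable[OF t(4)] by simp
  moreover have "integrable (lebesgue_on ?A) (\<lambda>x. (norm (uxx x t / E t))^2)"
    using t(5) by (simp add: norm_divide power_divide)
  ultimately have "helmholtz_profile a b \<omega> p F U D (\<lambda>x. uxx x t / E t)"
    using contU D by (simp add: helmholtz_profile_def)
  then show ?thesis by blast
qed

section \<open>The weighted energy inequality on one edge\<close>

lemma helmholtz_profile_continuous:
  assumes "helmholtz_profile a b \<omega> p F U D v"
  shows "continuous_on {a..b} U" "continuous_on {a..b} D"
proof -
  show "continuous_on {a..b} U" using assms by (simp add: helmholtz_profile_def)
  have "lebesgue_primitive a b (\<lambda>x. Re (D x)) (\<lambda>x. Re (v x))"
    "lebesgue_primitive a b (\<lambda>x. Im (D x)) (\<lambda>x. Im (v x))"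
    using assms by (simp_all add: helmholtz_profile_def)
  from this[THEN lebesgue_primitive_continuous] have "continuous_on {a..b} (\<lambda>x. complex_of_real (Re (D x)) + \<i> * complex_of_real (Im (D x)))"
    by (intro continuous_on_add continuous_on_mult continuous_on_const continuous_on_of_real)
  then show "continuous_on {a..b} D" by (simp add: complex_eq[symmetric])
qed

lemma continuous_imp_integrable_Ioo:
  fixes g :: "real \<Rightarrow> 'a::euclidean_space"
  assumes "continuous_on {a..b} g"
  shows "integrable (lebesgue_on {a<..<b}) g"
  using LINT_Ioo_eq_integral(2)[OF absolutely_integrable_continuous_real[OF assms]] .

text \<open>The equation expresses the source term through functions that are square integrable.\<close>

lemma helmholtz_profile_rhs_L2:
  assumes prof: "helmholtz_profile a b \<omega> p F U D v"
    and p: "p \<in> borel_measurable (lebesgue_on {a<..<b})" "AE x in lebesgue_on {a<..<b}. norm (p x) \<le> M"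
  shows "F \<in> borel_measurable (lebesgue_on {a<..<b})"
    "integrable (lebesgue_on {a<..<b}) (\<lambda>x. (norm (F x))^2)"
proof -
  let ?L = "lebesgue_on {a<..<b}"
  note U = helmholtz_profile_continuous(1)[OF prof]
  have v: "v \<in> borel_measurable ?L" "integrable ?L (\<lambda>x. (norm (v x))^2)"
    and eq: "AE x in ?L. v x + complex_of_real \<omega> * U x + p x * U x = F x"
    using prof by (simp_all add: helmholtz_profile_def)
  have "U \<in> borel_measurable ?L" using borel_measurable_integrable[OF continuous_imp_integrable_Ioo[OF U]] .
  then have m: "(\<lambda>x. v x + complex_of_real \<omega> * U x + p x * U x) \<in> borel_measurable ?L"
    using v p by simp
  show F: "F \<in> borel_measurable ?L"
    by (rule borel_measurable_lebesgue_on_AE[OF m _ eq]) simp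
  show "integrable ?L (\<lambda>x. (norm (F x))^2)"
  proof (rule Bochner_Integration.integrable_bound)
    have "integrable ?L (\<lambda>x. (norm (U x))^2)"
      by (rule continuous_imp_integrable_Ioo) (intro continuous_intros U)
    then show "integrable ?L (\<lambda>x. 2 * (norm (v x))^2 + 2 * (\<bar>\<omega>\<bar> + M)^2 * (norm (U x))^2)"
      using v(2) by simp
    show "(\<lambda>x. (norm (F x))^2) \<in> borel_measurable ?L" using F by simp
    show "AE x in ?L. norm ((norm (F x))^2) \<le> norm (2 * (norm (v x))^2 + 2 * (\<bar>\<omega>\<bar> + M)^2 * (norm (U x))^2)"
      using eq p(2)
    proof eventually_elim
      case (elim x)
      have "norm (F x) \<le> norm (v x) + norm (complex_of_real \<omega> * U x) + norm (p x * U x)"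
        unfolding elim(1)[symmetric] by (meson norm_triangle_ineq norm_triangle_mono order_refl)
      also have "\<dots> \<le> norm (v x) + (\<bar>\<omega>\<bar> + M) * norm (U x)"
        using mult_right_mono[OF elim(2) norm_ge_zero[of "U x"]] by (simp add: norm_mult algebra_simps)
      finally have "(norm (F x))^2 \<le> (norm (v x) + (\<bar>\<omega>\<bar> + M) * norm (U x))^2"
        by (rule power_mono) simp
      also have "\<dots> \<le> 2 * (norm (v x))^2 + 2 * ((\<bar>\<omega>\<bar> + M) * norm (U x))^2"
        using sum_squares_bound[of "norm (v x)" "(\<bar>\<omega>\<bar> + M) * norm (U x)"] by (simp add: power2_sum)
      finally show ?case by (simp add: power_mult_distrib)
    qed
  qed
qed

text \<open>Absorption of the lower order terms: the gain \<open>3 l / 2\<close> from the weight dominates the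
  contributions of \<open>f\<close>, of the potential, and of the artificial mass \<open>(l/4)\<^sup>2\<close>.\<close>

lemma energy_absorption:
  fixes d u f l M q g \<omega> :: real
  assumes l: "l > 0" and M: "M \<le> (l/4)^2" and nn: "d \<ge> 0" "u \<ge> 0" "\<omega> \<ge> 0"
    and q: "q \<ge> 3/2 * l" and g: "g \<ge> - (2 * d * f + 2 * (M + (l/4)^2) * d * u)"
  defines "G \<equiv> d^2 + (\<omega> + (l/4)^2) * u^2"
  shows "q * G + g \<ge> l/2 * G - 2/l * f^2"
proof -
  have 1: "2 * d * f \<le> l/2 * d^2 + 2/l * f^2"
  proof -
    have "0 \<le> l/2 * (d - 2/l * f)^2" using l by simp
    also have "\<dots> = l/2 * d^2 + 2/l * f^2 - 2 * d * f" using l by (simp add: power2_eq_square field_simps)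
    finally show ?thesis by simp
  qed
  have 2: "2 * (M + (l/4)^2) * d * u \<le> l/2 * (d^2 + (l/4)^2 * u^2)"
  proof -
    have "2 * (M + (l/4)^2) * (d * u) \<le> 4 * (l/4)^2 * (d * u)"
      using M nn by (intro mult_right_mono) auto
    also have "4 * (l/4)^2 * (d * u) = l/2 * (d^2 + (l/4)^2 * u^2) - l/2 * (d - l/4 * u)^2"
      by (simp add: power2_eq_square field_simps)
    also have "\<dots> \<le> l/2 * (d^2 + (l/4)^2 * u^2)" using l by simp
    finally show ?thesis by (simp add: mult.assoc)
  qed
  have 3: "d^2 \<le> G" "d^2 + (l/4)^2 * u^2 \<le> G" "0 \<le> G" using nn by (auto simp: G_def algebra_simps)
  have "l/2 * d^2 \<le> l/2 * G" "l/2 * (d^2 + (l/4)^2 * u^2) \<le> l/2 * G"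
    using 3 l by (auto intro!: mult_left_mono)
  moreover have "3/2 * l * G \<le> q * G" using mult_right_mono[OF q 3(3)] by simp
  ultimately show ?thesis using 1 2 g by linarith
qed

text \<open>The fundamental theorem of calculus for \<open>w G\<close>. In the derivative of \<open>G\<close> the equation replaces \<open>U''\<close>,
  and the term with \<open>\<omega>\<close> cancels against the one in \<open>G\<close>. The lower bound for \<open>\<mu> \<tau>\<close> in terms of \<open>\<nu>\<close>
  leaves \<open>3/2 \<mu> \<tau>\<close> of the logarithmic derivative of the weight \<open>w\<close>, as required by
  \<open>energy_absorption\<close>.\<close>

lemma weighted_energy_inequality:
  fixes a b \<omega> M \<alpha> \<beta> \<gamma> \<mu> \<nu> \<tau> :: real
  assumes ab: "a < b" and prof: "helmholtz_profile a b \<omega> p F U D v" and \<omega>: "\<omega> \<ge> 0"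
    and p: "p \<in> borel_measurable (lebesgue_on {a<..<b})" "AE x in lebesgue_on {a<..<b}. norm (p x) \<le> M"
    and \<mu>: "\<mu> > 0" "\<And>x. x \<in> {a..b} \<Longrightarrow> \<mu> \<le> 2 * \<alpha> * x + \<beta>"
    and \<tau>: "\<tau> > 0" "2 * \<nu> \<le> \<mu> * \<tau>" "M \<le> (\<mu> * \<tau> / 4)^2"
  defines "w \<equiv> \<lambda>x. exp (- \<nu> * (x - a)) * exp (2 * \<tau> * (\<alpha> * x^2 + \<beta> * x + \<gamma>))"
    and "G \<equiv> \<lambda>x. (norm (D x))^2 + (\<omega> + (\<mu> * \<tau> / 4)^2) * (norm (U x))^2"
  shows "\<mu> * \<tau> / 2 * (LINT x|lebesgue_on {a<..<b}. w x * G x)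
    \<le> w b * G b - w a * G a + 2 / (\<mu> * \<tau>) * (LINT x|lebesgue_on {a<..<b}. w x * (norm (F x))^2)"
proof -
  let ?L = "lebesgue_on {a<..<b}"
  define l where "l = \<mu> * \<tau>"
  have l: "l > 0" using \<mu> \<tau> by (simp add: l_def)
  define k where "k = \<omega> + (l/4)^2"
  have Geq: "G x = (Re (D x))^2 + (Im (D x))^2 + k * ((Re (U x))^2 + (Im (U x))^2)" for x
    by (simp add: G_def k_def l_def cmod_power2)
  define w' where "w' x = (2 * \<tau> * (2 * \<alpha> * x + \<beta>) - \<nu>) * w x" for x
  note cU = helmholtz_profile_continuous(1)[OF prof] and cD = helmholtz_profile_continuous(2)[OF prof]
  have cont: "continuous_on {a..b} (\<lambda>x. Re (D x))" "continuous_on {a..b} (\<lambda>x. Im (D x))"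
    "continuous_on {a..b} w" "continuous_on {a..b} w'"
    unfolding w'_def[abs_def] w_def by (intro continuous_intros cD)+
  have PD: "lebesgue_primitive a b (\<lambda>x. Re (D x)) (\<lambda>x. Re (v x))"
    "lebesgue_primitive a b (\<lambda>x. Im (D x)) (\<lambda>x. Im (v x))"
    using prof by (simp_all add: helmholtz_profile_def)
  have PU: "lebesgue_primitive a b (\<lambda>x. Re (U x)) (\<lambda>x. Re (D x))"
    "lebesgue_primitive a b (\<lambda>x. Im (U x)) (\<lambda>x. Im (D x))"
    using prof by (auto intro!: lebesgue_primitive_C1 cont simp: helmholtz_profile_def has_vector_derivative_complex_iff)
  have Pw: "lebesgue_primitive a b w w'"
  proof (rule lebesgue_primitive_C1[OF cont(4)])
    fix x
    show "(w has_real_derivative w' x) (at x within {a..b})"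
      unfolding w_def w'_def by (rule derivative_eq_intros refl | simp add: algebra_simps power2_eq_square)+
  qed
  define g where "g x = 2 * Re (cnj (D x) * (v x + complex_of_real k * U x))" for x
  have "lebesgue_primitive a b (\<lambda>x. Re (D x) * Re (D x) + Im (D x) * Im (D x)
         + k * (Re (U x) * Re (U x) + Im (U x) * Im (U x)))
      (\<lambda>x. (Re (D x) * Re (v x) + Re (D x) * Re (v x)) + (Im (D x) * Im (v x) + Im (D x) * Im (v x))
         + k * ((Re (U x) * Re (D x) + Re (U x) * Re (D x)) + (Im (U x) * Im (D x) + Im (U x) * Im (D x))))"
    by (intro lebesgue_primitive_add lebesgue_primitive_cmult lebesgue_primitive_mult PD PU)
  moreover have "(\<lambda>x. Re (D x) * Re (D x) + Im (D x) * Im (D x)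
      + k * (Re (U x) * Re (U x) + Im (U x) * Im (U x))) = G"
    by (auto simp: Geq power2_eq_square)
  moreover have "(\<lambda>x. (Re (D x) * Re (v x) + Re (D x) * Re (v x)) + (Im (D x) * Im (v x) + Im (D x) * Im (v x))
         + k * ((Re (U x) * Re (D x) + Re (U x) * Re (D x)) + (Im (U x) * Im (D x) + Im (U x) * Im (D x)))) = g"
    by (auto simp: g_def algebra_simps)
  ultimately have PG: "lebesgue_primitive a b G g" by simp
  have P: "lebesgue_primitive a b (\<lambda>x. w x * G x) (\<lambda>x. G x * w' x + w x * g x)"
    by (rule lebesgue_primitive_mult[OF Pw PG])
  define h where "h x = G x * w' x + w x * g x" for x
  have hA: "h absolutely_integrable_on {a..b}" using P by (simp add: lebesgue_primitive_def h_def[abs_def])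
  have "w b * G b - w a * G a = integral {a..b} h"
    using lebesgue_primitive_diff(1)[OF P, of a b] ab by (simp add: h_def[abs_def])
  also have "\<dots> = (LINT x|?L. h x)" using LINT_Ioo_eq_integral(1)[OF hA] by simp
  finally have bd: "w b * G b - w a * G a = (LINT x|?L. h x)" .
  have hi: "integrable ?L h" using LINT_Ioo_eq_integral(2)[OF hA] .
  have cG: "continuous_on {a..b} G" unfolding G_def by (intro continuous_intros cU cD)
  have wG: "integrable ?L (\<lambda>x. w x * G x)"
    by (rule continuous_imp_integrable_Ioo) (intro continuous_intros cont cG)
  have wF: "integrable ?L (\<lambda>x. w x * (norm (F x))^2)"
    by (rule LINT_Ioo_eq_integral(2), rule absolutely_integrable_continuous_mult[OF cont(3)],
        rule integrable_Ioo_imp_absolutely_integrable, rule helmholtz_profile_rhs_L2(2)[OF prof p])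
  have "AE x in ?L. v x + complex_of_real \<omega> * U x + p x * U x = F x"
    using prof by (simp add: helmholtz_profile_def)
  moreover have "AE x in ?L. x \<in> {a<..<b}" by (rule AE_I2) simp
  ultimately have "AE x in ?L. l/2 * (w x * G x) - 2/l * (w x * (norm (F x))^2) \<le> h x"
    using p(2)
  proof eventually_elim
    case (elim x)
    have "v x + complex_of_real k * U x = F x + complex_of_real ((l/4)^2) * U x - p x * U x"
      using elim(1) by (auto simp: k_def algebra_simps)
    then have "\<bar>g x\<bar> = 2 * \<bar>Re (cnj (D x) * (F x + complex_of_real ((l/4)^2) * U x - p x * U x))\<bar>"
      by (simp only: g_def abs_mult)
    also have "\<dots> \<le> 2 * norm (cnj (D x) * (F x + complex_of_real ((l/4)^2) * U x - p x * U x))"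
      by (intro mult_left_mono abs_Re_le_cmod) simp
    also have "\<dots> = 2 * (norm (D x) * norm (F x + complex_of_real ((l/4)^2) * U x - p x * U x))"
      by (simp add: norm_mult)
    also have "\<dots> \<le> 2 * (norm (D x) * (norm (F x) + (l/4)^2 * norm (U x) + M * norm (U x)))"
    proof (intro mult_left_mono)
      have "norm (F x + complex_of_real ((l/4)^2) * U x - p x * U x)
          \<le> norm (F x) + norm (complex_of_real ((l/4)^2) * U x) + norm (p x * U x)"
        by (meson norm_triangle_ineq norm_triangle_ineq4 norm_triangle_mono order_refl order_trans add_right_mono)
      also have "norm (p x * U x) \<le> M * norm (U x)"
        using elim(3) by (simp add: norm_mult mult_right_mono)
      also have "norm (complex_of_real ((l/4)^2) * U x) = (l/4)^2 * norm (U x)"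
        by (simp add: norm_mult norm_power norm_divide power_divide)
      finally show "norm (F x + complex_of_real ((l/4)^2) * U x - p x * U x)
          \<le> norm (F x) + (l/4)^2 * norm (U x) + M * norm (U x)" by simp
    qed auto
    finally have g: "g x \<ge> - (2 * norm (D x) * norm (F x) + 2 * (M + (l/4)^2) * norm (D x) * norm (U x))"
      by (simp add: algebra_simps)
    have "\<mu> * (2 * \<tau>) \<le> (2 * \<alpha> * x + \<beta>) * (2 * \<tau>)"
      using \<mu>(2)[of x] \<tau>(1) elim(2) by (intro mult_right_mono) auto
    then have q: "2 * \<tau> * (2 * \<alpha> * x + \<beta>) - \<nu> \<ge> 3/2 * l"
      using \<tau>(2) by (simp add: l_def algebra_simps)
    have "l/2 * G x - 2/l * (norm (F x))^2 \<le> (2 * \<tau> * (2 * \<alpha> * x + \<beta>) - \<nu>) * G x + g x"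
      using energy_absorption[OF l _ _ _ \<omega> q g] \<tau>(3) by (simp add: G_def l_def)
    then have "w x * (l/2 * G x - 2/l * (norm (F x))^2) \<le> w x * ((2 * \<tau> * (2 * \<alpha> * x + \<beta>) - \<nu>) * G x + g x)"
      by (rule mult_left_mono) (simp add: w_def)
    then show ?case by (simp add: h_def w'_def algebra_simps)
  qed
  then have "(LINT x|?L. l/2 * (w x * G x) - 2/l * (w x * (norm (F x))^2)) \<le> (LINT x|?L. h x)"
    by (intro integral_mono_AE hi Bochner_Integration.integrable_diff integrable_mult_right wG wF)
  moreover have "(LINT x|?L. l/2 * (w x * G x) - 2/l * (w x * (norm (F x))^2))
      = l/2 * (LINT x|?L. w x * G x) - 2/l * (LINT x|?L. w x * (norm (F x))^2)"
    using wG wF by simp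
  ultimately show ?thesis using bd by (simp add: l_def)
qed


text \<open>The rate \<open>\<nu> = ln n / (b - a)\<close> makes the additional weight fall from \<open>1\<close> to \<open>1/n\<close> along the edge. It
  stays within these bounds inside, so that the integrals change by at most the factor \<open>n\<close>. The
  constant \<open>c\<close> is common to all edges and compares the artificial mass \<open>(\<mu>\<tau>/4)\<^sup>2\<close> with \<open>\<tau>\<^sup>2\<close>.\<close>

lemma edge_carleman_inequality:
  fixes a b \<omega> M \<alpha> \<beta> \<gamma> \<mu> n \<tau> c :: real
  assumes ab: "a < b" and prof: "helmholtz_profile a b \<omega> p F U D v" and \<omega>: "\<omega> \<ge> 0"
    and p: "p \<in> borel_measurable (lebesgue_on {a<..<b})" "AE x in lebesgue_on {a<..<b}. norm (p x) \<le> M"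
    and \<mu>: "\<mu> > 0" "\<And>x. x \<in> {a..b} \<Longrightarrow> \<mu> \<le> 2 * \<alpha> * x + \<beta>"
    and n: "n \<ge> 1"
    and \<tau>: "\<tau> > 0" "2 * (ln n / (b - a)) \<le> \<mu> * \<tau>" "M \<le> (\<mu> * \<tau> / 4)^2"
    and c: "0 \<le> c" "c \<le> 1" "c \<le> (\<mu> / 4)^2"
  defines "e \<equiv> \<lambda>x. exp (2 * \<tau> * (\<alpha> * x^2 + \<beta> * x + \<gamma>))"
    and "G \<equiv> \<lambda>x. (norm (D x))^2 + (\<omega> + (\<mu> * \<tau> / 4)^2) * (norm (U x))^2"
  shows "c * \<mu> * \<tau> / (2 * n) * (LINT x|lebesgue_on {a<..<b}. e x * ((norm (D x))^2 + \<tau>^2 * (norm (U x))^2))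
    \<le> e b * G b / n - e a * G a + 2 / (\<mu> * \<tau>) * (LINT x|lebesgue_on {a<..<b}. e x * (norm (F x))^2)"
proof -
  let ?L = "lebesgue_on {a<..<b}"
  define \<nu> where "\<nu> = ln n / (b - a)"
  define r where "r x = exp (- \<nu> * (x - a))" for x
  have \<nu>0: "\<nu> \<ge> 0" using n ab by (simp add: \<nu>_def)
  have ra: "r a = 1" by (simp add: r_def)
  have rb: "r b = 1 / n" using ab n by (simp add: r_def \<nu>_def exp_minus inverse_eq_divide)
  have r: "1 / n \<le> r x" "r x \<le> 1" if "x \<in> {a<..<b}" for x
  proof -
    have "\<nu> * (x - a) \<le> \<nu> * (b - a)" using \<nu>0 that by (intro mult_left_mono) auto
    then show "1 / n \<le> r x" unfolding rb[symmetric] by (simp add: r_def)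
    show "r x \<le> 1" using \<nu>0 that by (simp add: r_def)
  qed
  note cU = helmholtz_profile_continuous(1)[OF prof] and cD = helmholtz_profile_continuous(2)[OF prof]
  have ce: "continuous_on {a..b} e" "continuous_on {a..b} r" unfolding e_def r_def[abs_def] by (intro continuous_intros)+
  have cG: "continuous_on {a..b} G" unfolding G_def by (intro continuous_intros cU cD)
  have F2: "integrable ?L (\<lambda>x. k x * (norm (F x))^2)" if "continuous_on {a..b} k" for k
    by (rule LINT_Ioo_eq_integral(2), rule absolutely_integrable_continuous_mult[OF that],
        rule integrable_Ioo_imp_absolutely_integrable, rule helmholtz_profile_rhs_L2(2)[OF prof p])
  have main: "\<mu> * \<tau> / 2 * (LINT x|?L. (r x * e x) * G x)
      \<le> (r b * e b) * G b - (r a * e a) * G a + 2 / (\<mu> * \<tau>) * (LINT x|?L. (r x * e x) * (norm (F x))^2)"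
    using weighted_energy_inequality[OF ab prof \<omega> p \<mu> \<tau>(1) \<tau>(2)[folded \<nu>_def] \<tau>(3), of \<gamma>]
    unfolding r_def e_def G_def by simp
  have low: "c / n * (LINT x|?L. e x * ((norm (D x))^2 + \<tau>^2 * (norm (U x))^2)) \<le> (LINT x|?L. (r x * e x) * G x)"
  proof -
    have "(LINT x|?L. c / n * (e x * ((norm (D x))^2 + \<tau>^2 * (norm (U x))^2))) \<le> (LINT x|?L. (r x * e x) * G x)"
    proof (rule integral_mono)
      show "integrable ?L (\<lambda>x. c / n * (e x * ((norm (D x))^2 + \<tau>^2 * (norm (U x))^2)))"
        by (rule continuous_imp_integrable_Ioo) (intro continuous_intros cU cD ce)
      show "integrable ?L (\<lambda>x. (r x * e x) * G x)"
        by (rule continuous_imp_integrable_Ioo) (intro continuous_intros cG ce)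
      fix x assume "x \<in> space ?L"
      then have x: "x \<in> {a<..<b}" by simp
      have "c * (norm (D x))^2 \<le> (norm (D x))^2" using c by (simp add: mult_left_le_one_le)
      moreover have "c * (\<tau>^2 * (norm (U x))^2) \<le> (\<mu> / 4)^2 * (\<tau>^2 * (norm (U x))^2)"
        using c(3) by (intro mult_right_mono) auto
      moreover have "0 \<le> \<omega> * (norm (U x))^2" using \<omega> by simp
      ultimately have "c * ((norm (D x))^2 + \<tau>^2 * (norm (U x))^2) \<le> G x"
        by (simp add: G_def algebra_simps power_mult_distrib power_divide)
      then have "(1 / n * e x) * (c * ((norm (D x))^2 + \<tau>^2 * (norm (U x))^2)) \<le> (r x * e x) * G x"
        using r(1)[OF x] c n by (intro mult_mono) (auto simp: e_def r_def)
      then show "c / n * (e x * ((norm (D x))^2 + \<tau>^2 * (norm (U x))^2)) \<le> (r x * e x) * G x"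
        by (simp add: algebra_simps)
    qed
    then show ?thesis by simp
  qed
  have up: "(LINT x|?L. (r x * e x) * (norm (F x))^2) \<le> (LINT x|?L. e x * (norm (F x))^2)"
  proof (rule integral_mono)
    show "integrable ?L (\<lambda>x. (r x * e x) * (norm (F x))^2)" by (rule F2) (intro continuous_intros ce)
    show "integrable ?L (\<lambda>x. e x * (norm (F x))^2)" by (rule F2) (rule ce)
    fix x assume "x \<in> space ?L"
    then have "r x \<le> 1" using r by simp
    then show "(r x * e x) * (norm (F x))^2 \<le> e x * (norm (F x))^2"
      by (intro mult_right_mono) (auto simp: e_def mult_left_le_one_le r_def)
  qed
  have "c * \<mu> * \<tau> / (2 * n) * (LINT x|?L. e x * ((norm (D x))^2 + \<tau>^2 * (norm (U x))^2))
      = \<mu> * \<tau> / 2 * (c / n * (LINT x|?L. e x * ((norm (D x))^2 + \<tau>^2 * (norm (U x))^2)))" by simp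
  also have "\<dots> \<le> \<mu> * \<tau> / 2 * (LINT x|?L. (r x * e x) * G x)"
    using \<mu>(1) \<tau>(1) by (intro mult_left_mono low) auto
  also note main
  also have "(r b * e b) * G b - (r a * e a) * G a = e b * G b / n - e a * G a" by (simp add: ra rb)
  also have "2 / (\<mu> * \<tau>) * (LINT x|?L. (r x * e x) * (norm (F x))^2)
      \<le> 2 / (\<mu> * \<tau>) * (LINT x|?L. e x * (norm (F x))^2)"
    using \<mu>(1) \<tau>(1) by (intro mult_left_mono up) auto
  finally show ?thesis by simp
qed

section \<open>Summation over the vertices\<close>

text \<open>The spatial factor \<open>\<psi>\<^sub>j\<close> of the weight.\<close>

definition phase :: "(nat \<Rightarrow> real) \<Rightarrow> (nat \<Rightarrow> real) \<Rightarrow> (nat \<Rightarrow> real) \<Rightarrow> nat \<Rightarrow> real \<Rightarrow> real" where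
  "phase a b c j x = a j * x^2 + b j * x + c j"

lemma weight_phase: "weight T a b c j x t = theta T t * phase a b c j x"
  by (simp add: weight_def phase_def)

lemma theta_pos: "t \<in> {-T<..<T} \<Longrightarrow> theta T t > 0"
  by (auto simp: theta_def)

lemma theta_ge:
  assumes "t \<in> {-T<..<T}"
  shows "1 \<le> T^2 * theta T t"
proof -
  have "0 < (T - t) * (T + t)" using assms by auto
  moreover have "(T - t) * (T + t) \<le> T^2" by (simp add: power2_eq_square algebra_simps)
  ultimately show ?thesis by (simp add: theta_def le_divide_eq)
qed

text \<open>All conditions on the weights carry the common factor \<open>\<theta>(t)\<close>, so they may be read off at \<open>t = 0\<close>.\<close>

lemma weight_functions_phase:
  assumes "weight_functions \<Lambda> T (weight T a b c)" "T > 0"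
  shows "\<And>k j1 j2. k \<in> inner_verts \<Lambda> \<Longrightarrow> j1 \<in> S_T \<Lambda> k \<union> S_I \<Lambda> k \<Longrightarrow> j2 \<in> S_T \<Lambda> k \<union> S_I \<Lambda> k \<Longrightarrow>
            phase a b c j1 (coord \<Lambda> k) = phase a b c j2 (coord \<Lambda> k)"
    and "\<And>j x. j \<in> edges \<Lambda> \<Longrightarrow> x \<in> {lft \<Lambda> j..rgt \<Lambda> j} \<Longrightarrow> phase a b c j x < 0"
    and "\<And>j x. j \<in> edges \<Lambda> \<Longrightarrow> x \<in> {lft \<Lambda> j..rgt \<Lambda> j} \<Longrightarrow> 0 < 2 * a j * x + b j"
proof -
  have 0: "(0::real) \<in> {-T<..<T}" using assms(2) by simp
  note th = theta_pos[OF 0]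
  have der: "deriv (\<lambda>x. weight T a b c j x 0) x = theta T 0 * (2 * a j * x + b j)" for j x
    unfolding weight_def[abs_def] by (rule DERIV_imp_deriv) (rule derivative_eq_intros refl | simp)+
  show "phase a b c j1 (coord \<Lambda> k) = phase a b c j2 (coord \<Lambda> k)"
    if "k \<in> inner_verts \<Lambda>" "j1 \<in> S_T \<Lambda> k \<union> S_I \<Lambda> k" "j2 \<in> S_T \<Lambda> k \<union> S_I \<Lambda> k" for k j1 j2
  proof -
    have "weight T a b c j1 (coord \<Lambda> k) 0 = weight T a b c j2 (coord \<Lambda> k) 0"
      using assms(1) that 0 unfolding weight_functions_def by blast
    then show ?thesis using th by (simp add: weight_phase)
  qed
  have *: "weight T a b c j x 0 < 0 \<and> deriv (\<lambda>x. weight T a b c j x 0) x > 0"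
    if "j \<in> edges \<Lambda>" "x \<in> {lft \<Lambda> j..rgt \<Lambda> j}" for j x
    using assms(1) that 0 unfolding weight_functions_def by blast
  show "phase a b c j x < 0" if "j \<in> edges \<Lambda>" "x \<in> {lft \<Lambda> j..rgt \<Lambda> j}" for j x
    using *[OF that] th by (simp add: weight_phase mult_less_0_iff)
  show "0 < 2 * a j * x + b j" if "j \<in> edges \<Lambda>" "x \<in> {lft \<Lambda> j..rgt \<Lambda> j}" for j x
    using *[OF that] th by (simp add: der zero_less_mult_iff)
qed

text \<open>The increment of a quadratic polynomial is its slope at the midpoint times the length.\<close>

lemma phase_le_right:
  assumes "\<And>y. y \<in> {l..r} \<Longrightarrow> 0 < 2 * a j * y + b j" "x \<in> {l..r}"
  shows "phase a b c j x \<le> phase a b c j r"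
proof -
  have "0 \<le> (r - x) * (2 * a j * ((x + r)/2) + b j)"
    using assms(1)[of "(x + r)/2"] assms(2) by (intro mult_nonneg_nonneg) auto
  also have "\<dots> = phase a b c j r - phase a b c j x"
    by (simp add: phase_def power2_eq_square field_simps)
  finally show ?thesis by simp
qed

text \<open>By Kirchhoff's law and the Cauchy-Schwarz inequality the energy at the end of the single incoming
  edge is at most \<open>n\<close> times the sum of the energies on the outgoing edges. This is where the factor
  \<open>1/n\<close> gained on each edge is spent.\<close>

lemma inner_vertex_energy:
  fixes U D :: "nat \<Rightarrow> complex" and K n :: real
  assumes fin: "finite S" and S: "S \<noteq> {}" "real (card S) \<le> n"
    and cont: "\<And>j. j \<in> S \<Longrightarrow> U j = U i" and flux: "D i = (\<Sum>j\<in>S. D j)" and K: "K \<ge> 0"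
  shows "((norm (D i))^2 + K * (norm (U i))^2) / n \<le> (\<Sum>j\<in>S. (norm (D j))^2 + K * (norm (U j))^2)"
proof -
  have card: "1 \<le> real (card S)" using fin S by (simp add: Suc_leI card_gt_0_iff)
  have nn: "0 \<le> (\<Sum>j\<in>S. (norm (D j))^2)" by (intro sum_nonneg) simp
  have "(norm (D i))^2 \<le> (\<Sum>j\<in>S. norm (D j))^2"
    unfolding flux by (intro power_mono norm_sum) simp
  also have "\<dots> \<le> (\<Sum>j\<in>S. (norm (D j))^2) * card S" by (rule sum_squared_le_sum_of_squares)
  also have "\<dots> \<le> (\<Sum>j\<in>S. (norm (D j))^2) * n" using S nn by (intro mult_left_mono) auto
  finally have 1: "(norm (D i))^2 / n \<le> (\<Sum>j\<in>S. (norm (D j))^2)"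
    using card S by (simp add: divide_le_eq)
  have "K * (norm (U i))^2 / n \<le> K * (norm (U i))^2 / 1"
    using card S K by (intro divide_left_mono) auto
  also have "\<dots> \<le> real (card S) * (K * (norm (U i))^2)"
    using mult_right_mono[OF card, of "K * (norm (U i))^2"] K by simp
  also have "\<dots> = (\<Sum>j\<in>S. K * (norm (U j))^2)" using cont by simp
  finally show ?thesis using 1 by (simp add: add_divide_distrib sum.distrib)
qed

text \<open>Up to the factor \<open>\<theta>\<close>, the integrand of the boundary term at the vertex \<open>k\<close>.\<close>

definition vertex_flux :: "metric_graph \<Rightarrow> (nat \<Rightarrow> real \<Rightarrow> real) \<Rightarrow> (nat \<Rightarrow> real \<Rightarrow> complex) \<Rightarrow> nat \<Rightarrow> real" where
  "vertex_flux \<Lambda> e D k = (\<Sum>j\<in>S_T \<Lambda> k. (norm (D j (coord \<Lambda> k)))^2 * e j (coord \<Lambda> k))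
     - (\<Sum>j\<in>S_I \<Lambda> k. (norm (D j (coord \<Lambda> k)))^2 * e j (coord \<Lambda> k))"

text \<open>Regrouped by vertices, the inner vertices contribute non-positive amounts, because the weights of the
  incident edges agree there. At a vertex of degree one \<open>U\<close> vanishes, so the energy reduces to
  \<open>|U'|\<^sup>2\<close>. A leaf is the terminal node of its edge and contributes with the factor \<open>1/n\<close>, the root is
  the initial node and contributes with the factor \<open>1\<close>.\<close>

lemma sum_edge_ends_le_boundary:
  fixes U D :: "nat \<Rightarrow> real \<Rightarrow> complex" and K n :: real and e :: "nat \<Rightarrow> real \<Rightarrow> real"
  assumes tree: "metric_tree \<Lambda>" and K: "K \<ge> 0" and n: "n \<ge> 1" "real (card (edges \<Lambda>)) \<le> n"
    and e: "\<And>j x. 0 < e j x"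
    and e_inner: "\<And>k j1 j2. k \<in> inner_verts \<Lambda> \<Longrightarrow> j1 \<in> S_T \<Lambda> k \<union> S_I \<Lambda> k \<Longrightarrow> j2 \<in> S_T \<Lambda> k \<union> S_I \<Lambda> k \<Longrightarrow>
            e j1 (coord \<Lambda> k) = e j2 (coord \<Lambda> k)"
    and U_inner: "\<And>k j1 j2. k \<in> inner_verts \<Lambda> \<Longrightarrow> j1 \<in> S_T \<Lambda> k \<union> S_I \<Lambda> k \<Longrightarrow> j2 \<in> S_T \<Lambda> k \<union> S_I \<Lambda> k \<Longrightarrow>
            U j1 (coord \<Lambda> k) = U j2 (coord \<Lambda> k)"
    and D_inner: "\<And>k. k \<in> inner_verts \<Lambda> \<Longrightarrow>
            (\<Sum>j\<in>S_T \<Lambda> k. D j (coord \<Lambda> k)) = (\<Sum>j\<in>S_I \<Lambda> k. D j (coord \<Lambda> k))"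
    and U_root: "\<And>j. j \<in> S_I \<Lambda> 0 \<Longrightarrow> U j (coord \<Lambda> 0) = 0"
    and U_leaf: "\<And>k j. k \<in> boundary_verts \<Lambda> - {0} \<Longrightarrow> j \<in> S_T \<Lambda> k \<Longrightarrow> U j (coord \<Lambda> k) = 0"
  defines "G \<equiv> \<lambda>j x. (norm (D j x))^2 + K * (norm (U j x))^2"
  shows "(\<Sum>j\<in>edges \<Lambda>. e j (rgt \<Lambda> j) * G j (rgt \<Lambda> j) / n - e j (lft \<Lambda> j) * G j (lft \<Lambda> j))
    \<le> (\<Sum>k\<in>boundary_verts \<Lambda>. vertex_flux \<Lambda> e D k)"
proof -
  define X where "X k = (\<Sum>j\<in>S_T \<Lambda> k. e j (coord \<Lambda> k) * G j (coord \<Lambda> k) / n)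
      - (\<Sum>j\<in>S_I \<Lambda> k. e j (coord \<Lambda> k) * G j (coord \<Lambda> k))" for k
  have inner: "X k \<le> 0" if k: "k \<in> inner_verts \<Lambda>" for k
  proof -
    have k0: "k \<noteq> 0"
    proof
      assume "k = 0"
      then have "0 \<in> boundary_verts \<Lambda> \<inter> inner_verts \<Lambda>" using k root_boundary[OF tree] by simp
      then show False using verts_cases(2)[OF tree] by simp
    qed
    have kv: "k \<in> verts \<Lambda>" using k by (simp add: inner_verts_def)
    obtain i where i: "S_T \<Lambda> k = {i}"
      using S_T_singleton[OF tree kv k0] ..
    have S: "S_I \<Lambda> k \<noteq> {}" using k i by (auto simp: inner_verts_def)
    have "card (S_I \<Lambda> k) \<le> card (edges \<Lambda>)" by (rule card_mono) (auto simp: S_I_def)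
    then have cn: "real (card (S_I \<Lambda> k)) \<le> n" using n(2) by linarith
    let ?x = "coord \<Lambda> k"
    have ei: "e j ?x = e i ?x" if "j \<in> S_I \<Lambda> k" for j using e_inner[OF k, of j i] that i by simp
    have "((norm (D i ?x))^2 + K * (norm (U i ?x))^2) / n
        \<le> (\<Sum>j\<in>S_I \<Lambda> k. (norm (D j ?x))^2 + K * (norm (U j ?x))^2)"
    proof (rule inner_vertex_energy[where D = "\<lambda>j. D j ?x" and U = "\<lambda>j. U j ?x"])
      show "U j ?x = U i ?x" if "j \<in> S_I \<Lambda> k" for j using U_inner[OF k, of j i] that i by simp
      show "D i ?x = (\<Sum>j\<in>S_I \<Lambda> k. D j ?x)" using D_inner[OF k] i by simp
    qed (use S cn K in auto)
    then have "e i ?x * (G i ?x / n) \<le> e i ?x * (\<Sum>j\<in>S_I \<Lambda> k. G j ?x)"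
      using e[of i ?x] unfolding G_def by (intro mult_left_mono) auto
    also have "\<dots> = (\<Sum>j\<in>S_I \<Lambda> k. e j ?x * G j ?x)"
      unfolding sum_distrib_left by (rule sum.cong) (simp_all add: ei)
    finally show ?thesis by (simp add: X_def i)
  qed
  have boundary: "X k \<le> vertex_flux \<Lambda> e D k" if k: "k \<in> boundary_verts \<Lambda>" for k
  proof (cases "k = 0")
    case True
    have "(\<Sum>j\<in>S_I \<Lambda> 0. e j (coord \<Lambda> 0) * G j (coord \<Lambda> 0))
        = (\<Sum>j\<in>S_I \<Lambda> 0. (norm (D j (coord \<Lambda> 0)))^2 * e j (coord \<Lambda> 0))"
      by (rule sum.cong) (simp_all add: G_def U_root)
    then show ?thesis using True S_T_root[OF tree] by (simp add: X_def vertex_flux_def)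
  next
    case False
    have "(\<Sum>j\<in>S_T \<Lambda> k. e j (coord \<Lambda> k) * G j (coord \<Lambda> k) / n)
        \<le> (\<Sum>j\<in>S_T \<Lambda> k. (norm (D j (coord \<Lambda> k)))^2 * e j (coord \<Lambda> k))"
    proof (rule sum_mono)
      fix j assume "j \<in> S_T \<Lambda> k"
      then have "G j (coord \<Lambda> k) = (norm (D j (coord \<Lambda> k)))^2"
        using U_leaf[of k j] k False by (simp add: G_def)
      moreover have "y / n \<le> y" if "y \<ge> 0" for y :: real
        using divide_left_mono[of 1 n y] n(1) that by simp
      ultimately show "e j (coord \<Lambda> k) * G j (coord \<Lambda> k) / n \<le> (norm (D j (coord \<Lambda> k)))^2 * e j (coord \<Lambda> k)"
        using less_imp_le[OF e[of j "coord \<Lambda> k"]] by (simp add: mult.commute)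
    qed
    then show ?thesis using leaf_S_I[OF tree k False] by (simp add: X_def vertex_flux_def)
  qed
  have fin: "finite (boundary_verts \<Lambda>)" "finite (inner_verts \<Lambda>)"
    by (rule finite_subset[OF _ finite_verts[of \<Lambda>]]; auto simp: boundary_verts_def inner_verts_def)+
  have "(\<Sum>j\<in>edges \<Lambda>. e j (rgt \<Lambda> j) * G j (rgt \<Lambda> j) / n - e j (lft \<Lambda> j) * G j (lft \<Lambda> j))
      = (\<Sum>k\<in>verts \<Lambda>. (\<Sum>j\<in>S_T \<Lambda> k. e j (rgt \<Lambda> j) * G j (rgt \<Lambda> j) / n)
          - (\<Sum>j\<in>S_I \<Lambda> k. e j (lft \<Lambda> j) * G j (lft \<Lambda> j)))"
    by (rule sum_ini_ter[OF tree])
  also have "\<dots> = (\<Sum>k\<in>verts \<Lambda>. X k)"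
    unfolding X_def by (intro sum.cong arg_cong2[where f = minus]) (auto simp: S_T_def S_I_def)
  also have "\<dots> = (\<Sum>k\<in>boundary_verts \<Lambda>. X k) + (\<Sum>k\<in>inner_verts \<Lambda>. X k)"
    using verts_cases[OF tree] fin by (simp add: sum.union_disjoint)
  also have "\<dots> \<le> (\<Sum>k\<in>boundary_verts \<Lambda>. vertex_flux \<Lambda> e D k) + 0"
    by (intro add_mono sum_mono boundary sum_nonpos inner)
  finally show ?thesis by simp
qed

text \<open>The estimate at a fixed time, for one value \<open>\<tau>\<close> of the large parameter \<open>s \<theta>(t)\<close>. The boundary term
  carries no power of \<open>\<tau>\<close> and the source term carries \<open>1/\<tau>\<close>. Multiplication by \<open>\<theta>\<close> turns these into
  the factor \<open>\<theta>\<close> of the boundary term and a factor of the source term that does not depend on time.\<close>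

lemma tree_carleman_inequality:
  fixes U D F v p :: "nat \<Rightarrow> real \<Rightarrow> complex" and a b c :: "nat \<Rightarrow> real"
  assumes tree: "metric_tree \<Lambda>" and W: "weight_functions \<Lambda> T (weight T a b c)" "T > 0"
    and \<omega>: "\<omega> \<ge> 0"
    and prof: "\<And>j. j \<in> edges \<Lambda> \<Longrightarrow> helmholtz_profile (lft \<Lambda> j) (rgt \<Lambda> j) \<omega> (p j) (F j) (U j) (D j) (v j)"
    and p: "\<And>j. j \<in> edges \<Lambda> \<Longrightarrow> p j \<in> borel_measurable (lebesgue_on {lft \<Lambda> j<..<rgt \<Lambda> j})"
      "\<And>j. j \<in> edges \<Lambda> \<Longrightarrow> AE x in lebesgue_on {lft \<Lambda> j<..<rgt \<Lambda> j}. norm (p j x) \<le> M"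
    and U_inner: "\<And>k j1 j2. k \<in> inner_verts \<Lambda> \<Longrightarrow> j1 \<in> S_T \<Lambda> k \<union> S_I \<Lambda> k \<Longrightarrow> j2 \<in> S_T \<Lambda> k \<union> S_I \<Lambda> k \<Longrightarrow>
            U j1 (coord \<Lambda> k) = U j2 (coord \<Lambda> k)"
    and D_inner: "\<And>k. k \<in> inner_verts \<Lambda> \<Longrightarrow>
            (\<Sum>j\<in>S_T \<Lambda> k. D j (coord \<Lambda> k)) = (\<Sum>j\<in>S_I \<Lambda> k. D j (coord \<Lambda> k))"
    and U_root: "\<And>j. j \<in> S_I \<Lambda> 0 \<Longrightarrow> U j (coord \<Lambda> 0) = 0"
    and U_leaf: "\<And>k j. k \<in> boundary_verts \<Lambda> - {0} \<Longrightarrow> j \<in> S_T \<Lambda> k \<Longrightarrow> U j (coord \<Lambda> k) = 0"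
    and \<mu>: "\<mu> > 0" "\<And>j x. j \<in> edges \<Lambda> \<Longrightarrow> x \<in> {lft \<Lambda> j..rgt \<Lambda> j} \<Longrightarrow> \<mu> \<le> 2 * a j * x + b j"
    and n: "n \<ge> 1" "real (card (edges \<Lambda>)) \<le> n"
    and \<tau>: "\<tau> > 0" "\<And>j. j \<in> edges \<Lambda> \<Longrightarrow> 2 * (ln n / (rgt \<Lambda> j - lft \<Lambda> j)) \<le> \<mu> * \<tau>" "M \<le> (\<mu> * \<tau> / 4)^2"
    and m: "0 \<le> m" "m \<le> 1" "m \<le> (\<mu> / 4)^2"
  defines "e \<equiv> \<lambda>j x. exp (2 * \<tau> * phase a b c j x)"
  shows "m * \<mu> * \<tau> / (2 * n) * (\<Sum>j\<in>edges \<Lambda>. LINT x|lebesgue_on {lft \<Lambda> j<..<rgt \<Lambda> j}.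
            e j x * ((norm (D j x))^2 + \<tau>^2 * (norm (U j x))^2))
    \<le> (\<Sum>k\<in>boundary_verts \<Lambda>. vertex_flux \<Lambda> e D k)
      + 2 / (\<mu> * \<tau>) * (\<Sum>j\<in>edges \<Lambda>. LINT x|lebesgue_on {lft \<Lambda> j<..<rgt \<Lambda> j}. e j x * (norm (F j x))^2)"
proof -
  define K where "K = \<omega> + (\<mu> * \<tau> / 4)^2"
  define G where "G j x = (norm (D j x))^2 + K * (norm (U j x))^2" for j x
  have "(\<Sum>j\<in>edges \<Lambda>. m * \<mu> * \<tau> / (2 * n) * (LINT x|lebesgue_on {lft \<Lambda> j<..<rgt \<Lambda> j}.
            e j x * ((norm (D j x))^2 + \<tau>^2 * (norm (U j x))^2)))
     \<le> (\<Sum>j\<in>edges \<Lambda>. (e j (rgt \<Lambda> j) * G j (rgt \<Lambda> j) / n - e j (lft \<Lambda> j) * G j (lft \<Lambda> j))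
          + 2 / (\<mu> * \<tau>) * (LINT x|lebesgue_on {lft \<Lambda> j<..<rgt \<Lambda> j}. e j x * (norm (F j x))^2))"
  proof (rule sum_mono)
    fix j assume j: "j \<in> edges \<Lambda>"
    show "m * \<mu> * \<tau> / (2 * n) * (LINT x|lebesgue_on {lft \<Lambda> j<..<rgt \<Lambda> j}.
            e j x * ((norm (D j x))^2 + \<tau>^2 * (norm (U j x))^2))
      \<le> (e j (rgt \<Lambda> j) * G j (rgt \<Lambda> j) / n - e j (lft \<Lambda> j) * G j (lft \<Lambda> j))
          + 2 / (\<mu> * \<tau>) * (LINT x|lebesgue_on {lft \<Lambda> j<..<rgt \<Lambda> j}. e j x * (norm (F j x))^2)"
      using edge_carleman_inequality[OF ini_ter(2)[OF tree j] prof[OF j] \<omega> p(1)[OF j] p(2)[OF j]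
          \<mu>(1) \<mu>(2)[OF j] n(1) \<tau>(1) \<tau>(2)[OF j] \<tau>(3) m, of "c j"]
      unfolding e_def G_def K_def phase_def by simp
  qed
  moreover have "(\<Sum>j\<in>edges \<Lambda>. e j (rgt \<Lambda> j) * G j (rgt \<Lambda> j) / n - e j (lft \<Lambda> j) * G j (lft \<Lambda> j))
      \<le> (\<Sum>k\<in>boundary_verts \<Lambda>. vertex_flux \<Lambda> e D k)"
    unfolding G_def
  proof (rule sum_edge_ends_le_boundary[where U = U and D = D and e = e and K = K, OF tree _ n _ _ U_inner D_inner U_root U_leaf])
    show "K \<ge> 0" using \<omega> by (simp add: K_def)
    show "e j1 (coord \<Lambda> k) = e j2 (coord \<Lambda> k)"
      if "k \<in> inner_verts \<Lambda>" "j1 \<in> S_T \<Lambda> k \<union> S_I \<Lambda> k" "j2 \<in> S_T \<Lambda> k \<union> S_I \<Lambda> k" for k j1 j2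
      unfolding e_def using weight_functions_phase(1)[OF W that] by simp
  qed (simp_all add: e_def)
  ultimately show ?thesis by (simp add: sum.distrib sum_distrib_left)
qed

section \<open>Integration in time\<close>

lemma power_times_exp_neg_le:
  fixes y d :: real
  assumes "y \<ge> 0" "d > 0" "n > 0"
  shows "y ^ n * exp (- (d * y)) \<le> (real n / d) ^ n"
proof -
  have "y ^ n = (real n / d) ^ n * (d * y / real n) ^ n"
    using assms by (simp flip: power_mult_distrib)
  also have "\<dots> \<le> (real n / d) ^ n * exp (d * y)"
  proof (rule mult_left_mono)
    have "(d * y / real n) ^ n \<le> (1 + d * y / real n) ^ n" using assms by (intro power_mono) auto
    also have "\<dots> \<le> exp (d * y)" using assms by (intro exp_ge_one_plus_x_over_n_power_n) (auto intro: order_trans[of _ 0])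
    finally show "(d * y / real n) ^ n \<le> exp (d * y)" .
  qed (use assms in simp)
  finally show ?thesis by (simp add: exp_minus divide_le_eq flip: divide_inverse)
qed

lemma integrable_bounded_continuous_Ioo:
  fixes g :: "real \<Rightarrow> real"
  assumes cont: "continuous_on {a<..<b} g" and bound: "\<And>x. x \<in> {a<..<b} \<Longrightarrow> \<bar>g x\<bar> \<le> K"
  shows "integrable (lebesgue_on {a<..<b}) g"
proof (rule Bochner_Integration.integrable_bound)
  show "integrable (lebesgue_on {a<..<b}) (\<lambda>x. K)"
    by (rule continuous_imp_integrable_Ioo) (rule continuous_on_const)
  show "g \<in> borel_measurable (lebesgue_on {a<..<b})"
    by (rule continuous_imp_measurable_on_sets_lebesgue[OF cont]) simp
  show "AE x in lebesgue_on {a<..<b}. norm (g x) \<le> norm K"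
    by (rule AE_I2) (use bound in force)
qed

lemma continuous_on_theta: "continuous_on {-T<..<T} (theta T)"
  unfolding theta_def[abs_def] by (intro continuous_intros) auto

text \<open>Powers of \<open>\<theta>\<close> blow up at the ends of the time interval. They are compensated by the exponential
  factor, because \<open>\<psi>\<close> is negative and bounded away from \<open>0\<close>.\<close>

lemma theta_power_exp_bounded:
  assumes t: "t \<in> {-T<..<T}" and s: "s > 0" and y: "y \<le> - d" and d: "d > 0" and n: "n > 0"
  shows "\<bar>(s * theta T t) ^ n * exp (2 * s * (theta T t * y))\<bar> \<le> (real n / (2 * d)) ^ n"
proof -
  have th: "s * theta T t > 0" using theta_pos[OF t] s by simp
  have "(s * theta T t) * y \<le> (s * theta T t) * (- d)" using y th by (intro mult_left_mono) auto
  then have "exp (2 * s * (theta T t * y)) \<le> exp (- (2 * d * (s * theta T t)))" by (simp add: algebra_simps)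
  then have "(s * theta T t) ^ n * exp (2 * s * (theta T t * y)) \<le> (s * theta T t) ^ n * exp (- (2 * d * (s * theta T t)))"
    using th by (intro mult_left_mono) auto
  also have "\<dots> \<le> (real n / (2 * d)) ^ n" using th d n by (intro power_times_exp_neg_le) auto
  finally show ?thesis using th by (simp add: abs_mult)
qed

text \<open>The hypotheses on \<open>\<tau>0\<close> are those of the estimate at a fixed time. They hold for \<open>s \<theta>(t)\<close> at every
  time \<open>t\<close> as soon as \<open>s \<ge> T\<^sup>2 \<tau>0\<close>, because \<open>\<theta> \<ge> 1/T\<^sup>2\<close>. The condition \<open>s \<ge> 2/\<mu>\<close> serves to
  normalise the coefficient \<open>2/(\<mu> s)\<close> of the source term to \<open>1\<close>.\<close>

lemma time_harmonic_carleman_inequality: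
  fixes U F p :: "nat \<Rightarrow> real \<Rightarrow> complex" and a b c :: "nat \<Rightarrow> real" and \<omega> \<phi>0 T :: real
  defines "u \<equiv> \<lambda>j x t. U j x * exp (- \<i> * complex_of_real (\<omega> * t + \<phi>0))"
    and "f \<equiv> \<lambda>j x t. F j x * exp (- \<i> * complex_of_real (\<omega> * t + \<phi>0))"
    and "\<phi> \<equiv> weight T a b c"
  assumes tree: "metric_tree \<Lambda>" and W: "weight_functions \<Lambda> T (weight T a b c)" "T > 0"
    and \<omega>: "\<omega> \<ge> 0" and p: "p \<in> potentials \<Lambda> M" and sol: "schroedinger_solution \<Lambda> T p f u"
    and \<mu>: "\<mu> > 0" "\<And>j x. j \<in> edges \<Lambda> \<Longrightarrow> x \<in> {lft \<Lambda> j..rgt \<Lambda> j} \<Longrightarrow> \<mu> \<le> 2 * a j * x + b j"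
    and n: "n \<ge> 1" "real (card (edges \<Lambda>)) \<le> n"
    and \<tau>0: "\<tau>0 > 0" "\<And>j. j \<in> edges \<Lambda> \<Longrightarrow> 2 * (ln n / (rgt \<Lambda> j - lft \<Lambda> j)) \<le> \<mu> * \<tau>0" "M \<le> (\<mu> * \<tau>0 / 4)^2"
    and m: "0 < m" "m \<le> 1" "m \<le> (\<mu> / 4)^2"
    and s: "2 / \<mu> \<le> s" "T^2 * \<tau>0 \<le> s"
  shows "(\<Sum>j\<in>edges \<Lambda>. LINT (x, t)|lebesgue_on (cyl \<Lambda> T j).
              (s^3 * (theta T t)^3 * (norm (u j x t))^2 + s * theta T t * (norm (dx \<Lambda> u j x t))^2)
                * exp (2 * s * \<phi> j x t))
           \<le> 2 * n * T^2 / (m * \<mu>) * ((\<Sum>j\<in>edges \<Lambda>. LINT (x, t)|lebesgue_on (cyl \<Lambda> T j).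
                      (norm (f j x t))^2 * exp (2 * s * \<phi> j x t))
                    + boundary_term \<Lambda> T \<phi> u s)"
proof -
  define E where "E t = exp (- \<i> * complex_of_real (\<omega> * t + \<phi>0))" for t
  have nE: "norm (E t) = 1" for t by (simp add: E_def norm_exp_eq_Re)
  have E0: "E t \<noteq> 0" for t by (simp add: E_def)
  have u: "u = (\<lambda>j x t. U j x * E t)" and f: "f = (\<lambda>j x t. F j x * E t)" by (simp_all add: u_def f_def E_def)
  let ?l = "lft \<Lambda>" and ?r = "rgt \<Lambda>" and ?B = "{-T<..<T}"
  let ?A = "\<lambda>j. {?l j<..<?r j}"
  have lr: "?l j < ?r j" if "j \<in> edges \<Lambda>" for j using ini_ter(2)[OF tree that] .
  have "0 < 2 / \<mu>" using \<mu>(1) by simp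
  then have s0: "s > 0" using s(1) by linarith
  note sol' = sol[unfolded schroedinger_solution_def]
  note edge_eq = sol'[THEN conjunct1] and inner_eq = sol'[THEN conjunct2, THEN conjunct1]
    and root_eq = sol'[THEN conjunct2, THEN conjunct2, THEN conjunct1]
    and leaf_eq = sol'[THEN conjunct2, THEN conjunct2, THEN conjunct2]
  have "\<forall>j\<in>edges \<Lambda>. \<exists>Dv. helmholtz_profile (?l j) (?r j) \<omega> (p j) (F j) (U j) (fst Dv) (snd Dv)"
  proof
    fix j assume j: "j \<in> edges \<Lambda>"
    obtain uxx ut where H: "H1_H2 (?l j) (?r j) T (u j) uxx ut"
        "AE (x, t) in lebesgue_on (cyl \<Lambda> T j). \<i> * ut x t + uxx x t + p j x * u j x t = f j x t"
      using bspec[OF edge_eq j] by (elim exE conjE)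
    have "\<exists>D v. helmholtz_profile (?l j) (?r j) \<omega> (p j) (F j) (U j) D v"
      by (rule time_harmonic_edge_profile[OF lr[OF j] W(2) H[unfolded cyl_def u_def f_def]])
    then show "\<exists>Dv. helmholtz_profile (?l j) (?r j) \<omega> (p j) (F j) (U j) (fst Dv) (snd Dv)" by auto
  qed
  then obtain Dv where "\<forall>j\<in>edges \<Lambda>. helmholtz_profile (?l j) (?r j) \<omega> (p j) (F j) (U j) (fst (Dv j)) (snd (Dv j))"
    by (rule bchoice[THEN exE])
  then obtain D v where prof: "\<And>j. j \<in> edges \<Lambda> \<Longrightarrow> helmholtz_profile (?l j) (?r j) \<omega> (p j) (F j) (U j) (D j) (v j)"
    using that[of "\<lambda>j. fst (Dv j)" "\<lambda>j. snd (Dv j)"] by blast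
  have pm: "p j \<in> borel_measurable (lebesgue_on (?A j))" "AE x in lebesgue_on (?A j). norm (p j x) \<le> M"
    if j: "j \<in> edges \<Lambda>" for j
  proof -
    show "p j \<in> borel_measurable (lebesgue_on (?A j))" using p j by (simp add: potentials_def)
    have "esssup (lebesgue_on (?A j)) (\<lambda>x. ereal (norm (p j x))) \<le> ereal M"
      using p j by (simp add: potentials_def)
    moreover have "AE x in lebesgue_on (?A j). ereal (norm (p j x)) \<le> esssup (lebesgue_on (?A j)) (\<lambda>x. ereal (norm (p j x)))"
      by (rule esssup_AE)
    ultimately show "AE x in lebesgue_on (?A j). norm (p j x) \<le> M"
      by (elim eventually_mono) (meson ereal_less_eq(3) order_trans)
  qed
  note cU = helmholtz_profile_continuous(1)[OF prof] and cD = helmholtz_profile_continuous(2)[OF prof]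
  have dx: "dx \<Lambda> u j x t = D j x * E t" if j: "j \<in> edges \<Lambda>" and x: "x \<in> {?l j..?r j}" for j x t
  proof -
    have "(U j has_vector_derivative D j x) (at x within {?l j..?r j})"
      using prof[OF j] x by (simp add: helmholtz_profile_def)
    then have "((\<lambda>y. U j y * E t) has_vector_derivative D j x * E t) (at x within cbox (?l j) (?r j))"
      by (simp add: has_vector_derivative_mult_left)
    from vector_derivative_within_cbox[OF lr[OF j] _ this] x show ?thesis by (simp add: dx_def u)
  qed
  have nu: "norm (u j x t) = norm (U j x)" and nf: "norm (f j x t) = norm (F j x)" for j x t
    by (simp_all add: u f norm_mult nE)
  have ndx: "norm (dx \<Lambda> u j x t) = norm (D j x)" if "j \<in> edges \<Lambda>" "x \<in> {?l j..?r j}" for j x t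
    by (simp add: dx[OF that] norm_mult nE)
  have coords: "coord \<Lambda> k \<in> {?l j..?r j}" "j \<in> edges \<Lambda>" if "j \<in> S_T \<Lambda> k \<union> S_I \<Lambda> k" for j k
    using that lr[of j] by (auto simp: S_T_def S_I_def)
  have zero: "(0::real) \<in> {-T..T}" using W(2) by simp
  have U_inner: "U j1 (coord \<Lambda> k) = U j2 (coord \<Lambda> k)"
    if "k \<in> inner_verts \<Lambda>" "j1 \<in> S_T \<Lambda> k \<union> S_I \<Lambda> k" "j2 \<in> S_T \<Lambda> k \<union> S_I \<Lambda> k" for k j1 j2
  proof -
    have "u j1 (coord \<Lambda> k) 0 = u j2 (coord \<Lambda> k) 0"
      using inner_eq that zero by blast
    then show ?thesis using E0 by (simp add: u)
  qed
  have D_inner: "(\<Sum>j\<in>S_T \<Lambda> k. D j (coord \<Lambda> k)) = (\<Sum>j\<in>S_I \<Lambda> k. D j (coord \<Lambda> k))"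
    if k: "k \<in> inner_verts \<Lambda>" for k
  proof -
    have "(\<Sum>j\<in>S_T \<Lambda> k. dx \<Lambda> u j (coord \<Lambda> k) 0) = (\<Sum>j\<in>S_I \<Lambda> k. dx \<Lambda> u j (coord \<Lambda> k) 0)"
      using inner_eq k zero by blast
    moreover have "(\<Sum>j\<in>S_T \<Lambda> k. dx \<Lambda> u j (coord \<Lambda> k) 0) = (\<Sum>j\<in>S_T \<Lambda> k. D j (coord \<Lambda> k)) * E 0"
      unfolding sum_distrib_right by (rule sum.cong) (use dx coords[of _ k] in auto)
    moreover have "(\<Sum>j\<in>S_I \<Lambda> k. dx \<Lambda> u j (coord \<Lambda> k) 0) = (\<Sum>j\<in>S_I \<Lambda> k. D j (coord \<Lambda> k)) * E 0"
      unfolding sum_distrib_right by (rule sum.cong) (use dx coords[of _ k] in auto)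
    ultimately show ?thesis using E0 by simp
  qed
  have U_root: "U j (coord \<Lambda> 0) = 0" if "j \<in> S_I \<Lambda> 0" for j
  proof -
    have "u j (coord \<Lambda> 0) 0 = 0" using root_eq that zero by blast
    then show ?thesis using E0 by (simp add: u)
  qed
  have U_leaf: "U j (coord \<Lambda> k) = 0" if "k \<in> boundary_verts \<Lambda> - {0}" "j \<in> S_T \<Lambda> k" for j k
  proof -
    have "u j (coord \<Lambda> k) 0 = 0" using leaf_eq that zero by blast
    then show ?thesis using E0 by (simp add: u)
  qed
  \<comment> \<open>the three integrands in the time variable\<close>
  define \<Psi> where "\<Psi> j x t = exp (2 * s * \<phi> j x t)" for j x t
  define LT where "LT j t = (LINT x|lebesgue_on (?A j). (s^3 * (theta T t)^3 * (norm (U j x))^2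
      + s * theta T t * (norm (D j x))^2) * \<Psi> j x t)" for j t
  define FT where "FT j t = (LINT x|lebesgue_on (?A j). (norm (F j x))^2 * \<Psi> j x t)" for j t
  define BT where "BT k t = (\<Sum>j\<in>S_T \<Lambda> k. theta T t * (norm (D j (coord \<Lambda> k)))^2 * \<Psi> j (coord \<Lambda> k) t)
      - (\<Sum>j\<in>S_I \<Lambda> k. theta T t * (norm (D j (coord \<Lambda> k)))^2 * \<Psi> j (coord \<Lambda> k) t)" for k t
  define C where "C = 2 * n * T^2 / (m * \<mu>)"
  have pointwise: "(\<Sum>j\<in>edges \<Lambda>. LT j t) \<le> C * ((\<Sum>j\<in>edges \<Lambda>. FT j t) + (\<Sum>k\<in>boundary_verts \<Lambda>. BT k t))"
    if t: "t \<in> ?B" for t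
  proof -
    define \<tau> where "\<tau> = s * theta T t"
    have th: "theta T t > 0" by (rule theta_pos[OF t])
    have "\<tau>0 * 1 \<le> \<tau>0 * (T^2 * theta T t)" using theta_ge[OF t] \<tau>0(1) by (intro mult_left_mono) auto
    also have "\<dots> \<le> \<tau>" using mult_right_mono[OF s(2) less_imp_le[OF th]] by (simp add: \<tau>_def algebra_simps)
    finally have \<tau>\<tau>0: "\<tau>0 \<le> \<tau>" by simp
    have \<mu>\<tau>: "\<mu> * \<tau>0 \<le> \<mu> * \<tau>" using \<tau>\<tau>0 \<mu>(1) by simp
    have \<tau>pos: "\<tau> > 0" using \<tau>\<tau>0 \<tau>0(1) by simp
    have M\<tau>: "M \<le> (\<mu> * \<tau> / 4)^2"
    proof -
      have "(\<mu> * \<tau>0 / 4)^2 \<le> (\<mu> * \<tau> / 4)^2" using \<mu>\<tau> \<mu>(1) \<tau>0(1) by (intro power_mono) auto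
      then show ?thesis using \<tau>0(3) by simp
    qed
    have ln\<tau>: "2 * (ln n / (?r j - ?l j)) \<le> \<mu> * \<tau>" if "j \<in> edges \<Lambda>" for j
      using \<tau>0(2)[OF that] \<mu>\<tau> by simp
    define e where "e j x = exp (2 * \<tau> * phase a b c j x)" for j x
    have \<Psi>e: "\<Psi> j x t = e j x" for j x
      by (simp add: \<Psi>_def e_def \<phi>_def weight_phase \<tau>_def mult.assoc)
    define X where "X = (\<Sum>j\<in>edges \<Lambda>. LINT x|lebesgue_on (?A j). e j x * ((norm (D j x))^2 + \<tau>^2 * (norm (U j x))^2))"
    define V where "V = (\<Sum>k\<in>boundary_verts \<Lambda>. vertex_flux \<Lambda> e D k)"
    define Y where "Y = (\<Sum>j\<in>edges \<Lambda>. LINT x|lebesgue_on (?A j). e j x * (norm (F j x))^2)"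
    have static: "m * \<mu> * \<tau> / (2 * n) * X \<le> V + 2 / (\<mu> * \<tau>) * Y"
      unfolding X_def V_def Y_def e_def
      by (rule tree_carleman_inequality[OF tree W \<omega> prof pm U_inner D_inner U_root U_leaf \<mu> n \<tau>pos ln\<tau> M\<tau> less_imp_le[OF m(1)] m(2,3)])
    have LTX: "(\<Sum>j\<in>edges \<Lambda>. LT j t) = \<tau> * X"
    proof -
      have "LT j t = \<tau> * (LINT x|lebesgue_on (?A j). e j x * ((norm (D j x))^2 + \<tau>^2 * (norm (U j x))^2))" for j
      proof -
        have "LT j t = (LINT x|lebesgue_on (?A j). \<tau> * (e j x * ((norm (D j x))^2 + \<tau>^2 * (norm (U j x))^2)))"
          unfolding LT_def \<Psi>e \<tau>_def
          by (rule arg_cong[of _ _ "integral\<^sup>L _"]) (simp add: fun_eq_iff algebra_simps power2_eq_square power3_eq_cube)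
        then show ?thesis by simp
      qed
      then show ?thesis by (simp add: X_def sum_distrib_left)
    qed
    have FTY: "(\<Sum>j\<in>edges \<Lambda>. FT j t) = Y" by (simp add: FT_def \<Psi>e Y_def mult.commute)
    have BTV: "(\<Sum>k\<in>boundary_verts \<Lambda>. BT k t) = theta T t * V"
      by (simp add: BT_def \<Psi>e V_def vertex_flux_def sum_distrib_left right_diff_distrib mult.assoc)
    have X0: "X \<ge> 0" unfolding X_def e_def by (intro sum_nonneg integral_nonneg_AE AE_I2) simp
    have Y0: "Y \<ge> 0" unfolding Y_def e_def by (intro sum_nonneg integral_nonneg_AE AE_I2) simp
    have "\<tau> * X = 2 * n / (m * \<mu>) * (m * \<mu> * \<tau> / (2 * n) * X)" using m(1) \<mu>(1) n(1) by (simp add: field_simps)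
    also have "\<dots> \<le> 2 * n / (m * \<mu>) * (V + 2 / (\<mu> * \<tau>) * Y)"
      using m(1) \<mu>(1) n(1) by (intro mult_left_mono static) auto
    finally have 1: "\<tau> * X \<le> 2 * n / (m * \<mu>) * (V + 2 / (\<mu> * \<tau>) * Y)" .
    \<comment> \<open>the left-hand side is enlarged first, since the boundary flux \<open>V\<close> may be of either sign\<close>
    have "\<tau> * X \<le> (T^2 * theta T t) * (\<tau> * X)"
      using mult_right_mono[OF theta_ge[OF t], of "\<tau> * X"] X0 \<tau>pos by simp
    also have "\<dots> \<le> (T^2 * theta T t) * (2 * n / (m * \<mu>) * (V + 2 / (\<mu> * \<tau>) * Y))"
      using th by (intro mult_left_mono 1) auto
    also have "\<dots> = C * (theta T t * V + 2 / (\<mu> * s) * Y)"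
    proof -
      have "theta T t * (2 / (\<mu> * \<tau>) * Y) = 2 / (\<mu> * s) * Y" using th s0 \<mu>(1) by (simp add: \<tau>_def field_simps)
      then have "theta T t * (V + 2 / (\<mu> * \<tau>) * Y) = theta T t * V + 2 / (\<mu> * s) * Y" by (simp add: distrib_left)
      moreover have "(T^2 * theta T t) * (2 * n / (m * \<mu>) * w) = C * (theta T t * w)" for w
        by (simp add: C_def)
      ultimately show ?thesis by (simp only:)
    qed
    also have "\<dots> \<le> C * (theta T t * V + Y)"
    proof (intro mult_left_mono add_left_mono)
      have "2 / (\<mu> * s) \<le> 1" using s(1) \<mu>(1) s0 by (simp add: field_simps)
      then show "2 / (\<mu> * s) * Y \<le> Y" using Y0 by (rule mult_left_le_one_le[rotated -1]) (use s0 \<mu>(1) in auto)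
      show "0 \<le> C" using n(1) m(1) \<mu>(1) by (simp add: C_def)
    qed
    finally show ?thesis unfolding LTX FTY BTV by (simp add: add.commute)
  qed
  \<comment> \<open>the maximum of \<open>\<psi>\<^sub>j\<close> is attained at the terminal node\<close>
  have bound: "\<bar>(s * theta T t) ^ i * \<Psi> j x t\<bar> \<le> (real i / (2 * - phase a b c j (?r j))) ^ i"
    if j: "j \<in> edges \<Lambda>" and x: "x \<in> {?l j..?r j}" and t: "t \<in> ?B" and i: "i > 0" for i j x t
  proof -
    have "phase a b c j x \<le> phase a b c j (?r j)"
      by (rule phase_le_right[where l = "?l j" and r = "?r j"])
        (use weight_functions_phase(3)[OF W j] x in auto)
    moreover have "phase a b c j (?r j) < 0" using weight_functions_phase(2)[OF W j] lr[OF j] by simp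
    ultimately show ?thesis
      using theta_power_exp_bounded[OF t s0, of "phase a b c j x" "- phase a b c j (?r j)" i] i
      by (simp add: \<Psi>_def \<phi>_def weight_phase)
  qed
  have bound0: "\<bar>\<Psi> j x t\<bar> \<le> 1" if j: "j \<in> edges \<Lambda>" and x: "x \<in> {?l j..?r j}" and t: "t \<in> ?B" for j x t
  proof -
    have "s * (theta T t * phase a b c j x) \<le> 0"
      using theta_pos[OF t] weight_functions_phase(2)[OF W j x] s0 by (simp add: mult_nonneg_nonpos)
    then show ?thesis by (simp add: \<Psi>_def \<phi>_def weight_phase)
  qed
  have cont\<theta>: "continuous_on (S \<times> ?B) (\<lambda>z. theta T (snd z))" for S :: "real set"
    by (rule continuous_on_compose2[OF continuous_on_theta]) (auto intro!: continuous_intros)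
  have cont\<Psi>: "continuous_on (S \<times> ?B) (\<lambda>z. \<Psi> j (fst z) (snd z))" for S :: "real set" and j
    unfolding \<Psi>_def \<phi>_def weight_phase phase_def by (intro continuous_intros cont\<theta>)
  have sets: "?A j \<in> sets borel" "?B \<in> sets borel" for j by auto
  have IL: "integrable (lebesgue_on (?A j \<times> ?B)) (\<lambda>(x, t). (s^3 * (theta T t)^3 * (norm (U j x))^2
      + s * theta T t * (norm (D j x))^2) * \<Psi> j x t)" if j: "j \<in> edges \<Lambda>" for j
  proof -
    have "integrable (lebesgue_on (?A j \<times> ?B)) (\<lambda>(x, t). (norm (U j x))^2 * (\<lambda>z. (s * theta T (snd z))^3 * \<Psi> j (fst z) (snd z)) (x, t))"
    proof (rule integrable_times_bounded_continuous)
      show "integrable (lebesgue_on (?A j)) (\<lambda>x. (norm (U j x))^2)"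
        by (rule continuous_imp_integrable_Ioo) (intro continuous_intros cU[OF j])
      show "continuous_on (?A j \<times> ?B) (\<lambda>z. (s * theta T (snd z))^3 * \<Psi> j (fst z) (snd z))"
        by (intro continuous_intros cont\<theta> cont\<Psi>)
      show "\<bar>(s * theta T (snd z))^3 * \<Psi> j (fst z) (snd z)\<bar> \<le> (real 3 / (2 * - phase a b c j (?r j)))^3"
        if "z \<in> ?A j \<times> ?B" for z
        by (rule bound[OF j]) (use that in auto)
    qed
    moreover have "integrable (lebesgue_on (?A j \<times> ?B)) (\<lambda>(x, t). (norm (D j x))^2 * (\<lambda>z. (s * theta T (snd z))^1 * \<Psi> j (fst z) (snd z)) (x, t))"
    proof (rule integrable_times_bounded_continuous)
      show "integrable (lebesgue_on (?A j)) (\<lambda>x. (norm (D j x))^2)"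
        by (rule continuous_imp_integrable_Ioo) (intro continuous_intros cD[OF j])
      show "continuous_on (?A j \<times> ?B) (\<lambda>z. (s * theta T (snd z))^1 * \<Psi> j (fst z) (snd z))"
        by (intro continuous_intros cont\<theta> cont\<Psi>)
      show "\<bar>(s * theta T (snd z))^1 * \<Psi> j (fst z) (snd z)\<bar> \<le> (real 1 / (2 * - phase a b c j (?r j)))^1"
        if "z \<in> ?A j \<times> ?B" for z
        by (rule bound[OF j]) (use that in auto)
    qed
    ultimately have "integrable (lebesgue_on (?A j \<times> ?B)) (\<lambda>z.
        (case z of (x, t) \<Rightarrow> (norm (U j x))^2 * (\<lambda>z. (s * theta T (snd z))^3 * \<Psi> j (fst z) (snd z)) (x, t))
        + (case z of (x, t) \<Rightarrow> (norm (D j x))^2 * (\<lambda>z. (s * theta T (snd z))^1 * \<Psi> j (fst z) (snd z)) (x, t)))"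
      by (rule Bochner_Integration.integrable_add)
    moreover have "(\<lambda>z. (case z of (x, t) \<Rightarrow> (norm (U j x))^2 * (\<lambda>z. (s * theta T (snd z))^3 * \<Psi> j (fst z) (snd z)) (x, t))
        + (case z of (x, t) \<Rightarrow> (norm (D j x))^2 * (\<lambda>z. (s * theta T (snd z))^1 * \<Psi> j (fst z) (snd z)) (x, t)))
      = (\<lambda>(x, t). (s^3 * (theta T t)^3 * (norm (U j x))^2 + s * theta T t * (norm (D j x))^2) * \<Psi> j x t)"
      by (auto simp: fun_eq_iff algebra_simps power_mult_distrib)
    ultimately show ?thesis by simp
  qed
  have IF: "integrable (lebesgue_on (?A j \<times> ?B)) (\<lambda>(x, t). (norm (F j x))^2 * \<Psi> j x t)" if j: "j \<in> edges \<Lambda>" for j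
  proof -
    have "integrable (lebesgue_on (?A j \<times> ?B)) (\<lambda>(x, t). (norm (F j x))^2 * (\<lambda>z. \<Psi> j (fst z) (snd z)) (x, t))"
      by (rule integrable_times_bounded_continuous[where K = 1,
            OF helmholtz_profile_rhs_L2(2)[OF prof[OF j] pm[OF j]] cont\<Psi>], rule bound0[OF j]) auto
    then show ?thesis by simp
  qed
  have IB: "integrable (lebesgue_on ?B) (BT k)" for k
  proof -
    have "integrable (lebesgue_on ?B) (\<lambda>t. theta T t * (norm (D j (coord \<Lambda> k)))^2 * \<Psi> j (coord \<Lambda> k) t)"
      if jk: "j \<in> S_T \<Lambda> k \<union> S_I \<Lambda> k" for j
    proof -
      have "integrable (lebesgue_on ?B) (\<lambda>t. (s * theta T t) ^ 1 * \<Psi> j (coord \<Lambda> k) t)"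
      proof (rule integrable_bounded_continuous_Ioo)
        show "continuous_on ?B (\<lambda>t. (s * theta T t) ^ 1 * \<Psi> j (coord \<Lambda> k) t)"
          unfolding \<Psi>_def \<phi>_def weight_phase by (intro continuous_intros continuous_on_theta)
        show "\<bar>(s * theta T t) ^ 1 * \<Psi> j (coord \<Lambda> k) t\<bar> \<le> (real 1 / (2 * - phase a b c j (?r j))) ^ 1"
          if "t \<in> ?B" for t
          by (rule bound[OF coords(2)[OF jk] coords(1)[OF jk] that]) simp
      qed
      then have "integrable (lebesgue_on ?B) (\<lambda>t. ((norm (D j (coord \<Lambda> k)))^2 / s) * ((s * theta T t) ^ 1 * \<Psi> j (coord \<Lambda> k) t))"
        by (rule integrable_mult_right)
      then show ?thesis using s0 by (simp add: algebra_simps)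
    qed
    then show ?thesis unfolding BT_def[abs_def]
      by (intro Bochner_Integration.integrable_diff Bochner_Integration.integrable_sum) auto
  qed
  have FL: "integrable (lebesgue_on ?B) (LT j)"
    "(LINT z|lebesgue_on (?A j \<times> ?B). (case z of (x, t) \<Rightarrow> (s^3 * (theta T t)^3 * (norm (U j x))^2
      + s * theta T t * (norm (D j x))^2) * \<Psi> j x t)) = (LINT t|lebesgue_on ?B. LT j t)" if j: "j \<in> edges \<Lambda>" for j
    using Fubini_lebesgue_on(3,4)[OF sets IL[OF j]] by (simp_all add: LT_def[abs_def])
  have FF: "integrable (lebesgue_on ?B) (FT j)"
    "(LINT z|lebesgue_on (?A j \<times> ?B). (case z of (x, t) \<Rightarrow> (norm (F j x))^2 * \<Psi> j x t))
      = (LINT t|lebesgue_on ?B. FT j t)" if j: "j \<in> edges \<Lambda>" for j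
    using Fubini_lebesgue_on(3,4)[OF sets IF[OF j]] by (simp_all add: FT_def[abs_def])
  have "(LINT t|lebesgue_on ?B. (\<Sum>j\<in>edges \<Lambda>. LT j t))
      \<le> (LINT t|lebesgue_on ?B. C * ((\<Sum>j\<in>edges \<Lambda>. FT j t) + (\<Sum>k\<in>boundary_verts \<Lambda>. BT k t)))"
  proof (rule integral_mono)
    show "integrable (lebesgue_on ?B) (\<lambda>t. \<Sum>j\<in>edges \<Lambda>. LT j t)"
      by (intro Bochner_Integration.integrable_sum FL)
    show "integrable (lebesgue_on ?B) (\<lambda>t. C * ((\<Sum>j\<in>edges \<Lambda>. FT j t) + (\<Sum>k\<in>boundary_verts \<Lambda>. BT k t)))"
      by (intro integrable_mult_right Bochner_Integration.integrable_add Bochner_Integration.integrable_sum FF IB)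
  qed (use pointwise in simp)
  also have "\<dots> = C * ((\<Sum>j\<in>edges \<Lambda>. LINT t|lebesgue_on ?B. FT j t) + (\<Sum>k\<in>boundary_verts \<Lambda>. LINT t|lebesgue_on ?B. BT k t))"
    using FF(1) IB by (simp add: Bochner_Integration.integral_add Bochner_Integration.integral_sum)
  finally have main: "(\<Sum>j\<in>edges \<Lambda>. LINT t|lebesgue_on ?B. LT j t)
      \<le> C * ((\<Sum>j\<in>edges \<Lambda>. LINT t|lebesgue_on ?B. FT j t) + (\<Sum>k\<in>boundary_verts \<Lambda>. LINT t|lebesgue_on ?B. BT k t))"
    using FL(1) by (simp add: Bochner_Integration.integral_sum)
  have L: "(\<Sum>j\<in>edges \<Lambda>. LINT (x, t)|lebesgue_on (cyl \<Lambda> T j).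
              (s^3 * (theta T t)^3 * (norm (u j x t))^2 + s * theta T t * (norm (dx \<Lambda> u j x t))^2)
                * exp (2 * s * \<phi> j x t)) = (\<Sum>j\<in>edges \<Lambda>. LINT t|lebesgue_on ?B. LT j t)"
  proof (rule sum.cong[OF refl])
    fix j assume j: "j \<in> edges \<Lambda>"
    show "(LINT (x, t)|lebesgue_on (cyl \<Lambda> T j).
              (s^3 * (theta T t)^3 * (norm (u j x t))^2 + s * theta T t * (norm (dx \<Lambda> u j x t))^2)
                * exp (2 * s * \<phi> j x t)) = (LINT t|lebesgue_on ?B. LT j t)"
      unfolding FL(2)[OF j, symmetric] cyl_def
      by (rule Bochner_Integration.integral_cong[OF refl]) (auto simp: ndx[OF j] nu \<Psi>_def)
  qed
  have R: "(\<Sum>j\<in>edges \<Lambda>. LINT (x, t)|lebesgue_on (cyl \<Lambda> T j). (norm (f j x t))^2 * exp (2 * s * \<phi> j x t))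
      = (\<Sum>j\<in>edges \<Lambda>. LINT t|lebesgue_on ?B. FT j t)"
  proof (rule sum.cong[OF refl])
    fix j assume j: "j \<in> edges \<Lambda>"
    show "(LINT (x, t)|lebesgue_on (cyl \<Lambda> T j). (norm (f j x t))^2 * exp (2 * s * \<phi> j x t))
        = (LINT t|lebesgue_on ?B. FT j t)"
      unfolding FF(2)[OF j, symmetric] cyl_def
      by (rule Bochner_Integration.integral_cong[OF refl]) (auto simp: nf \<Psi>_def)
  qed
  have B: "boundary_term \<Lambda> T \<phi> u s = (\<Sum>k\<in>boundary_verts \<Lambda>. LINT t|lebesgue_on ?B. BT k t)"
  proof -
    have nd: "norm (dx \<Lambda> u j (coord \<Lambda> k) t) = norm (D j (coord \<Lambda> k))" if "j \<in> S_T \<Lambda> k \<union> S_I \<Lambda> k" for j k t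
      by (rule ndx[OF coords(2)[OF that] coords(1)[OF that]])
    show ?thesis
      unfolding boundary_term_def BT_def \<Psi>_def
      by (intro sum.cong refl Bochner_Integration.integral_cong arg_cong2[where f = minus]) (simp_all add: nd)
  qed
  show ?thesis using main unfolding L R B C_def .
qed

theorem theorem1:
  fixes \<Lambda> :: metric_graph and T M :: real and \<phi> :: "nat \<Rightarrow> real \<Rightarrow> real \<Rightarrow> real"
  assumes "metric_tree \<Lambda>" and "T > 0" and "weight_functions \<Lambda> T \<phi>"
  shows "\<exists>s0\<ge>0. \<exists>C>0. \<forall>(\<omega>::real) (\<phi>0::real) (p :: nat \<Rightarrow> real \<Rightarrow> complex)
           (F :: nat \<Rightarrow> real \<Rightarrow> complex) (U :: nat \<Rightarrow> real \<Rightarrow> complex)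
           (f :: nat \<Rightarrow> real \<Rightarrow> real \<Rightarrow> complex) (u :: nat \<Rightarrow> real \<Rightarrow> real \<Rightarrow> complex).
         \<omega> \<ge> 0 \<longrightarrow> p \<in> potentials \<Lambda> M \<longrightarrow>
         f = (\<lambda>j x t. F j x * exp (- \<i> * complex_of_real (\<omega> * t + \<phi>0))) \<longrightarrow>
         u = (\<lambda>j x t. U j x * exp (- \<i> * complex_of_real (\<omega> * t + \<phi>0))) \<longrightarrow>
         schroedinger_solution \<Lambda> T p f u \<longrightarrow>
         (\<forall>s>s0.
           (\<Sum>j\<in>edges \<Lambda>. LINT (x, t)|lebesgue_on (cyl \<Lambda> T j).
              (s^3 * (theta T t)^3 * (norm (u j x t))^2 + s * theta T t * (norm (dx \<Lambda> u j x t))^2)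
                * exp (2 * s * \<phi> j x t))
           \<le> C * ((\<Sum>j\<in>edges \<Lambda>. LINT (x, t)|lebesgue_on (cyl \<Lambda> T j).
                      (norm (f j x t))^2 * exp (2 * s * \<phi> j x t))
                    + boundary_term \<Lambda> T \<phi> u s))"
proof -
  obtain a b c where \<phi>: "\<phi> = weight T a b c" using assms(3) by (auto simp: weight_functions_def)
  note W = assms(3)[unfolded \<phi>]
  let ?l = "lft \<Lambda>" and ?r = "rgt \<Lambda>"
  have lr: "?l j < ?r j" if "j \<in> edges \<Lambda>" for j using ini_ter(2)[OF assms(1) that] .
  \<comment> \<open>\<open>n\<close> bounds the number of edges leaving a vertex\<close>
  define n where "n = real (card (edges \<Lambda>)) + 1"
  have n: "n \<ge> 1" "real (card (edges \<Lambda>)) \<le> n" by (simp_all add: n_def)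
  \<comment> \<open>the slope of \<open>\<psi>\<^sub>j\<close> is affine, so that its minimum over an edge is attained at an end point\<close>
  define \<mu> where "\<mu> = Min (insert 1 ((\<lambda>j. min (2 * a j * ?l j + b j) (2 * a j * ?r j + b j)) ` edges \<Lambda>))"
  have \<mu>: "\<mu> > 0"
    unfolding \<mu>_def using weight_functions_phase(3)[OF W assms(2)] lr
    by (subst Min_gr_iff) (auto simp: less_imp_le)
  have \<mu>le: "\<mu> \<le> 2 * a j * x + b j" if j: "j \<in> edges \<Lambda>" and x: "x \<in> {?l j..?r j}" for j x
  proof -
    have "\<mu> \<le> min (2 * a j * ?l j + b j) (2 * a j * ?r j + b j)"
      unfolding \<mu>_def using j by (intro Min_le) auto
    moreover have "a j * ?l j \<le> a j * x \<or> a j * ?r j \<le> a j * x"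
      using x by (cases "a j \<ge> 0") (auto intro: mult_left_mono mult_left_mono_neg)
    ultimately show ?thesis by auto
  qed
  define L where "L = (\<Sum>j\<in>edges \<Lambda>. ln n / (?r j - ?l j))"
  have L: "ln n / (?r j - ?l j) \<le> L" if "j \<in> edges \<Lambda>" for j
    unfolding L_def using that n(1) lr by (intro member_le_sum) (auto simp: less_imp_le)
  have L0: "L \<ge> 0"
    unfolding L_def using n(1) lr by (intro sum_nonneg divide_nonneg_nonneg) (auto simp: less_imp_le)
  \<comment> \<open>the summands serve the positivity of \<open>\<tau>\<close>, the additional weights and the potential\<close>
  define \<tau> where "\<tau> = (1 + 2 * L + 4 * (1 + \<bar>M\<bar>)) / \<mu>"
  have \<mu>\<tau>: "\<mu> * \<tau> = 1 + 2 * L + 4 * (1 + \<bar>M\<bar>)" using \<mu> by (simp add: \<tau>_def)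
  have \<tau>: "\<tau> > 0" using \<mu> L0 by (simp add: \<tau>_def)
  have \<tau>L: "2 * (ln n / (?r j - ?l j)) \<le> \<mu> * \<tau>" if "j \<in> edges \<Lambda>" for j
    using L[OF that] unfolding \<mu>\<tau> by simp
  have \<tau>M: "M \<le> (\<mu> * \<tau> / 4)^2"
  proof -
    have 1: "1 + \<bar>M\<bar> \<le> \<mu> * \<tau> / 4" using L0 unfolding \<mu>\<tau> by simp
    have "M \<le> \<mu> * \<tau> / 4" using 1 by simp
    also have "\<dots> \<le> (\<mu> * \<tau> / 4)^2" using 1 by (intro self_le_power) auto
    finally show ?thesis .
  qed
  define m where "m = min 1 ((\<mu> / 4)^2)"
  have m: "0 < m" "m \<le> 1" "m \<le> (\<mu> / 4)^2" using \<mu> by (simp_all add: m_def)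
  have s0_terms: "0 \<le> 2 / \<mu>" "0 \<le> T^2 * \<tau>" using \<mu> \<tau> by simp_all
  then have s0: "2 / \<mu> + T^2 * \<tau> \<ge> 0" by simp
  have C: "2 * n * T^2 / (m * \<mu>) > 0" using n(1) assms(2) m(1) \<mu> by simp
  show ?thesis
  proof (rule exI[of _ "2 / \<mu> + T^2 * \<tau>"], rule conjI[OF s0],
      rule exI[of _ "2 * n * T^2 / (m * \<mu>)"], rule conjI[OF C], intro allI impI)
    fix \<omega> \<phi>0 s :: real and p F U :: "nat \<Rightarrow> real \<Rightarrow> complex" and f u :: "nat \<Rightarrow> real \<Rightarrow> real \<Rightarrow> complex"
    assume \<omega>: "\<omega> \<ge> 0" and p: "p \<in> potentials \<Lambda> M"
      and f: "f = (\<lambda>j x t. F j x * exp (- \<i> * complex_of_real (\<omega> * t + \<phi>0)))"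
      and u: "u = (\<lambda>j x t. U j x * exp (- \<i> * complex_of_real (\<omega> * t + \<phi>0)))"
      and sol: "schroedinger_solution \<Lambda> T p f u" and s: "2 / \<mu> + T^2 * \<tau> < s"
    have s': "2 / \<mu> \<le> s" "T^2 * \<tau> \<le> s"
      using s s0_terms by linarith+
    show "(\<Sum>j\<in>edges \<Lambda>. LINT (x, t)|lebesgue_on (cyl \<Lambda> T j).
              (s^3 * (theta T t)^3 * (norm (u j x t))^2 + s * theta T t * (norm (dx \<Lambda> u j x t))^2)
                * exp (2 * s * \<phi> j x t))
           \<le> 2 * n * T^2 / (m * \<mu>) * ((\<Sum>j\<in>edges \<Lambda>. LINT (x, t)|lebesgue_on (cyl \<Lambda> T j).
                      (norm (f j x t))^2 * exp (2 * s * \<phi> j x t))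
                    + boundary_term \<Lambda> T \<phi> u s)"
      using time_harmonic_carleman_inequality[OF assms(1) W assms(2) \<omega> p sol[unfolded f u]
          \<mu> \<mu>le n \<tau> \<tau>L \<tau>M m s']
      unfolding f u \<phi> .
  qed
qed

end
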